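(* Let $r\ge 1$, let $\mu=(\mu_1,\mu_2,\ldots)$ be a partition of $r$, and let $\chi_r:=\sum_{i=0}^{r-1}\chi^{(r-i,1^i)}$, a sum of irreducible characters of the Iwahori--Hecke algebra $H_r(q)$. Then, writing $\chi_r(\mu)$ for the value of $\chi_r$ on the standard element $T_{\gamma_\mu}$, $$\chi_r(\mu)=2^{\ell(\mu)-1}\prod_{i=1}^{\ell(\mu)}[\mu_i]_{-q}.$$
   Context: Let $q$ be an indeterminate. The Iwahori--Hecke algebra $H_r(q)$ is the associative unital algebra over $\mathbb{C}(q)$ generated by $T_1,\ldots,T_{r-1}$ with relations $T_i^2=(1-q)T_i+q$, $T_iT_j=T_jT_i$ for $|i-j|\ge 2$, and $T_iT_{i+1}T_i=T_{i+1}T_iT_{i+1}$. It has basis $\{T_w : w\in\mathfrak{S}_r\}$ with $T_w=T_{i_1}\cdots T_{i_k}$ for any reduced expression $w=s_{i_1}\cdots s_{i_k}$. The irreducible representations of $H_r(q)$ are parameterized by partitions $\lambda\vdash r$; $\chi^\lambda$ denotes the corresponding character, namely the irreducible character whose values on the $T_w$ are polynomials in $q$ specializing at $q=1$ to the ordinary irreducible character of $\mathfrak{S}_r$ labelled by $\lambda$ (so $\chi^{(r)}(T_i)=1$ and $\chi^{(1^r)}(T_i)=-q$). For a partition $\mu$, $\ell(\mu)$ is its number of nonzero parts. For $\mu\vdash r$, the standard element is $T_{\gamma_\mu}=\prod_{i=1}^{\ell(\mu)}T_{a_{i-1}+1}T_{a_{i-1}+2}\cdots T_{a_i-1}$ with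 $a_0=0$, $a_i=a_{i-1}+\mu_i$; a factor with $\mu_i=1$ is $1$. $[k]_x:=\frac{x^k-1}{x-1}$, so $[k]_{-q}=\frac{1-(-q)^k}{1+q}$. *)

theory Defs
  imports
    "HOL-Algebra.QuotRing"
    "HOL-Computational_Algebra.Computational_Algebra"
    "HOL-Combinatorics.Permutations"
    "HOL-Library.Poly_Mapping"
    "HOL-Library.Function_Algebras"
    "Jordan_Normal_Form.VS_Connect"
begin

section \<open>Partitions and hooks\<close>

text \<open>Partitions are lists of their nonzero parts, so \<^term>\<open>length mu\<close> is $\ell(\mu)$.\<close>

definition partition_of :: "nat \<Rightarrow> nat list \<Rightarrow> bool" where
  "partition_of r mu \<longleftrightarrow> sorted_wrt (\<ge>) mu \<and> (\<forall>m\<in>set mu. 0 < m) \<and> sum_list mu = r"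

definition hook :: "nat \<Rightarrow> nat \<Rightarrow> nat list" where
  "hook r i = (r - i) # replicate i 1"


section \<open>The ordinary irreducible characters of the symmetric group\<close>

interpretation fun_space:
  Vector_Spaces.vector_space "\<lambda>(c::complex) (f::'b \<Rightarrow> complex) x. c * f x"
  by unfold_locales (auto simp: fun_eq_iff algebra_simps)

text \<open>The trace of a linear operator \<open>g\<close> on a finite-dimensional invariant subspace \<open>S\<close>;
  it does not depend on the basis that is chosen.\<close>

definition trace_on :: "('b \<Rightarrow> complex) set \<Rightarrow> (('b \<Rightarrow> complex) \<Rightarrow> ('b \<Rightarrow> complex)) \<Rightarrow> complex" where
  "trace_on S g =
    (let B = (SOME B. fun_space.independent B \<and> fun_space.span B = S)
     in \<Sum>b\<in>B. fun_space.representation B (g b) b)"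

definition diagram :: "nat list \<Rightarrow> (nat \<times> nat) set" where
  "diagram lam = {(i, j). i < length lam \<and> j < lam ! i}"

text \<open>A tableau of shape \<open>lam\<close> is encoded by the map sending each entry in \<open>{1..r}\<close> to its cell
  (row, column); \<open>p \<cdot> t\<close> is then \<^term>\<open>t \<circ> inv_into UNIV p\<close>. A tabloid (a tableau up to permutation within
  rows) is the map sending each entry to its row.\<close>

definition tableau :: "nat \<Rightarrow> nat list \<Rightarrow> (nat \<Rightarrow> nat \<times> nat) \<Rightarrow> bool" where
  "tableau r lam t \<longleftrightarrow> bij_betw t {1..r} (diagram lam)"

definition tabloid :: "nat \<Rightarrow> (nat \<Rightarrow> nat \<times> nat) \<Rightarrow> (nat \<Rightarrow> nat)" where
  "tabloid r t = restrict (fst \<circ> t) {1..r}"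

definition column_stabilizer :: "nat \<Rightarrow> (nat \<Rightarrow> nat \<times> nat) \<Rightarrow> (nat \<Rightarrow> nat) set" where
  "column_stabilizer r t = {p. p permutes {1..r} \<and> (\<forall>k\<in>{1..r}. snd (t (p k)) = snd (t k))}"

text \<open>Formal linear combinations of tabloids are functions on tabloids.\<close>

definition polytabloid :: "nat \<Rightarrow> (nat \<Rightarrow> nat \<times> nat) \<Rightarrow> (nat \<Rightarrow> nat) \<Rightarrow> complex" where
  "polytabloid r t =
    (\<lambda>x. \<Sum>p\<in>column_stabilizer r t. of_int (sign p) * of_bool (x = tabloid r (t \<circ> inv_into UNIV p)))"

definition specht_module :: "nat \<Rightarrow> nat list \<Rightarrow> ((nat \<Rightarrow> nat) \<Rightarrow> complex) set" where
  "specht_module r lam = fun_space.span (polytabloid r ` {t. tableau r lam t})"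

text \<open>\<open>w\<close> sends the tabloid \<open>x\<close> to \<^term>\<open>x \<circ> inv_into UNIV w\<close>, hence the function \<open>f\<close> to the following.\<close>

definition perm_act :: "(nat \<Rightarrow> nat) \<Rightarrow> ((nat \<Rightarrow> nat) \<Rightarrow> complex) \<Rightarrow> ((nat \<Rightarrow> nat) \<Rightarrow> complex)" where
  "perm_act w f = (\<lambda>x. f (x \<circ> w))"

definition sym_char :: "nat \<Rightarrow> nat list \<Rightarrow> (nat \<Rightarrow> nat) \<Rightarrow> complex" where
  "sym_char r lam w = trace_on (specht_module r lam) (perm_act w)"


section \<open>The Iwahori--Hecke algebra\<close>

type_synonym ratfun = "complex poly fract"

definition qq :: ratfun where
  "qq = to_fract [:0, 1:]"

definition qint :: "nat \<Rightarrow> ratfun \<Rightarrow> ratfun" where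
  "qint k x = (x ^ k - 1) / (x - 1)"

text \<open>Words, written additively so that \<open>\<Rightarrow>\<^sub>0\<close> supplies the convolution product:
  \<open>free_monoid \<Rightarrow>\<^sub>0 ratfun\<close> is the free associative algebra on countably many generators.\<close>

datatype free_monoid = Word (letters: "nat list")

instantiation free_monoid :: monoid_add
begin

definition zero_free_monoid :: free_monoid where
  "0 = Word []"

definition plus_free_monoid :: "free_monoid \<Rightarrow> free_monoid \<Rightarrow> free_monoid" where
  "x + y = Word (letters x @ letters y)"

instance
  by standard (auto simp: zero_free_monoid_def plus_free_monoid_def)

end

type_synonym free_alg = "free_monoid \<Rightarrow>\<^sub>0 ratfun"

abbreviation const :: "ratfun \<Rightarrow> free_alg" where
  "const c \<equiv> Poly_Mapping.single 0 c"

abbreviation gen :: "nat \<Rightarrow> free_alg" where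
  "gen i \<equiv> Poly_Mapping.single (Word [i]) 1"

definition free_algebra :: "nat \<Rightarrow> free_alg ring" where
  "free_algebra r =
    \<lparr>carrier = {p. \<forall>x\<in>Poly_Mapping.keys p. set (letters x) \<subseteq> {1..<r}},
     monoid.mult = (*), one = 1, zero = 0, add = (+)\<rparr>"

definition hecke_relators :: "nat \<Rightarrow> free_alg set" where
  "hecke_relators r =
    {gen i * gen i - (const (1 - qq) * gen i + const qq) | i. i \<in> {1..<r}} \<union>
    {gen i * gen j - gen j * gen i | i j. i \<in> {1..<r} \<and> j \<in> {1..<r} \<and> i + 2 \<le> j} \<union>
    {gen i * gen (i + 1) * gen i - gen (i + 1) * gen i * gen (i + 1) | i.
       i \<in> {1..<r} \<and> i + 1 \<in> {1..<r}}"

definition hecke_ideal :: "nat \<Rightarrow> free_alg set" where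
  "hecke_ideal r = genideal (free_algebra r) (hecke_relators r)"

definition hecke :: "nat \<Rightarrow> free_alg set ring" where
  "hecke r = free_algebra r Quot hecke_ideal r"

definition hecke_scalar :: "nat \<Rightarrow> ratfun \<Rightarrow> free_alg set" where
  "hecke_scalar r c = hecke_ideal r +>\<^bsub>free_algebra r\<^esub> const c"

definition hecke_T :: "nat \<Rightarrow> nat \<Rightarrow> free_alg set" where
  "hecke_T r i = hecke_ideal r +>\<^bsub>free_algebra r\<^esub> gen i"

definition hecke_word :: "nat \<Rightarrow> nat list \<Rightarrow> free_alg set" where
  "hecke_word r is = foldr (\<lambda>i h. hecke_T r i \<otimes>\<^bsub>hecke r\<^esub> h) is \<one>\<^bsub>hecke r\<^esub>"

definition word_perm :: "nat list \<Rightarrow> nat \<Rightarrow> nat" where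
  "word_perm is = foldr (\<lambda>i w. transpose i (i + 1) \<circ> w) is id"

definition reduced_word :: "nat \<Rightarrow> (nat \<Rightarrow> nat) \<Rightarrow> nat list \<Rightarrow> bool" where
  "reduced_word r w is \<longleftrightarrow>
    set is \<subseteq> {1..<r} \<and> word_perm is = w \<and>
    (\<forall>js. set js \<subseteq> {1..<r} \<and> word_perm js = w \<longrightarrow> length is \<le> length js)"

text \<open>By Matsumoto's theorem the choice of reduced expression is immaterial.\<close>

definition hecke_Tw :: "nat \<Rightarrow> (nat \<Rightarrow> nat) \<Rightarrow> free_alg set" where
  "hecke_Tw r w = hecke_word r (SOME is. reduced_word r w is)"

text \<open>Blocks are indexed from \<open>0\<close>: with $a_i = \mu_1 + \dots + \mu_i$, block \<open>i\<close> contributes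
  $T_{a_i+1} \cdots T_{a_{i+1}-1}$.\<close>

definition standard_element :: "nat \<Rightarrow> nat list \<Rightarrow> free_alg set" where
  "standard_element r mu =
    hecke_word r (concat (map (\<lambda>i. [sum_list (take i mu) + 1 ..< sum_list (take (i + 1) mu)])
                              [0..<length mu]))"


section \<open>Irreducible characters of the Iwahori--Hecke algebra\<close>

definition hecke_rep :: "nat \<Rightarrow> nat \<Rightarrow> (free_alg set \<Rightarrow> ratfun mat) \<Rightarrow> bool" where
  "hecke_rep r n \<rho> \<longleftrightarrow>
    \<rho> \<in> Ring.ring_hom (hecke r) (ring_mat TYPE(ratfun) n ()) \<and>
    (\<forall>c. \<rho> (hecke_scalar r c) = c \<cdot>\<^sub>m 1\<^sub>m n)"

definition irreducible_hecke_rep :: "nat \<Rightarrow> nat \<Rightarrow> (free_alg set \<Rightarrow> ratfun mat) \<Rightarrow> bool" where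
  "irreducible_hecke_rep r n \<rho> \<longleftrightarrow>
    hecke_rep r n \<rho> \<and> 0 < n \<and>
    (\<forall>U. VectorSpace.subspace class_ring U (module_vec TYPE(ratfun) n) \<and>
         (\<forall>h\<in>carrier (hecke r). \<forall>v\<in>U. \<rho> h *\<^sub>v v \<in> U)
         \<longrightarrow> U = {0\<^sub>v n} \<or> U = carrier_vec n)"

definition mat_trace :: "ratfun mat \<Rightarrow> ratfun" where
  "mat_trace A = (\<Sum>i<dim_row A. A $$ (i, i))"

definition irreducible_hecke_character :: "nat \<Rightarrow> (free_alg set \<Rightarrow> ratfun) \<Rightarrow> bool" where
  "irreducible_hecke_character r \<chi> \<longleftrightarrow>
    (\<exists>n \<rho>. irreducible_hecke_rep r n \<rho> \<and>
           \<chi> = restrict (\<lambda>h. mat_trace (\<rho> h)) (carrier (hecke r)))"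

definition hecke_char :: "nat \<Rightarrow> nat list \<Rightarrow> free_alg set \<Rightarrow> ratfun" where
  "hecke_char r lam =
    (THE \<chi>. irreducible_hecke_character r \<chi> \<and>
      (\<forall>w. w permutes {1..r} \<longrightarrow>
        (\<exists>p. \<chi> (hecke_Tw r w) = to_fract p \<and> poly p 1 = sym_char r lam w)))"

end

theory Submission
  imports Defs
begin

text \<open>
  Let \<open>V\<close> be the reflection representation of the Hecke algebra, of dimension \<open>r - 1\<close>: every
  \<open>T\<^sub>j\<close> acts on it with eigenvalue \<open>-q\<close> on a basis vector \<open>v\<^sub>j\<close> and with eigenvalue \<open>1\<close> on a
  hyperplane. The character of the hook with leg \<open>i\<close> is the trace on the exterior power
  \<open>\<Lambda>\<^sup>i V\<close>, so the sum over all hooks is the trace on the whole exterior algebra. That algebra has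
  one basis vector \<open>v\<^sub>S\<close> for each \<open>S \<subseteq> {1..r-1}\<close>, and a generator moves elements of \<open>S\<close> by one place
  without any sign:
  \<open>T\<^sub>j v\<^sub>S = - q v\<^sub>S\<close> if \<open>j \<in> S\<close>, and otherwise \<open>v\<^sub>S\<close> plus \<open>q\<close> times the vector with
  \<open>j-1\<close> moved to \<open>j\<close> plus the vector with \<open>j+1\<close> moved to \<open>j\<close>, as far as these elements exist.

  The trace of a standard element is found by removing its largest generator. If \<open>T\<^sub>n\<close> does not occur,
  the place \<open>n\<close> can be occupied or empty without effect on the trace, which gives a factor \<open>2\<close> for each
  boundary between blocks (\<open>total_char_spectator\<close>). If it occurs, the trace satisfies
  \<open>t\<^sub>n = (1 - q) t\<^sub>n\<^sub>-\<^sub>1 + q t\<^sub>n\<^sub>-\<^sub>2\<close> inside a block (\<open>total_char_extend_block\<close>), with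
  the last term absent at the start of a block (\<open>total_char_new_block\<close>). The roots of \<open>x\<^sup>2 = (1 - q) x + q\<close> are \<open>1\<close> and \<open>-q\<close>, so the block of size \<open>k\<close> contributes
  \<open>1 + (-q) + \<dots> + (-q)\<^sup>k\<^sup>-\<^sup>1\<close>, the \<open>q\<close>-integer of the statement.

  The larger part of the work is to see that these traces are the characters in the statement, which are
  singled out among the irreducible characters by the specialization \<open>q = 1\<close>
  (\<open>hecke_char_hook\<close>). Three facts are needed.

  \<^item> \<open>\<Lambda>\<^sup>i V\<close> is irreducible. The image of \<open>1 - T\<^sub>j\<close> is spanned by the \<open>v\<^sub>S\<close> with \<open>j \<in> S\<close>, so an
    endomorphism that commutes with all generators preserves every line \<open>v\<^sub>S\<close>; as the generators connect
    these lines, it is a scalar (\<open>hook_commutant\<close>). Schur's averaging over the basis \<open>T\<^sub>w\<close>, weighted by \<open>q\<close> to the power \<open>-\<ell>(w)\<close>, then produces all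
    matrix units, because a certain trace is nonzero at \<open>q = 1\<close>
    (\<open>schur_orthogonality\<close>, \<open>schur_hook_qq\<close>). Averaging makes sense by Matsumoto's theorem
    (\<open>matsumoto\<close>).

  \<^item> At \<open>q = 1\<close> its character is the Specht character of the hook (\<open>sym_char_hook\<close>). The wedge
    product of the vectors \<open>v\<^sub>s\<close>, \<open>s \<in> S\<close>, is written as a determinant on tabloids; for \<open>S = {1..i}\<close> it is a multiple
    of a polytabloid, and irreducibility at \<open>q = 1\<close> does the rest.

  \<^item> No other irreducible character has this specialization. Different irreducible characters are
    orthogonal (\<open>irreducible_characters_orthogonal\<close>); at \<open>q = 1\<close> orthogonality would make the norm of the
    Specht character vanish, but it does not (\<open>hook_char_norm\<close>).
\<close>

section \<open>Reduced words in the symmetric group\<close>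

lemma word_perm_Nil [simp]: "word_perm [] = id"
  by (simp add: word_perm_def)

lemma word_perm_Cons [simp]: "word_perm (j # js) = transpose j (j + 1) \<circ> word_perm js"
  by (simp add: word_perm_def)

lemma word_perm_append [simp]: "word_perm (is @ js) = word_perm is \<circ> word_perm js"
  by (induction "is") (simp_all add: o_assoc)

lemma comp_transpose_twice [simp]: "w \<circ> transpose j k \<circ> transpose j k = w"
  by (simp add: fun_eq_iff)

lemma transpose_simple_permutes: "(j::nat) \<in> {1..<r} \<Longrightarrow> transpose j (j + 1) permutes {1..r}"
  by (intro permutes_swap_id) auto

lemma word_perm_permutes: "set is \<subseteq> {1..<r} \<Longrightarrow> word_perm is permutes {1..r}"
proof (induction "is")
  case (Cons j js)
  then have "transpose j (j + 1) permutes {1..r}" "word_perm js permutes {1..r}"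
    using transpose_simple_permutes[of j r] by auto
  from permutes_compose[OF this(2,1)] show ?case by (simp only: word_perm_Cons)
qed (simp add: permutes_id)

lemma word_perm_rev: "word_perm (rev is) \<circ> word_perm is = id"
proof (induction "is")
  case (Cons j js)
  have "word_perm (rev (j # js)) \<circ> word_perm (j # js)
      = word_perm (rev js) \<circ> transpose j (j + 1) \<circ> transpose j (j + 1) \<circ> word_perm js"
    by (simp only: rev.simps word_perm_append word_perm_Cons word_perm_Nil comp_id o_assoc)
  then show ?case using Cons by (simp only: comp_transpose_twice)
qed simp

lemma word_perm_rev_eq_inv: "word_perm (rev is) = inv_into UNIV (word_perm is)"
  using inv_unique_comp[OF _ word_perm_rev] word_perm_rev[of "rev is"] by simp

definition inversions :: "nat \<Rightarrow> (nat \<Rightarrow> nat) \<Rightarrow> (nat \<times> nat) set" where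
  "inversions r w = {(a, b). a \<in> {1..r} \<and> b \<in> {1..r} \<and> a < b \<and> w b < w a}"

definition perm_length :: "nat \<Rightarrow> (nat \<Rightarrow> nat) \<Rightarrow> nat" where
  "perm_length r w = card (inversions r w)"

lemma finite_inversions: "finite (inversions r w)"
  by (rule finite_subset[of _ "{1..r} \<times> {1..r}"]) (auto simp: inversions_def)

lemma perm_length_id [simp]: "perm_length r id = 0"
proof -
  have "inversions r id = {}" by (auto simp: inversions_def)
  then show ?thesis by (simp add: perm_length_def)
qed

text \<open>A simple transposition preserves the order of all pairs of places except \<open>(j, j + 1)\<close>. It therefore
  maps the inversions of \<open>w\<close> to those of the product, and an ascent at \<open>j\<close> makes that pair a new one.\<close>

lemma perm_length_ascent:
  assumes "j \<in> {1..<r}" "w j < w (j + 1)"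
  shows "perm_length r (w \<circ> transpose j (j + 1)) = Suc (perm_length r w)"
proof -
  let ?s = "transpose j (j + 1)"
  let ?f = "map_prod ?s ?s"
  have inj: "inj ?f" by (simp add: prod.inj_map)
  have range_s: "?s a \<in> {1..r} \<longleftrightarrow> a \<in> {1..r}" for a
    using assms(1) by (auto simp: transpose_def)
  have order_s: "?s a < ?s b" if "a < b" "(a, b) \<noteq> (j, j + 1)" for a b
    using that by (auto simp: transpose_def)
  have "inversions r (w \<circ> ?s) = insert (j, j + 1) (?f ` inversions r w)" (is "?L = ?R")
  proof (intro equalityI subsetI)
    fix p assume p: "p \<in> ?L"
    obtain a b where ab: "p = (a, b)" by (cases p)
    show "p \<in> ?R"
    proof (cases "p = (j, j + 1)")
      case False
      have "(?s a, ?s b) \<in> inversions r w"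
        using p False order_s[of a b] range_s by (auto simp: ab inversions_def)
      moreover have "p = ?f (?s a, ?s b)" by (simp add: ab)
      ultimately show ?thesis by blast
    qed simp
  next
    fix p assume "p \<in> ?R"
    then consider "p = (j, j + 1)" | a b where "(a, b) \<in> inversions r w" "p = (?s a, ?s b)" by auto
    then show "p \<in> ?L"
    proof cases
      case 1
      then show ?thesis using assms by (auto simp: inversions_def)
    next
      case 2
      then have "(a, b) \<noteq> (j, j + 1)" using assms(2) by (auto simp: inversions_def)
      then show ?thesis using 2 order_s[of a b] range_s by (auto simp: inversions_def)
    qed
  qed
  moreover have "(j, j + 1) \<notin> ?f ` inversions r w"
  proof
    assume "(j, j + 1) \<in> ?f ` inversions r w"
    then obtain a b where "(a, b) \<in> inversions r w" "j = ?s a" "j + 1 = ?s b" by auto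
    then have "a = j + 1" "b = j" by (metis transpose_apply_second transpose_involutory, metis transpose_apply_second transpose_apply_first transpose_involutory)
    with \<open>(a, b) \<in> inversions r w\<close> show False by (simp add: inversions_def)
  qed
  ultimately show ?thesis
    using card_image[OF inj_on_subset[OF inj subset_UNIV], of "inversions r w"] finite_inversions[of r w]
    by (simp add: perm_length_def)
qed

lemma perm_length_descent:
  assumes "j \<in> {1..<r}" "w (j + 1) < w j"
  shows "Suc (perm_length r (w \<circ> transpose j (j + 1))) = perm_length r w"
  using perm_length_ascent[of j r "w \<circ> transpose j (j + 1)"] assms
  by simp

lemma perm_length_word_le: "set is \<subseteq> {1..<r} \<Longrightarrow> perm_length r (word_perm is) \<le> length is"
proof (induction "is" rule: rev_induct)
  case (snoc j js)
  let ?w = "word_perm js"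
  have j: "j \<in> {1..<r}" using snoc.prems by simp
  have "inj ?w"
    using snoc.prems word_perm_permutes[of js r] permutes_inj by auto
  then have "?w j \<noteq> ?w (j + 1)" by (simp add: inj_eq)
  then have "perm_length r (?w \<circ> transpose j (j + 1)) \<le> Suc (perm_length r ?w)"
    using perm_length_ascent[OF j, of ?w] perm_length_descent[OF j, of ?w] by linarith
  moreover have "perm_length r ?w \<le> length js" using snoc by simp
  moreover have "word_perm (js @ [j]) = ?w \<circ> transpose j (j + 1)"
    by (simp only: word_perm_append word_perm_Cons word_perm_Nil comp_id)
  ultimately have "perm_length r (word_perm (js @ [j])) \<le> Suc (length js)" by presburger
  then show ?case by (simp only: length_append_singleton)
qed simp

text \<open>Without descents the values increase strictly, so \<open>i \<le> w i\<close> everywhere.\<close>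

lemma no_descent_imp_id:
  fixes w :: "nat \<Rightarrow> nat"
  assumes w: "w permutes {1..r}" and asc: "\<And>j. j \<in> {1..<r} \<Longrightarrow> w j < w (j + 1)"
  shows "w = id"
proof -
  have "1 \<le> i \<Longrightarrow> i \<le> r \<Longrightarrow> i \<le> w i" for i
  proof (induction i)
    case (Suc n)
    show ?case
    proof (cases "n = 0")
      case True
      then show ?thesis using permutes_in_image[OF w, of 1] Suc.prems by simp
    next
      case False
      then have "n \<le> w n" "w n < w (n + 1)" using asc[of n] Suc by auto
      then show ?thesis by simp
    qed
  qed simp
  then show ?thesis using permutes_natset_ge[OF w] by auto
qed

text \<open>Removing descents one at a time sorts \<open>w\<close> in as many steps as it has inversions.\<close>

lemma ex_shortest_word:
  assumes "w permutes {1..r}"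
  shows "\<exists>is. set is \<subseteq> {1..<r} \<and> word_perm is = w \<and> length is = perm_length r w"
  using assms
proof (induction "perm_length r w" arbitrary: w)
  case 0
  have "w j < w (j + 1)" if j: "j \<in> {1..<r}" for j
  proof -
    have "w j \<noteq> w (j + 1)" using permutes_inj[OF 0(2)] by (simp add: inj_eq)
    moreover have "\<not> w (j + 1) < w j" using perm_length_descent[OF j, of w] 0(1) by auto
    ultimately show ?thesis by simp
  qed
  then have "w = id" using no_descent_imp_id[OF 0(2)] by blast
  then have "word_perm [] = w" "perm_length r w = 0" using 0(1) by (simp_all only: word_perm_Nil)
  then show ?case by (metis list.set(1) empty_subsetI list.size(3))
next
  case (Suc n)
  have "w \<noteq> id" using Suc(2) by auto
  then obtain j where j: "j \<in> {1..<r}" "\<not> w j < w (j + 1)"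
    using no_descent_imp_id[OF Suc(3)] by blast
  moreover have "w j \<noteq> w (j + 1)" using permutes_inj[OF Suc(3)] by (simp add: inj_eq)
  ultimately have desc: "w (j + 1) < w j" by simp
  let ?v = "w \<circ> transpose j (j + 1)"
  have "?v permutes {1..r}"
    using j(1) Suc(3) by (intro permutes_compose transpose_simple_permutes) auto
  moreover have "perm_length r ?v = n" using perm_length_descent[of j r w] j(1) desc Suc(2) by simp
  ultimately obtain js where "set js \<subseteq> {1..<r}" "word_perm js = ?v" "length js = n"
    using Suc(1) by metis
  then show ?case
    using j(1) Suc(2) by (intro exI[of _ "js @ [j]"]) (auto simp: o_assoc[symmetric])
qed

text \<open>This makes reducedness checkable: each letter changes the number of inversions by one.\<close>

lemma reduced_word_iff_length:
  "reduced_word r w is \<longleftrightarrow> set is \<subseteq> {1..<r} \<and> word_perm is = w \<and> length is = perm_length r w"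
  (is "?L \<longleftrightarrow> ?R")
proof
  assume L: ?L
  then have "w permutes {1..r}" using word_perm_permutes by (auto simp: reduced_word_def)
  then obtain js where "set js \<subseteq> {1..<r}" "word_perm js = w" "length js = perm_length r w"
    using ex_shortest_word by blast
  then show ?R using L perm_length_word_le[of "is" r] by (force simp: reduced_word_def)
next
  assume ?R
  then show ?L using perm_length_word_le[of _ r] unfolding reduced_word_def by metis
qed

lemma ex_reduced_word: "w permutes {1..r} \<Longrightarrow> \<exists>is. reduced_word r w is"
  using ex_shortest_word by (simp add: reduced_word_iff_length)

lemma reduced_word_rev:
  assumes "reduced_word r w is"
  shows "reduced_word r (inv_into UNIV w) (rev is)"
  unfolding reduced_word_def
proof (intro conjI allI impI)
  fix js assume js: "set js \<subseteq> {1..<r} \<and> word_perm js = inv_into UNIV w"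
  have w: "w permutes {1..r}" using assms word_perm_permutes by (auto simp: reduced_word_def)
  have "word_perm (rev js) = w"
    using js permutes_inv_inv[OF w] by (simp add: word_perm_rev_eq_inv)
  then have "length is \<le> length (rev js)" using js assms by (auto simp: reduced_word_def simp del: length_rev)
  then show "length (rev is) \<le> length js" by simp
qed (use assms in \<open>auto simp: reduced_word_def word_perm_rev_eq_inv\<close>)

lemma perm_length_inv:
  assumes "w permutes {1..r}"
  shows "perm_length r (inv_into UNIV w) = perm_length r w"
proof -
  obtain "is" where "reduced_word r w is" using ex_reduced_word[OF assms] by blast
  with reduced_word_rev[OF this] show ?thesis by (simp add: reduced_word_iff_length)
qed

lemma reduced_word_snoc:
  assumes "reduced_word r w is" "j \<in> {1..<r}" "w j < w (j + 1)"
  shows "reduced_word r (w \<circ> transpose j (j + 1)) (is @ [j])"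
  using assms perm_length_ascent[OF assms(2,3)] by (simp add: reduced_word_iff_length)

lemma reduced_word_butlast:
  assumes "reduced_word r w (is @ [j])"
  shows "reduced_word r (w \<circ> transpose j (j + 1)) is" "w (j + 1) < w j" "j \<in> {1..<r}"
proof -
  let ?v = "word_perm is"
  have w: "w = ?v \<circ> transpose j (j + 1)" "length is + 1 = perm_length r w"
    and "is": "set is \<subseteq> {1..<r}" and j: "j \<in> {1..<r}"
    using assms by (auto simp: reduced_word_iff_length)
  have v: "w \<circ> transpose j (j + 1) = ?v" by (simp add: w(1) o_assoc[symmetric])
  have le: "perm_length r ?v \<le> length is" using perm_length_word_le[OF "is"] .
  have "inj ?v" using "is" word_perm_permutes permutes_inj by blast
  then have "?v j \<noteq> ?v (j + 1)" by (simp add: inj_eq)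
  moreover have "\<not> ?v (j + 1) < ?v j"
    using perm_length_descent[OF j, of ?v] le w by auto
  ultimately have asc: "?v j < ?v (j + 1)" by simp
  then show "w (j + 1) < w j" by (simp add: w(1))
  show "j \<in> {1..<r}" by fact
  have "perm_length r ?v = length is" using perm_length_ascent[OF j asc] w by simp
  then show "reduced_word r (w \<circ> transpose j (j + 1)) is"
    using "is" v by (simp add: reduced_word_iff_length)
qed

lemma reduced_word_descent:
  assumes "w permutes {1..r}" "j \<in> {1..<r}" "w (j + 1) < w j"
    and "reduced_word r (w \<circ> transpose j (j + 1)) is"
  shows "reduced_word r w (is @ [j])"
  using reduced_word_snoc[OF assms(4,2)] assms(3) by simp

text \<open>The function \<open>E\<close> stands for any evaluation of words that respects the braid relations. The induction
  is on the length of \<open>w\<close>. If two reduced words end in different letters \<open>i\<close> and \<open>j\<close>, then \<open>w\<close> has descents at both places, so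
  it also has a reduced word that ends in the longest word in \<open>i\<close> and \<open>j\<close>. The two forms of that ending are
  related by one braid or commutation relation, and each of them shares its last letter with one of the given words.\<close>

theorem matsumoto:
  fixes E :: "nat list \<Rightarrow> 'b"
  assumes cong: "\<And>u v j. j \<in> {1..<r} \<Longrightarrow> set u \<subseteq> {1..<r} \<Longrightarrow> set v \<subseteq> {1..<r} \<Longrightarrow> E u = E v \<Longrightarrow> E (u @ [j]) = E (v @ [j])"
    and comm: "\<And>u i j. set u \<subseteq> {1..<r} \<Longrightarrow> i \<in> {1..<r} \<Longrightarrow> j \<in> {1..<r} \<Longrightarrow> i + 2 \<le> j \<Longrightarrow>
                 E (u @ [i, j]) = E (u @ [j, i])"
    and braid: "\<And>u i. set u \<subseteq> {1..<r} \<Longrightarrow> i \<in> {1..<r} \<Longrightarrow> i + 1 \<in> {1..<r} \<Longrightarrow>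
                 E (u @ [i, i + 1, i]) = E (u @ [i + 1, i, i + 1])"
    and "reduced_word r w is" "reduced_word r w js"
  shows "E is = E js"
  using assms(4,5)
proof (induction "perm_length r w" arbitrary: w "is" js)
  case 0
  then have "is = []" "js = []" by (auto simp: reduced_word_iff_length)
  then show ?case by simp
next
  case (Suc n)
  have len: "length is = Suc n" "length js = Suc n"
    using Suc by (auto simp: reduced_word_iff_length)
  obtain u i where ui: "is = u @ [i]" using len(1) by (cases "is" rule: rev_cases) auto
  obtain v j where vj: "js = v @ [j]" using len(2) by (cases js rule: rev_cases) auto
  have w: "w permutes {1..r}" using Suc.prems(1) word_perm_permutes by (auto simp: reduced_word_def)
  let ?s = "\<lambda>i. transpose i (i + 1) :: nat \<Rightarrow> nat"
  note ru = reduced_word_butlast[OF Suc.prems(1)[unfolded ui]]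
  note rv = reduced_word_butlast[OF Suc.prems(2)[unfolded vj]]
  have sub: "set x \<subseteq> {1..<r}" if "reduced_word r y x" for x y
    using that by (simp add: reduced_word_def)
  have perm_s: "x \<circ> ?s k permutes {1..r}" if "x permutes {1..r}" "k \<in> {1..<r}" for x k
    using that by (intro permutes_compose transpose_simple_permutes) auto
  have IH: "E (x @ [k]) = E (y @ [k])"
    if "reduced_word r (w \<circ> ?s k) x" "reduced_word r (w \<circ> ?s k) y" "k \<in> {1..<r}" "w (k + 1) < w k" for x y k
  proof -
    have "n = perm_length r (w \<circ> ?s k)"
      using perm_length_descent[of k r w] that Suc.hyps(2) by simp
    from Suc.hyps(1)[OF this that(1,2)] have "E x = E y" .
    then show ?thesis using cong[OF that(3) sub[OF that(1)] sub[OF that(2)]] by blast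
  qed
  have key: "E is = E js" if "i < j" "is = u @ [i]" "js = v @ [j]"
     "reduced_word r (w \<circ> ?s i) u" "w (i + 1) < w i" "i \<in> {1..<r}"
     "reduced_word r (w \<circ> ?s j) v" "w (j + 1) < w j" "j \<in> {1..<r}" for i j u v "is" js
  proof -
    note hyps = that
    show ?thesis
  proof (cases "i + 2 \<le> j")
    case True
    have lt: "(w \<circ> ?s i) (j + 1) < (w \<circ> ?s i) j" using that True by (simp add: transpose_def)
    obtain x where x: "reduced_word r (w \<circ> ?s i \<circ> ?s j) x"
      using ex_reduced_word[OF perm_s[OF perm_s[OF w hyps(6)] hyps(9)]] by blast
    from reduced_word_descent[OF perm_s[OF w hyps(6)] hyps(9) lt x]
    have A: "reduced_word r (w \<circ> ?s i) (x @ [j])" .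
    have "?s i \<circ> ?s j = ?s j \<circ> ?s i" using True by (auto simp: fun_eq_iff transpose_def)
    then have x': "reduced_word r (w \<circ> ?s j \<circ> ?s i) x" using x by (simp only: o_assoc[symmetric])
    have lt': "(w \<circ> ?s j) (i + 1) < (w \<circ> ?s j) i" using that True by (simp add: transpose_def)
    from reduced_word_descent[OF perm_s[OF w hyps(9)] hyps(6) lt' x']
    have B: "reduced_word r (w \<circ> ?s j) (x @ [i])" .
    have "E is = E ((x @ [j]) @ [i])" using IH[OF that(4) A that(6,5)] that(2) by simp
    also have "\<dots> = E ((x @ [i]) @ [j])" using comm[OF sub[OF x] that(6,9) True] by simp
    also have "\<dots> = E js" using IH[OF that(7) B that(9,8)] that(3) by simp
    finally show ?thesis .
  next
    case False
    with that(1) have j: "j = i + 1" by simp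
    let ?x = "w \<circ> ?s i \<circ> ?s j \<circ> ?s i"
    have "?x permutes {1..r}" by (intro perm_s w hyps(6,9))
    then obtain x where x: "reduced_word r ?x x" using ex_reduced_word by metis
    have "?s i \<circ> ?s j \<circ> ?s i = ?s j \<circ> ?s i \<circ> ?s j" by (auto simp: fun_eq_iff transpose_def j)
    then have x': "reduced_word r (w \<circ> ?s j \<circ> ?s i \<circ> ?s j) x" using x by (simp only: o_assoc[symmetric])
    have lt: "(w \<circ> ?s i \<circ> ?s j) (i + 1) < (w \<circ> ?s i \<circ> ?s j) i" "(w \<circ> ?s i) (j + 1) < (w \<circ> ?s i) j"
      "(w \<circ> ?s j \<circ> ?s i) (j + 1) < (w \<circ> ?s j \<circ> ?s i) j" "(w \<circ> ?s j) (i + 1) < (w \<circ> ?s j) i"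
      using hyps(5,8) by (simp_all add: transpose_def j)
    have wi: "w \<circ> ?s i permutes {1..r}" and wj: "w \<circ> ?s j permutes {1..r}"
      by (intro perm_s w hyps(6,9))+
    have A: "reduced_word r (w \<circ> ?s i) ((x @ [i]) @ [j])"
      by (rule reduced_word_descent[OF wi hyps(9) lt(2) reduced_word_descent[OF perm_s[OF wi hyps(9)] hyps(6) lt(1) x]])

    have B: "reduced_word r (w \<circ> ?s j) ((x @ [j]) @ [i])"
      by (rule reduced_word_descent[OF wj hyps(6) lt(4) reduced_word_descent[OF perm_s[OF wj hyps(6)] hyps(9) lt(3) x']])

    have "E is = E (((x @ [i]) @ [j]) @ [i])" using IH[OF that(4) A that(6,5)] that(2) by simp
    also have "\<dots> = E (((x @ [j]) @ [i]) @ [j])" using braid[OF sub[OF x] that(6)] that(9) j by simp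
    also have "\<dots> = E js" using IH[OF that(7) B that(9,8)] that(3) by simp
    finally show ?thesis .
  qed
  qed
  consider "i = j" | "i < j" | "j < i" by linarith
  then show ?case
  proof cases
    case 1
    then show ?thesis using IH[OF ru(1) _ ru(3,2), of v] rv(1) by (simp only: ui vj)
  next
    case 2
    then show ?thesis using key[OF _ ui vj ru(1,2,3) rv(1,2,3)] by blast
  next
    case 3
    then show ?thesis using key[OF _ vj ui rv(1,2,3) ru(1,2,3)] by simp
  qed
qed

lemma ascents_bij_descents:
  fixes j r :: nat
  assumes j: "j \<in> {1..<r}"
  shows "bij_betw (\<lambda>w. w \<circ> transpose j (j + 1))
    {w. w permutes {1..r} \<and> w j < w (j + 1)} {w. w permutes {1..r} \<and> \<not> w j < w (j + 1)}"
proof -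
  let ?s = "transpose j (j + 1)"
  have perm: "w \<circ> ?s permutes {1..r}" and ne: "w j \<noteq> w (j + 1)" if "w permutes {1..r}" for w :: "nat \<Rightarrow> nat"
    using permutes_compose[OF transpose_simple_permutes[OF j] that] permutes_inj[OF that] by (simp_all add: inj_eq)
  have val: "(w \<circ> ?s) j = w (j + 1)" "(w \<circ> ?s) (j + 1) = w j" for w :: "nat \<Rightarrow> nat" by simp_all
  show ?thesis
  proof (rule bij_betw_byWitness[where f' = "\<lambda>w. w \<circ> ?s"])
    show "(\<lambda>w. w \<circ> ?s) ` {w. w permutes {1..r} \<and> \<not> w j < w (j + 1)} \<subseteq> {w. w permutes {1..r} \<and> w j < w (j + 1)}"
    proof (intro image_subsetI CollectI conjI)
      fix w assume "w \<in> {w. w permutes {1..r} \<and> \<not> w j < w (j + 1)}"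
      then have w: "w permutes {1..r}" "\<not> w j < w (j + 1)" by auto
      show "w \<circ> ?s permutes {1..r}" using perm w by blast
      show "(w \<circ> ?s) j < (w \<circ> ?s) (j + 1)" using ne[OF w(1)] w(2) unfolding val by linarith
    qed
    show "(\<lambda>w. w \<circ> ?s) ` {w. w permutes {1..r} \<and> w j < w (j + 1)} \<subseteq> {w. w permutes {1..r} \<and> \<not> w j < w (j + 1)}"
    proof (intro image_subsetI CollectI conjI)
      fix w assume "w \<in> {w. w permutes {1..r} \<and> w j < w (j + 1)}"
      then have w: "w permutes {1..r}" "w j < w (j + 1)" by auto
      show "w \<circ> ?s permutes {1..r}" using perm w by blast
      show "\<not> (w \<circ> ?s) j < (w \<circ> ?s) (j + 1)" using w(2) unfolding val by linarith
    qed
  qed simp_all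
qed

text \<open>Schur's averaging is checked on the pairs formed by \<open>w\<close> and its product with a generator, with \<open>w\<close> the shorter of the two.\<close>

lemma sum_permutations_ascents:
  fixes g :: "(nat \<Rightarrow> nat) \<Rightarrow> 'a::comm_monoid_add" and j r :: nat
  assumes j: "j \<in> {1..<r}"
  shows "(\<Sum>w | w permutes {1..r}. g w) =
    (\<Sum>w | w permutes {1..r} \<and> w j < w (j + 1). g w + g (w \<circ> transpose j (j + 1)))"
proof -
  have fin: "finite {w. w permutes {1..r} \<and> P w}" for P
    by (rule finite_subset[OF _ finite_permutations[of "{1..r}"]]) auto
  have split: "{w. w permutes {1..r}} = {w. w permutes {1..r} \<and> w j < w (j + 1)} \<union> {w. w permutes {1..r} \<and> \<not> w j < w (j + 1)}"
    by blast
  have "(\<Sum>w | w permutes {1..r}. g w) = (\<Sum>w | w permutes {1..r} \<and> w j < w (j + 1). g w)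
     + (\<Sum>w | w permutes {1..r} \<and> \<not> w j < w (j + 1). g w)"
    unfolding split by (rule sum.union_disjoint[OF fin fin]) blast
  also have "(\<Sum>w | w permutes {1..r} \<and> \<not> w j < w (j + 1). g w) =
     (\<Sum>w | w permutes {1..r} \<and> w j < w (j + 1). g (w \<circ> transpose j (j + 1)))"
    by (rule sum.reindex_bij_betw[OF ascents_bij_descents[OF j], symmetric])
  finally show ?thesis by (simp only: sum.distrib)
qed

section \<open>Schur orthogonality for matrices with the Hecke relations\<close>

lemma mult_mat_entry:
  assumes "A \<in> carrier_mat a b" "B \<in> carrier_mat b c" "i < a" "j < c"
  shows "(A * B) $$ (i, j) = (\<Sum>k<b. A $$ (i, k) * B $$ (k, j))"
  using assms by (simp add: scalar_prod_def atLeast0LessThan)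

definition word_mat :: "nat \<Rightarrow> (nat \<Rightarrow> 'a::comm_ring_1 mat) \<Rightarrow> nat list \<Rightarrow> 'a mat" where
  "word_mat n A is = foldr (\<lambda>j M. A j * M) is (1\<^sub>m n)"

lemma word_mat_Nil [simp]: "word_mat n A [] = 1\<^sub>m n"
  and word_mat_Cons [simp]: "word_mat n A (j # js) = A j * word_mat n A js"
  by (simp_all add: word_mat_def)

definition trace_mat :: "'a::comm_ring_1 mat \<Rightarrow> 'a" where
  "trace_mat A = (\<Sum>i<dim_row A. A $$ (i, i))"

lemma trace_mat_comm:
  assumes "A \<in> carrier_mat n m" "B \<in> carrier_mat m n"
  shows "trace_mat (A * B) = trace_mat (B * A)"
proof -
  have "trace_mat (A * B) = (\<Sum>i<n. \<Sum>k<m. A $$ (i, k) * B $$ (k, i))"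
    using assms mult_mat_entry[OF assms] by (simp add: trace_mat_def)
  also have "\<dots> = (\<Sum>k<m. \<Sum>i<n. B $$ (k, i) * A $$ (i, k))"
    by (subst sum.swap) (simp add: mult.commute)
  also have "\<dots> = trace_mat (B * A)"
    using assms mult_mat_entry[OF assms(2,1)] by (simp add: trace_mat_def)
  finally show ?thesis .
qed

lemma sum_swap3: "(\<Sum>w\<in>W. \<Sum>k\<in>K. \<Sum>l\<in>L. f w k l) = (\<Sum>k\<in>K. \<Sum>l\<in>L. \<Sum>w\<in>W. f w k l)"
  by (subst sum.swap, rule sum.cong[OF refl], rule sum.swap)

text \<open>A matrix representation of the Hecke algebra, given by the images of the generators. The parameter may
  lie in any commutative ring, so that \<open>q\<close> can be an indeterminate or \<open>1\<close>.\<close>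

locale hecke_matrices =
  fixes q :: "'a::comm_ring_1" and r n :: nat and A :: "nat \<Rightarrow> 'a mat"
  assumes carrier: "j \<in> {1..<r} \<Longrightarrow> A j \<in> carrier_mat n n"
    and quadratic: "j \<in> {1..<r} \<Longrightarrow> A j * A j = (1 - q) \<cdot>\<^sub>m A j + q \<cdot>\<^sub>m 1\<^sub>m n"
    and commutation: "i \<in> {1..<r} \<Longrightarrow> j \<in> {1..<r} \<Longrightarrow> i + 2 \<le> j \<Longrightarrow> A i * A j = A j * A i"
    and braid: "i \<in> {1..<r} \<Longrightarrow> i + 1 \<in> {1..<r} \<Longrightarrow> A i * A (i + 1) * A i = A (i + 1) * A i * A (i + 1)"
begin

lemma word_mat_carrier: "set is \<subseteq> {1..<r} \<Longrightarrow> word_mat n A is \<in> carrier_mat n n"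
proof (induction "is")
  case (Cons j js)
  then have "A j \<in> carrier_mat n n" "word_mat n A js \<in> carrier_mat n n" using carrier by auto
  then show ?case by simp
qed simp

lemma word_mat_append:
  assumes "set is \<subseteq> {1..<r}" "set js \<subseteq> {1..<r}"
  shows "word_mat n A (is @ js) = word_mat n A is * word_mat n A js"
  using assms(1)
proof (induction "is")
  case (Cons j "is")
  then have "A j \<in> carrier_mat n n" "word_mat n A is \<in> carrier_mat n n"
    using carrier word_mat_carrier by auto
  then show ?case using Cons word_mat_carrier[OF assms(2)] by simp
qed (simp add: left_mult_one_mat[OF word_mat_carrier[OF assms(2)]])

lemma word_mat_snoc:
  assumes "set is \<subseteq> {1..<r}" "j \<in> {1..<r}"
  shows "word_mat n A (is @ [j]) = word_mat n A is * A j"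
  using word_mat_append[OF assms(1), of "[j]"] assms(2) carrier[OF assms(2)] by simp

text \<open>The image of \<open>T\<^sub>w\<close>.\<close>

definition perm_mat :: "(nat \<Rightarrow> nat) \<Rightarrow> 'a mat" where
  "perm_mat w = word_mat n A (SOME is. reduced_word r w is)"

lemma word_mat_reduced:
  assumes "reduced_word r w is"
  shows "word_mat n A is = perm_mat w"
  unfolding perm_mat_def
proof (rule matsumoto[where r = r])
  fix u v j assume "j \<in> {1..<r}" "set u \<subseteq> {1..<r}" "set v \<subseteq> {1..<r}" "word_mat n A u = word_mat n A v"
  then show "word_mat n A (u @ [j]) = word_mat n A (v @ [j])" by (simp only: word_mat_snoc)
next
  fix u i j assume u: "set u \<subseteq> {1..<r}" and ij: "i \<in> {1..<r}" "j \<in> {1..<r}" and "i + 2 \<le> j"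
  then have "A i * A j = A j * A i" using commutation by blast
  then have "word_mat n A [i, j] = word_mat n A [j, i]" using carrier[OF ij(1)] carrier[OF ij(2)] by simp
  moreover have "set [i, j] \<subseteq> {1..<r}" "set [j, i] \<subseteq> {1..<r}" using ij by auto
  ultimately show "word_mat n A (u @ [i, j]) = word_mat n A (u @ [j, i])"
    using u by (simp only: word_mat_append)
next
  fix u i assume u: "set u \<subseteq> {1..<r}" and ij: "i \<in> {1..<r}" "i + 1 \<in> {1..<r}"
  from braid[OF ij] have "word_mat n A [i, i + 1, i] = word_mat n A [i + 1, i, i + 1]"
    using carrier[OF ij(1)] carrier[OF ij(2)] by simp
  moreover have "set [i, i + 1, i] \<subseteq> {1..<r}" "set [i + 1, i, i + 1] \<subseteq> {1..<r}" using ij by auto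
  ultimately show "word_mat n A (u @ [i, i + 1, i]) = word_mat n A (u @ [i + 1, i, i + 1])"
    using u by (simp only: word_mat_append)
next
  show "reduced_word r w is" by fact
  then show "reduced_word r w (SOME is. reduced_word r w is)" by (rule someI)
qed

lemma perm_mat_carrier: "w permutes {1..r} \<Longrightarrow> perm_mat w \<in> carrier_mat n n"
proof -
  assume "w permutes {1..r}"
  then obtain "is" where red: "reduced_word r w is" using ex_reduced_word by blast
  then have "set is \<subseteq> {1..<r}" by (simp add: reduced_word_def)
  from word_mat_carrier[OF this] show ?thesis by (simp only: word_mat_reduced[OF red])
qed

text \<open>The action of a generator on \<open>T\<^sub>w\<close> from the right, and on the image of the inverse from the left:
  along an ascent the length increases, and back along it the quadratic relation enters.\<close>

lemma perm_mat_ascent: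
  assumes w: "w permutes {1..r}" and j: "j \<in> {1..<r}" and asc: "w j < w (j + 1)"
  defines "v \<equiv> w \<circ> transpose j (j + 1)"
  shows "perm_mat v = perm_mat w * A j"
    and "perm_mat (inv_into UNIV v) = A j * perm_mat (inv_into UNIV w)"
    and "perm_mat v * A j = (1 - q) \<cdot>\<^sub>m perm_mat v + q \<cdot>\<^sub>m perm_mat w"
    and "A j * perm_mat (inv_into UNIV v) = (1 - q) \<cdot>\<^sub>m perm_mat (inv_into UNIV v) + q \<cdot>\<^sub>m perm_mat (inv_into UNIV w)"
proof -
  obtain "is" where red: "reduced_word r w is" using ex_reduced_word[OF w] by blast
  then have sub: "set is \<subseteq> {1..<r}" by (simp add: reduced_word_def)
  have red': "reduced_word r v (is @ [j])" unfolding v_def using reduced_word_snoc[OF red j asc] .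
  show *: "perm_mat v = perm_mat w * A j"
    using word_mat_reduced[OF red] word_mat_reduced[OF red'] word_mat_snoc[OF sub j] by simp
  show **: "perm_mat (inv_into UNIV v) = A j * perm_mat (inv_into UNIV w)"
    using word_mat_reduced[OF reduced_word_rev[OF red]] word_mat_reduced[OF reduced_word_rev[OF red']] by simp
  have P: "perm_mat w \<in> carrier_mat n n" "perm_mat (inv_into UNIV w) \<in> carrier_mat n n"
    using perm_mat_carrier w permutes_inv[OF w] by auto
  note c = carrier[OF j]
  have "perm_mat v * A j = perm_mat w * (A j * A j)" using * P c by simp
  also have "\<dots> = perm_mat w * ((1 - q) \<cdot>\<^sub>m A j) + perm_mat w * (q \<cdot>\<^sub>m 1\<^sub>m n)"
    unfolding quadratic[OF j] using P c by (intro mult_add_distrib_mat[of _ n n _ n]) auto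
  also have "perm_mat w * ((1 - q) \<cdot>\<^sub>m A j) = (1 - q) \<cdot>\<^sub>m perm_mat v"
    using * mult_smult_distrib[OF P(1) c] by simp
  also have "perm_mat w * (q \<cdot>\<^sub>m 1\<^sub>m n) = q \<cdot>\<^sub>m perm_mat w"
    using mult_smult_distrib[OF P(1) one_carrier_mat] P by simp
  finally show "perm_mat v * A j = (1 - q) \<cdot>\<^sub>m perm_mat v + q \<cdot>\<^sub>m perm_mat w" .
  have "A j * perm_mat (inv_into UNIV v) = A j * A j * perm_mat (inv_into UNIV w)" using ** P c by simp
  also have "\<dots> = ((1 - q) \<cdot>\<^sub>m A j) * perm_mat (inv_into UNIV w) + (q \<cdot>\<^sub>m 1\<^sub>m n) * perm_mat (inv_into UNIV w)"
    unfolding quadratic[OF j] using P c by (intro add_mult_distrib_mat[of _ n n]) auto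
  also have "((1 - q) \<cdot>\<^sub>m A j) * perm_mat (inv_into UNIV w) = (1 - q) \<cdot>\<^sub>m perm_mat (inv_into UNIV v)"
    using ** mult_smult_assoc_mat[OF c P(2)] by simp
  also have "(q \<cdot>\<^sub>m 1\<^sub>m n) * perm_mat (inv_into UNIV w) = q \<cdot>\<^sub>m perm_mat (inv_into UNIV w)"
    using mult_smult_assoc_mat[OF one_carrier_mat P(2)] P by simp
  finally show "A j * perm_mat (inv_into UNIV v) = (1 - q) \<cdot>\<^sub>m perm_mat (inv_into UNIV v) + q \<cdot>\<^sub>m perm_mat (inv_into UNIV w)" .
qed

end

text \<open>The entry \<open>(k, l)\<close> of the average of the matrix unit \<open>E\<close> with its one at \<open>(a, b)\<close>, that is, of the sum of
  \<open>B(T\<^sub>w') E A(T\<^sub>w)\<close> with \<open>w'\<close> inverse to \<open>w\<close>. The weight \<open>q\<close> to the power \<open>-\<ell>(w)\<close> comes from the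
  symmetrizing trace of the Hecke algebra, for which \<open>T\<^sub>w\<close> and \<open>T\<^sub>w'\<close> are dual up to this scalar.\<close>

definition schur_sum :: "'a::field \<Rightarrow> nat \<Rightarrow> nat \<Rightarrow> (nat \<Rightarrow> 'a mat) \<Rightarrow> nat \<Rightarrow> (nat \<Rightarrow> 'a mat)
    \<Rightarrow> nat \<Rightarrow> nat \<Rightarrow> nat \<Rightarrow> nat \<Rightarrow> 'a" where
  "schur_sum q r m B n A k a b l = (\<Sum>w | w permutes {1..r}. inverse q ^ perm_length r w *
     (hecke_matrices.perm_mat r m B (inv_into UNIV w) $$ (k, a) * hecke_matrices.perm_mat r n A w $$ (b, l)))"

text \<open>In the sum over a pair \<open>w\<close>, \<open>v\<close> with \<open>v\<close> longer by one generator, both sides become the same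
  expression in the four matrices that belong to \<open>w\<close> and \<open>v\<close>; the weights \<open>q\<close> and the quadratic relation cancel.\<close>

theorem schur_sum_intertwines:
  fixes q :: "'a::field"
  assumes A: "hecke_matrices q r n A" and B: "hecke_matrices q r m B"
    and q: "q \<noteq> 0" and a: "a < m" and b: "b < n" and j: "j \<in> {1..<r}"
  defines "M \<equiv> mat m n (\<lambda>(k, l). schur_sum q r m B n A k a b l)"
  shows "B j * M = M * A j"
proof -
  interpret A: hecke_matrices q r n A by fact
  interpret B: hecke_matrices q r m B by fact
  let ?c = "\<lambda>w. inverse q ^ perm_length r w"
  let ?i = "inv_into UNIV :: (nat \<Rightarrow> nat) \<Rightarrow> nat \<Rightarrow> nat"
  note Aj = A.carrier[OF j] and Bj = B.carrier[OF j]
  have M: "M \<in> carrier_mat m n" by (simp add: M_def)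
  show ?thesis
  proof (rule eq_matI)
    fix k l assume "k < dim_row (M * A j)" "l < dim_col (M * A j)"
    then have kl: "k < m" "l < n" using M Aj by auto
    have PA: "A.perm_mat w \<in> carrier_mat n n" if "w permutes {1..r}" for w using A.perm_mat_carrier[OF that] .
    have PB: "B.perm_mat (?i w) \<in> carrier_mat m m" if "w permutes {1..r}" for w
      using B.perm_mat_carrier permutes_inv[OF that] by blast
    have "(B j * M) $$ (k, l) = (\<Sum>i<m. B j $$ (k, i) * schur_sum q r m B n A i a b l)"
      using mult_mat_entry[OF Bj M kl] kl by (simp add: M_def)
    also have "\<dots> = (\<Sum>w | w permutes {1..r}. ?c w * ((B j * B.perm_mat (?i w)) $$ (k, a) * A.perm_mat w $$ (b, l)))"
      unfolding schur_sum_def sum_distrib_left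
      by (subst sum.swap)
         (simp add: mult_mat_entry[OF Bj PB kl(1) a] sum_distrib_left sum_distrib_right mult_ac)
    also have "\<dots> = (\<Sum>w | w permutes {1..r}. ?c w * (B.perm_mat (?i w) $$ (k, a) * (A.perm_mat w * A j) $$ (b, l)))"
      unfolding sum_permutations_ascents[OF j]
    proof (rule sum.cong[OF refl])
      fix w assume "w \<in> {w. w permutes {1..r} \<and> w j < w (j + 1)}"
      then have w: "w permutes {1..r}" and asc: "w j < w (j + 1)" by auto
      define v where "v = w \<circ> transpose j (j + 1)"
      have v: "v permutes {1..r}"
        unfolding v_def by (rule permutes_compose[OF transpose_simple_permutes[OF j] w])
      have cv: "q * ?c v = ?c w"
        unfolding v_def perm_length_ascent[where w = w, OF j asc] using q by simp
      note hA = A.perm_mat_ascent[OF w j asc, folded v_def] and hB = B.perm_mat_ascent[OF w j asc, folded v_def]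
      have 1: "(A.perm_mat v * A j) $$ (b, l) = (1 - q) * A.perm_mat v $$ (b, l) + q * A.perm_mat w $$ (b, l)"
        unfolding hA(3) using PA[OF v] PA[OF w] b kl by auto
      have 2: "(B j * B.perm_mat (?i v)) $$ (k, a) = (1 - q) * B.perm_mat (?i v) $$ (k, a) + q * B.perm_mat (?i w) $$ (k, a)"
        unfolding hB(4) using PB[OF v] PB[OF w] a kl by auto
      show "?c w * ((B j * B.perm_mat (?i w)) $$ (k, a) * A.perm_mat w $$ (b, l)) +
         ?c v * ((B j * B.perm_mat (?i v)) $$ (k, a) * A.perm_mat v $$ (b, l)) =
         ?c w * (B.perm_mat (?i w) $$ (k, a) * (A.perm_mat w * A j) $$ (b, l)) +
         ?c v * (B.perm_mat (?i v) $$ (k, a) * (A.perm_mat v * A j) $$ (b, l))"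
        unfolding 1 2 hA(1)[symmetric] hB(2)[symmetric] cv[symmetric] by (simp add: algebra_simps)
    qed
    also have "\<dots> = (\<Sum>i<n. schur_sum q r m B n A k a b i * A j $$ (i, l))"
      unfolding schur_sum_def sum_distrib_right
      by (subst sum.swap)
         (simp add: mult_mat_entry[OF PA Aj b kl(2)] sum_distrib_left sum_distrib_right mult_ac)
    also have "\<dots> = (M * A j) $$ (k, l)"
      using mult_mat_entry[OF M Aj kl] kl by (simp add: M_def)
    finally show "(B j * M) $$ (k, l) = (M * A j) $$ (k, l)" .
  qed (use M Aj Bj in auto)
qed

lemma trace_product_schur_sum:
  fixes q :: "'a::field"
  assumes A: "hecke_matrices q r n A" and B: "hecke_matrices q r m B"
  shows "(\<Sum>w | w permutes {1..r}. inverse q ^ perm_length r w *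
      (trace_mat (hecke_matrices.perm_mat r m B (inv_into UNIV w)) * trace_mat (hecke_matrices.perm_mat r n A w)))
     = (\<Sum>k<m. \<Sum>l<n. schur_sum q r m B n A k k l l)"
proof -
  interpret A: hecke_matrices q r n A by fact
  interpret B: hecke_matrices q r m B by fact
  have "trace_mat (B.perm_mat (inv_into UNIV w)) * trace_mat (A.perm_mat w) =
     (\<Sum>k<m. \<Sum>l<n. B.perm_mat (inv_into UNIV w) $$ (k, k) * A.perm_mat w $$ (l, l))"
    if w: "w permutes {1..r}" for w
    using A.perm_mat_carrier[OF w] B.perm_mat_carrier[OF permutes_inv[OF w]]
    by (simp add: trace_mat_def sum_product)
  then have "(\<Sum>w | w permutes {1..r}. inverse q ^ perm_length r w *
      (trace_mat (B.perm_mat (inv_into UNIV w)) * trace_mat (A.perm_mat w)))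
    = (\<Sum>w | w permutes {1..r}. \<Sum>k<m. \<Sum>l<n. inverse q ^ perm_length r w *
        (B.perm_mat (inv_into UNIV w) $$ (k, k) * A.perm_mat w $$ (l, l)))"
    by (simp add: sum_distrib_left)
  also have "\<dots> = (\<Sum>k<m. \<Sum>l<n. schur_sum q r m B n A k k l l)"
    unfolding schur_sum_def by (rule sum_swap3)
  finally show ?thesis .
qed

text \<open>Scalar commutant and a nonvanishing trace are what remains of semisimplicity in the arguments below. The
  trace is the Schur element of the representation up to the square of its dimension.\<close>

locale schur_matrices = hecke_matrices q r n A for q :: "'a::field" and r n A +
  assumes q_nonzero: "q \<noteq> 0"
    and commutant: "\<lbrakk>X \<in> carrier_mat n n; \<And>j. j \<in> {1..<r} \<Longrightarrow> A j * X = X * A j\<rbrakk> \<Longrightarrow> \<exists>c. X = c \<cdot>\<^sub>m 1\<^sub>m n"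
    and trace_nonzero: "(\<Sum>w | w permutes {1..r}. inverse q ^ perm_length r w *
      trace_mat (perm_mat w * perm_mat (inv_into UNIV w))) \<noteq> 0"
begin

text \<open>Replacing \<open>w\<close> by its inverse exchanges the two factors of each summand.\<close>

lemma schur_sum_swap: "schur_sum q r n A n A k a b l = schur_sum q r n A n A b l k a"
proof -
  let ?P = "{w. w permutes {1..r}}" and ?i = "inv_into UNIV :: (nat \<Rightarrow> nat) \<Rightarrow> nat \<Rightarrow> nat"
  let ?g = "\<lambda>w. inverse q ^ perm_length r w * (perm_mat (?i w) $$ (k, a) * perm_mat w $$ (b, l))"
  have "bij_betw ?i ?P ?P"
  proof (rule bij_betw_byWitness[where f' = ?i])
    show "\<forall>w\<in>?P. ?i (?i w) = w" "\<forall>w\<in>?P. ?i (?i w) = w" using permutes_inv_inv by blast+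
    show "?i ` ?P \<subseteq> ?P" "?i ` ?P \<subseteq> ?P" using permutes_inv by blast+
  qed
  from sum.reindex_bij_betw[OF this, of ?g]
  have "(\<Sum>w\<in>?P. ?g w) = (\<Sum>w\<in>?P. ?g (?i w))" by (rule sym)
  also have "\<dots> = (\<Sum>w\<in>?P. inverse q ^ perm_length r w * (perm_mat (?i w) $$ (b, l) * perm_mat w $$ (k, a)))"
  proof (rule sum.cong[OF refl])
    fix w assume "w \<in> ?P"
    then have w: "w permutes {1..r}" by simp
    show "?g (?i w) = inverse q ^ perm_length r w * (perm_mat (?i w) $$ (b, l) * perm_mat w $$ (k, a))"
      unfolding perm_length_inv[OF w] permutes_inv_inv[OF w] by (simp only: mult.commute)
  qed
  finally show ?thesis by (simp only: schur_sum_def)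
qed

lemma trace_eq_schur_sum:
  "(\<Sum>w | w permutes {1..r}. inverse q ^ perm_length r w * trace_mat (perm_mat w * perm_mat (inv_into UNIV w)))
   = (\<Sum>b<n. \<Sum>l<n. schur_sum q r n A n A l b b l)"
proof -
  have "trace_mat (perm_mat w * perm_mat (inv_into UNIV w)) =
     (\<Sum>b<n. \<Sum>l<n. perm_mat (inv_into UNIV w) $$ (l, b) * perm_mat w $$ (b, l))"
    if w: "w permutes {1..r}" for w
    using perm_mat_carrier[OF w] mult_mat_entry[OF perm_mat_carrier[OF w] perm_mat_carrier[OF permutes_inv[OF w]]]
    by (simp add: trace_mat_def mult.commute)
  then have "(\<Sum>w | w permutes {1..r}. inverse q ^ perm_length r w * trace_mat (perm_mat w * perm_mat (inv_into UNIV w)))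
    = (\<Sum>w | w permutes {1..r}. \<Sum>b<n. \<Sum>l<n. inverse q ^ perm_length r w * (perm_mat (inv_into UNIV w) $$ (l, b) * perm_mat w $$ (b, l)))"
    by (simp add: sum_distrib_left)
  also have "\<dots> = (\<Sum>b<n. \<Sum>l<n. schur_sum q r n A n A l b b l)"
    unfolding schur_sum_def by (rule sum_swap3)
  finally show ?thesis .
qed

text \<open>By the scalar commutant, an entry of an averaged matrix unit vanishes unless \<open>k = l\<close>; by the symmetry
  \<open>schur_sum_swap\<close> it also vanishes unless \<open>a = b\<close>, and the remaining scalars all agree.\<close>

lemma schur_orthogonality:
  "\<exists>c. c \<noteq> 0 \<and>
    (\<forall>k<n. \<forall>a<n. \<forall>b<n. \<forall>l<n. schur_sum q r n A n A k a b l = (if a = b \<and> k = l then c else 0)) \<and>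
    of_nat (n * n) * c = (\<Sum>w | w permutes {1..r}. inverse q ^ perm_length r w *
      trace_mat (perm_mat w * perm_mat (inv_into UNIV w)))"
proof -
  let ?G = "schur_sum q r n A n A"
  define c where "c a b = ?G 0 a b 0" for a b
  have c: "?G k a b l = (if k = l then c a b else 0)" if ab: "a < n" "b < n" and kl: "k < n" "l < n" for a b k l
  proof -
    let ?M = "mat n n (\<lambda>(k, l). ?G k a b l)"
    have "\<exists>c. ?M = c \<cdot>\<^sub>m 1\<^sub>m n"
      by (rule commutant)
         (simp_all add: schur_sum_intertwines[OF hecke_matrices_axioms hecke_matrices_axioms q_nonzero ab])
    then obtain d where d: "?M = d \<cdot>\<^sub>m 1\<^sub>m n" by blast
    have "?G k' a b l' = (if k' = l' then d else 0)" if "k' < n" "l' < n" for k' l'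
      using arg_cong[OF d, of "\<lambda>M. M $$ (k', l')"] that by simp
    from this[of 0 0] this[OF kl] ab show ?thesis by (simp add: c_def)
  qed
  have diag: "c a a = c 0 0" if "a < n" for a
    using c[of a a 0 0] c[of 0 0 a a] schur_sum_swap[of 0 a a 0] that by auto
  have off: "?G k a b l = 0" if "k < n" "a < n" "b < n" "l < n" "a \<noteq> b" for k a b l
    using schur_sum_swap[of k a b l] c[of l k b a] that by auto
  have G: "?G k a b l = (if a = b \<and> k = l then c 0 0 else 0)" if "k < n" "a < n" "b < n" "l < n" for k a b l
    using off[of k a b l] c[of a b k l] diag[of a] that by auto
  have tr: "(\<Sum>w | w permutes {1..r}. inverse q ^ perm_length r w *
      trace_mat (perm_mat w * perm_mat (inv_into UNIV w))) = of_nat (n * n) * c 0 0"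
    unfolding trace_eq_schur_sum by (simp add: G)
  have "c 0 0 \<noteq> 0" using tr trace_nonzero by (intro notI) (simp only: mult_zero_right)
  then show ?thesis using tr[symmetric] by (intro exI[of _ "c 0 0"] conjI allI impI G)
qed

text \<open>Orthogonality expresses each matrix unit as a combination of the \<open>T\<^sub>w\<close>. Applied to a vector with a nonzero
  coordinate \<open>k\<close>, the matrix units yield every basis vector.\<close>

lemma nonzero_invariant_subset_full:
  assumes U: "U \<subseteq> carrier_vec n" "\<And>u v. u \<in> U \<Longrightarrow> v \<in> U \<Longrightarrow> u + v \<in> U" "\<And>c u. u \<in> U \<Longrightarrow> c \<cdot>\<^sub>v u \<in> U"
    and inv: "\<And>j u. j \<in> {1..<r} \<Longrightarrow> u \<in> U \<Longrightarrow> A j *\<^sub>v u \<in> U"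
    and u: "u \<in> U" "u \<noteq> 0\<^sub>v n"
  shows "U = carrier_vec n"
proof -
  obtain c where c: "c \<noteq> 0"
    "\<forall>k<n. \<forall>a<n. \<forall>b<n. \<forall>l<n. schur_sum q r n A n A k a b l = (if a = b \<and> k = l then c else 0)"
      "of_nat (n * n) * c = (\<Sum>w | w permutes {1..r}. inverse q ^ perm_length r w *
      trace_mat (perm_mat w * perm_mat (inv_into UNIV w)))"
    using schur_orthogonality by (elim exE conjE)
  have uc: "u \<in> carrier_vec n" using U(1) u(1) by blast
  have "u = 0\<^sub>v n" if "\<And>k. k < n \<Longrightarrow> u $ k = 0"
    using that uc by (intro eq_vecI) auto
  then obtain k where k: "k < n" "u $ k \<noteq> 0" using u(2) by blast
  have word: "word_mat n A is *\<^sub>v u \<in> U" if "set is \<subseteq> {1..<r}" for "is"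
    using that
  proof (induction "is")
    case (Cons j js)
    then have "word_mat n A (j # js) *\<^sub>v u = A j *\<^sub>v (word_mat n A js *\<^sub>v u)"
      using carrier[of j] word_mat_carrier[of js] uc by simp
    then show ?case using Cons inv[of j] by simp
  qed (use u uc in simp)
  have perm: "perm_mat w *\<^sub>v u \<in> U" if "w permutes {1..r}" for w
  proof -
    note w = that
    obtain "is" where red: "reduced_word r w is" using ex_reduced_word[OF w] by blast
    then have "set is \<subseteq> {1..<r}" by (simp add: reduced_word_def)
    from word[OF this] show ?thesis by (simp only: word_mat_reduced[OF red])
  qed
  have "0 \<cdot>\<^sub>v u = 0\<^sub>v n" using uc by (intro eq_vecI) auto
  then have zero: "0\<^sub>v n \<in> U" using U(3)[OF u(1), of 0] by simp
  have lincomb: "vec n (\<lambda>b. \<Sum>w\<in>F. f w * (perm_mat w *\<^sub>v u) $ b) \<in> U"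
    if "finite F" "\<And>w. w \<in> F \<Longrightarrow> w permutes {1..r}" for F f
    using that
  proof (induction F rule: finite_induct)
    case empty
    have "vec n (\<lambda>b. 0 :: 'a) = 0\<^sub>v n" by auto
    then show ?case using zero by simp
  next
    case (insert w F)
    have dim: "dim_vec (perm_mat w *\<^sub>v u) = n" using perm_mat_carrier[of w] insert by simp
    have "vec n (\<lambda>b. \<Sum>w\<in>insert w F. f w * (perm_mat w *\<^sub>v u) $ b)
        = f w \<cdot>\<^sub>v (perm_mat w *\<^sub>v u) + vec n (\<lambda>b. \<Sum>w\<in>F. f w * (perm_mat w *\<^sub>v u) $ b)"
      using insert dim by (intro eq_vecI) auto
    also have "\<dots> \<in> U" using insert by (intro U(2) U(3) perm) auto
    finally show ?case .
  qed
  have basis: "unit_vec n a \<in> U" if a: "a < n" for a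
  proof -
    let ?f = "\<lambda>w. inverse (u $ k * c) * inverse q ^ perm_length r w * perm_mat (inv_into UNIV w) $$ (k, a)"
    have "(\<Sum>w | w permutes {1..r}. ?f w * (perm_mat w *\<^sub>v u) $ b) = unit_vec n a $ b" if b: "b < n" for b
    proof -
      have ent: "(perm_mat w *\<^sub>v u) $ b = (\<Sum>l<n. perm_mat w $$ (b, l) * u $ l)" if "w permutes {1..r}" for w
        using perm_mat_carrier[OF that] uc b by (simp add: scalar_prod_def atLeast0LessThan)
      have inv1: "inverse (u $ k * c) * u $ k * c = 1" using k(2) c(1) by (simp add: field_simps)
      have "(\<Sum>w | w permutes {1..r}. ?f w * (perm_mat w *\<^sub>v u) $ b)
         = (\<Sum>w | w permutes {1..r}. \<Sum>l<n. inverse (u $ k * c) * u $ l * (inverse q ^ perm_length r w *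
              (perm_mat (inv_into UNIV w) $$ (k, a) * perm_mat w $$ (b, l))))"
        by (intro sum.cong refl) (simp add: ent sum_distrib_left mult_ac)
      also have "\<dots> = (\<Sum>l<n. inverse (u $ k * c) * u $ l * schur_sum q r n A n A k a b l)"
        unfolding schur_sum_def sum_distrib_left by (rule sum.swap)
      also have "\<dots> = (\<Sum>l<n. if l = k then (if a = b then 1 else 0) else 0)"
        using k a b c(2) inv1 by (intro sum.cong refl) auto
      also have "\<dots> = (if a = b then 1 else 0)" using k(1) by simp
      finally show ?thesis using a b by auto
    qed
    then have "vec n (\<lambda>b. \<Sum>w | w permutes {1..r}. ?f w * (perm_mat w *\<^sub>v u) $ b) = unit_vec n a"
      by (intro eq_vecI) auto
    then show ?thesis using lincomb[of "{w. w permutes {1..r}}" ?f] finite_permutations[of "{1..r}"] by simp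
  qed
  have "v \<in> U" if v: "v \<in> carrier_vec n" for v
  proof -
    have "vec n (\<lambda>b. if b < m then v $ b else 0) \<in> U" if "m \<le> n" for m
      using that
    proof (induction m)
      case 0
      have "vec n (\<lambda>b. if b < 0 then v $ b else 0) = 0\<^sub>v n" by auto
      then show ?case using zero by simp
    next
      case (Suc m)
      have "vec n (\<lambda>b. if b < Suc m then v $ b else 0)
          = vec n (\<lambda>b. if b < m then v $ b else 0) + v $ m \<cdot>\<^sub>v unit_vec n m"
        using Suc by (intro eq_vecI) (auto simp: less_Suc_eq)
      also have "\<dots> \<in> U" using Suc by (intro U(2) U(3) basis) auto
      finally show ?case .
    qed
    from this[of n] have "vec n (\<lambda>b. if b < n then v $ b else 0) \<in> U" by simp
    moreover have "vec n (\<lambda>b. if b < n then v $ b else 0) = v" using v by auto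
    ultimately show ?thesis by simp
  qed
  then show ?thesis using U(1) by blast
qed

text \<open>The orthogonality relations for \<open>a = k\<close> and \<open>b = l\<close> sum to the norm of the character.\<close>

lemma character_norm:
  "of_nat n * (\<Sum>w | w permutes {1..r}. inverse q ^ perm_length r w *
      (trace_mat (perm_mat (inv_into UNIV w)) * trace_mat (perm_mat w))) =
   (\<Sum>w | w permutes {1..r}. inverse q ^ perm_length r w * trace_mat (perm_mat w * perm_mat (inv_into UNIV w)))"
proof -
  obtain c where "c \<noteq> 0"
    and c: "\<forall>k<n. \<forall>a<n. \<forall>b<n. \<forall>l<n. schur_sum q r n A n A k a b l = (if a = b \<and> k = l then c else 0)"
      "of_nat (n * n) * c = (\<Sum>w | w permutes {1..r}. inverse q ^ perm_length r w *
      trace_mat (perm_mat w * perm_mat (inv_into UNIV w)))"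
    using schur_orthogonality by (elim exE conjE)
  have "(\<Sum>w | w permutes {1..r}. inverse q ^ perm_length r w *
      (trace_mat (perm_mat (inv_into UNIV w)) * trace_mat (perm_mat w)))
     = (\<Sum>k<n. \<Sum>l<n. schur_sum q r n A n A k k l l)"
    by (rule trace_product_schur_sum[OF hecke_matrices_axioms hecke_matrices_axioms])
  also have "\<dots> = of_nat n * c" by (simp add: c(1))
  finally show ?thesis by (simp only: c(2)[symmetric] of_nat_mult mult.assoc)
qed

end

section \<open>Exterior powers of the reflection representation\<close>

text \<open>The operator \<open>T\<^sub>j\<close> on the exterior algebra, in coordinates: \<open>f S\<close> is the coefficient of \<open>v\<^sub>S\<close>, and
  the vector \<open>v\<^sub>S\<close> with \<open>j \<in> S\<close> is reached from itself and from the sets in which \<open>j\<close> is replaced by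
  \<open>j - 1\<close> or \<open>j + 1\<close>. In this form it acts on all functions on sets of naturals, so the relations
  can be proved without regard to the number of strands.\<close>

definition hook_op :: "'a::comm_ring_1 \<Rightarrow> nat \<Rightarrow> (nat set \<Rightarrow> 'a) \<Rightarrow> nat set \<Rightarrow> 'a" where
  "hook_op q j f S =
    (if j \<in> S then - q * f S + (if j - 1 \<in> S then 0 else q * f (insert (j - 1) (S - {j})))
                   + (if j + 1 \<in> S then 0 else f (insert (j + 1) (S - {j})))
     else f S)"

text \<open>The sets that contribute to the coordinate of \<open>S\<close>, other than \<open>S\<close>, do not contain \<open>j\<close>. The operator
  keeps their coordinates, so a second application only changes the coordinate of \<open>S\<close>.\<close>

lemma hook_op_quadratic:
  assumes "1 \<le> j"
  shows "hook_op q j (hook_op q j f) S = (1 - q) * hook_op q j f S + q * f S"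
proof (cases "j \<in> S")
  case True
  have "hook_op q j f (insert (j - 1) (S - {j})) = f (insert (j - 1) (S - {j}))"
    "hook_op q j f (insert (j + 1) (S - {j})) = f (insert (j + 1) (S - {j}))"
    using assms by (auto simp: hook_op_def)
  then have "hook_op q j (hook_op q j f) S = - q * hook_op q j f S + (hook_op q j f S + q * f S)"
    using True unfolding hook_op_def[of q j "hook_op q j f" S]
    by (simp add: hook_op_def[of q j f S])
  then show ?thesis by (simp add: algebra_simps)
qed (simp add: hook_op_def algebra_simps)

text \<open>The two generators act on disjoint places, except that both can refer to the place \<open>i + 1 = j - 1\<close> as a source.\<close>

lemma hook_op_commute:
  assumes "1 \<le> i" "i + 2 \<le> j"
  shows "hook_op q i (hook_op q j f) S = hook_op q j (hook_op q i f) S"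
proof -
  have mem: "i \<in> insert (j - 1) (S - {j}) \<longleftrightarrow> i \<in> S" "i \<in> insert (j + 1) (S - {j}) \<longleftrightarrow> i \<in> S"
    "j \<in> insert (i - 1) (S - {i}) \<longleftrightarrow> j \<in> S" "j \<in> insert (i + 1) (S - {i}) \<longleftrightarrow> j \<in> S"
    using assms by auto
  have mem': "i - 1 \<in> insert (j - 1) (S - {j}) \<longleftrightarrow> i - 1 \<in> S" "i - 1 \<in> insert (j + 1) (S - {j}) \<longleftrightarrow> i - 1 \<in> S"
    "j + 1 \<in> insert (i - 1) (S - {i}) \<longleftrightarrow> j + 1 \<in> S" "j + 1 \<in> insert (i + 1) (S - {i}) \<longleftrightarrow> j + 1 \<in> S"
    "i + 1 \<in> insert (j - 1) (S - {j}) \<longleftrightarrow> i + 1 \<in> S \<or> j = i + 2" "i + 1 \<in> insert (j + 1) (S - {j}) \<longleftrightarrow> i + 1 \<in> S"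
    "j - 1 \<in> insert (i - 1) (S - {i}) \<longleftrightarrow> j - 1 \<in> S" "j - 1 \<in> insert (i + 1) (S - {i}) \<longleftrightarrow> j - 1 \<in> S \<or> j = i + 2"
    using assms by auto
  have sets: "insert a (insert b (S - {j}) - {i}) = insert b (insert a (S - {i}) - {j})"
    if "a \<in> {i - 1, i + 1}" "b \<in> {j - 1, j + 1}" for a b
    using that assms by auto
  show ?thesis
    unfolding hook_op_def[of q i "hook_op q j f" S] hook_op_def[of q j "hook_op q i f" S]
    unfolding hook_op_def mem mem' using sets by (auto simp: algebra_simps)
qed

text \<open>Both sides involve only the four places \<open>j - 1, \<dots>, j + 2\<close>, so this is a check of the sixteen possible
  intersections with them.\<close>

lemma hook_op_braid:
  assumes "1 \<le> j"
  shows "hook_op q j (hook_op q (j + 1) (hook_op q j f)) S = hook_op q (j + 1) (hook_op q j (hook_op q (j + 1) f)) S"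
proof -
  obtain k where k: "j = Suc k" using assms by (cases j) auto
  \<comment> \<open>The four places are made explicit as truth values; \<open>T\<close> is the part of \<open>S\<close> away from them.\<close>
  define T where "T = S - {k, Suc k, Suc (Suc k), Suc (Suc (Suc k))}"
  define st where "st a b c d = {x. x \<in> T \<or> a \<and> x = k \<or> b \<and> x = Suc k \<or> c \<and> x = Suc (Suc k)
      \<or> d \<and> x = Suc (Suc (Suc k))}" for a b c d
  have T: "k \<notin> T" "Suc k \<notin> T" "Suc (Suc k) \<notin> T" "Suc (Suc (Suc k)) \<notin> T" by (auto simp: T_def)
  have S: "S = st (k \<in> S) (Suc k \<in> S) (Suc (Suc k) \<in> S) (Suc (Suc (Suc k)) \<in> S)"
    by (auto simp: st_def T_def)
  have mem: "k \<in> st a b c d \<longleftrightarrow> a" "Suc k \<in> st a b c d \<longleftrightarrow> b" "Suc (Suc k) \<in> st a b c d \<longleftrightarrow> c"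
    "Suc (Suc (Suc k)) \<in> st a b c d \<longleftrightarrow> d" for a b c d
    using T by (simp_all add: st_def)
  have moves: "insert k (st False b c d - {Suc k}) = st True False c d"
    "insert (Suc (Suc k)) (st a b False d - {Suc k}) = st a False True d"
    "insert (Suc k) (st a False c d - {Suc (Suc k)}) = st a True False d"
    "insert (Suc (Suc (Suc k))) (st a b c False - {Suc (Suc k)}) = st a b False True" for a b c d
    using T by (auto simp: st_def)
  have j1: "hook_op q (Suc k) g (st a b c d) = (if b then - q * g (st a b c d) + (if a then 0 else q * g (st True False c d))
     + (if c then 0 else g (st a False True d)) else g (st a b c d))" for g a b c d
    by (simp add: hook_op_def mem moves)
  have j2: "hook_op q (Suc (Suc k)) g (st a b c d) = (if c then - q * g (st a b c d) + (if b then 0 else q * g (st a True False d))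
     + (if d then 0 else g (st a b False True)) else g (st a b c d))" for g a b c d
    by (simp add: hook_op_def mem moves)
  show ?thesis
    unfolding k Suc_eq_plus1[symmetric]
    by (subst (1 2) S) (cases "k \<in> S"; cases "Suc k \<in> S"; cases "Suc (Suc k) \<in> S"; cases "Suc (Suc (Suc k)) \<in> S";
      simp add: j1 j2 algebra_simps)
qed

lemma hook_op_sum:
  "hook_op q j (\<lambda>S. \<Sum>x\<in>X. c x * g x S) S = (\<Sum>x\<in>X. c x * hook_op q j (g x) S)"
  by (simp add: hook_op_def sum.distrib sum_distrib_left algebra_simps sum_negf sum_subtractf)

definition hook_index :: "nat \<Rightarrow> nat \<Rightarrow> nat set set" where
  "hook_index r i = {S. S \<subseteq> {1..<r} \<and> card S = i}"

lemma finite_hook_index: "finite (hook_index r i)"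
  by (rule finite_subset[of _ "Pow {1..<r}"]) (auto simp: hook_index_def)

lemma move_mem_hook_index:
  assumes "j \<in> {1..<r}" "j \<in> S" "k \<notin> S" "insert k (S - {j}) \<in> hook_index r i"
  shows "S \<in> hook_index r i"
proof -
  have S: "S \<subseteq> {1..<r}" using assms by (auto simp: hook_index_def)
  then have "finite S" by (rule finite_subset) simp
  then have "card (insert k (S - {j})) = Suc (card (S - {j}))"
    using assms(3) by simp
  also have "\<dots> = card S" by (rule card_Suc_Diff1[OF \<open>finite S\<close> assms(2)])
  finally show ?thesis using S assms(4) by (simp add: hook_index_def)
qed

lemma hook_op_support:
  assumes j: "j \<in> {1..<r}" and f: "\<And>S. S \<notin> hook_index r i \<Longrightarrow> f S = 0" and S: "S \<notin> hook_index r i"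
  shows "hook_op q j f S = 0"
proof -
  have "f (insert k (S - {j})) = 0" if "j \<in> S" "k \<notin> S" for k
    using move_mem_hook_index[OF j that] S f by blast
  then show ?thesis using f[OF S] by (simp add: hook_op_def)
qed

text \<open>Moving \<open>b\<close> to \<open>a\<close> and moving \<open>a\<close> to \<open>b\<close> are inverse to each other.\<close>

lemma exchange_eq_iff:
  assumes "a \<noteq> b" "b \<in> X" "b \<notin> S"
  shows "insert a (X - {b}) = S \<and> a \<notin> X \<longleftrightarrow> a \<in> S \<and> X = insert b (S - {a})"
proof (intro iffI conjI; elim conjE)
  assume A: "insert a (X - {b}) = S" "a \<notin> X"
  show "a \<in> S" using A(1) by blast
  have "S - {a} = X - {b}" unfolding A(1)[symmetric] using A(2) by simp
  then show "X = insert b (S - {a})" using insert_Diff[OF assms(2)] by simp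
next
  assume A: "a \<in> S" "X = insert b (S - {a})"
  have "X - {b} = S - {a}" unfolding A(2) using assms(3) by simp
  then show "insert a (X - {b}) = S" using insert_Diff[OF A(1)] by simp
  show "a \<notin> X" using A(2) assms(1) by simp
qed

definition basis_fun :: "nat set \<Rightarrow> nat set \<Rightarrow> 'a::comm_ring_1" where
  "basis_fun S = (\<lambda>S'. of_bool (S' = S))"

definition hook_word :: "'a::comm_ring_1 \<Rightarrow> nat list \<Rightarrow> (nat set \<Rightarrow> 'a) \<Rightarrow> nat set \<Rightarrow> 'a" where
  "hook_word q is f = foldr (hook_op q) is f"

lemma hook_word_simps [simp]: "hook_word q [] f = f" "hook_word q (j # js) f = hook_op q j (hook_word q js f)"
  by (simp_all add: hook_word_def)

lemma hook_word_support:
  assumes "set is \<subseteq> {1..<r}" and f: "\<And>S. S \<notin> hook_index r i \<Longrightarrow> f S = 0" and "S \<notin> hook_index r i"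
  shows "hook_word q is f S = 0"
  using assms(1,3)
proof (induction "is" arbitrary: S)
  case (Cons j js)
  then show ?case using hook_op_support[of j r i "hook_word q js f" S q] by simp
qed (simp add: f)

text \<open>An arbitrary numbering of the basis, needed only to pass from operators to matrices.\<close>

definition hook_enum :: "nat \<Rightarrow> nat \<Rightarrow> nat \<Rightarrow> nat set" where
  "hook_enum r i = (SOME e. bij_betw e {..<card (hook_index r i)} (hook_index r i))"

lemma hook_enum: "bij_betw (hook_enum r i) {..<card (hook_index r i)} (hook_index r i)"
proof -
  have "\<exists>e. bij_betw e {..<card (hook_index r i)} (hook_index r i)"
    using ex_bij_betw_nat_finite[OF finite_hook_index[of r i]] by (simp only: atLeast0LessThan)
  from someI_ex[OF this] show ?thesis unfolding hook_enum_def .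
qed

lemma hook_enum_mem: "a < card (hook_index r i) \<Longrightarrow> hook_enum r i a \<in> hook_index r i"
  using hook_enum by (auto simp: bij_betw_def)

lemma hook_enum_eq_iff: "a < card (hook_index r i) \<Longrightarrow> b < card (hook_index r i) \<Longrightarrow>
    hook_enum r i a = hook_enum r i b \<longleftrightarrow> a = b"
  using hook_enum[of r i] by (auto simp: bij_betw_def inj_on_def)

lemma hook_enum_surj: "S \<in> hook_index r i \<Longrightarrow> \<exists>a<card (hook_index r i). hook_enum r i a = S"
  using bij_betw_imp_surj_on[OF hook_enum[of r i]] by (metis imageE lessThan_iff)

text \<open>The matrix of \<open>T\<^sub>j\<close> on the exterior power of degree \<open>i\<close>.\<close>

definition hook_mat :: "'a::comm_ring_1 \<Rightarrow> nat \<Rightarrow> nat \<Rightarrow> nat \<Rightarrow> 'a mat" where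
  "hook_mat q r i j = mat (card (hook_index r i)) (card (hook_index r i))
     (\<lambda>(a, b). hook_op q j (basis_fun (hook_enum r i b)) (hook_enum r i a))"

lemma hook_mat_carrier: "hook_mat q r i j \<in> carrier_mat (card (hook_index r i)) (card (hook_index r i))"
  by (simp add: hook_mat_def)

lemma word_hook_mat_carrier:
  "word_mat (card (hook_index r i)) (hook_mat q r i) is \<in> carrier_mat (card (hook_index r i)) (card (hook_index r i))"
proof (induction "is")
  case (Cons j js)
  then show ?case using hook_mat_carrier[of q r i j] by simp
qed simp

lemma expand_basis_fun:
  assumes f: "\<And>S. S \<notin> hook_index r i \<Longrightarrow> f S = 0"
  shows "f = (\<lambda>S. \<Sum>a<card (hook_index r i). f (hook_enum r i a) * basis_fun (hook_enum r i a) S)"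
proof
  fix S
  have "(\<Sum>a<card (hook_index r i). f (hook_enum r i a) * basis_fun (hook_enum r i a) S)
      = (\<Sum>X\<in>hook_index r i. f X * basis_fun X S)"
    by (rule sum.reindex_bij_betw[OF hook_enum])
  also have "\<dots> = (\<Sum>X\<in>hook_index r i. if S = X then f X else 0)"
    by (intro sum.cong refl) (simp add: basis_fun_def)
  also have "\<dots> = f S" using f finite_hook_index by simp
  finally show "f S = (\<Sum>a<card (hook_index r i). f (hook_enum r i a) * basis_fun (hook_enum r i a) S)" by simp
qed

lemma hook_mat_action:
  assumes f: "\<And>S. S \<notin> hook_index r i \<Longrightarrow> f S = 0" and a: "a < card (hook_index r i)"
  shows "(\<Sum>k<card (hook_index r i). hook_mat q r i j $$ (a, k) * f (hook_enum r i k)) = hook_op q j f (hook_enum r i a)"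
  by (subst (2) expand_basis_fun[of r i f, OF f], assumption)
     (simp add: hook_op_sum hook_mat_def a mult.commute)

lemma basis_fun_support: "S \<in> hook_index r i \<Longrightarrow> X \<notin> hook_index r i \<Longrightarrow> basis_fun S X = 0"
  by (auto simp: basis_fun_def)

text \<open>This transports identities between words from operators to matrices.\<close>

lemma word_hook_mat_entry:
  assumes "set is \<subseteq> {1..<r}" and a: "a < card (hook_index r i)" and b: "b < card (hook_index r i)"
  shows "word_mat (card (hook_index r i)) (hook_mat q r i) is $$ (a, b)
    = hook_word q is (basis_fun (hook_enum r i b)) (hook_enum r i a)"
  using assms(1) a
proof (induction "is" arbitrary: a)
  case Nil
  then show ?case using b by (simp add: basis_fun_def hook_enum_eq_iff)
next
  case (Cons j js)
  have sub: "set js \<subseteq> {1..<r}" using Cons.prems by simp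
  have "word_mat (card (hook_index r i)) (hook_mat q r i) (j # js) $$ (a, b)
     = (\<Sum>k<card (hook_index r i). hook_mat q r i j $$ (a, k) *
          hook_word q js (basis_fun (hook_enum r i b)) (hook_enum r i k))"
    using mult_mat_entry[OF hook_mat_carrier[of q r i j] word_hook_mat_carrier[of r i q js] Cons.prems(2) b] Cons.IH[OF sub] by simp
  also have "\<dots> = hook_op q j (hook_word q js (basis_fun (hook_enum r i b))) (hook_enum r i a)"
    by (rule hook_mat_action[OF hook_word_support[OF sub basis_fun_support] Cons.prems(2)])
       (use hook_enum_mem b in auto)
  finally show ?case by simp
qed

lemma hook_matrices: "hecke_matrices q r (card (hook_index r i)) (hook_mat q r i)"
proof
  let ?n = "card (hook_index r i)" and ?A = "hook_mat q r i"
  have words: "word_mat ?n ?A u = word_mat ?n ?A v"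
    if "set u \<subseteq> {1..<r}" "set v \<subseteq> {1..<r}" "\<And>f S. hook_word q u f S = hook_word q v f S" for u v
    using word_hook_mat_entry[OF that(1), of _ i _ q] word_hook_mat_entry[OF that(2), of _ i _ q] that(3)
      word_hook_mat_carrier[of r i q u] word_hook_mat_carrier[of r i q v]
    by (intro eq_matI) auto
  have one: "?A j * 1\<^sub>m ?n = ?A j" for j using right_mult_one_mat[OF hook_mat_carrier] .
  show "?A j \<in> carrier_mat ?n ?n" if "j \<in> {1..<r}" for j by (rule hook_mat_carrier)
  show "?A j * ?A j = (1 - q) \<cdot>\<^sub>m ?A j + q \<cdot>\<^sub>m 1\<^sub>m ?n" if j: "j \<in> {1..<r}" for j
  proof (rule eq_matI)
    fix a b assume "a < dim_row ((1 - q) \<cdot>\<^sub>m ?A j + q \<cdot>\<^sub>m 1\<^sub>m ?n)" "b < dim_col ((1 - q) \<cdot>\<^sub>m ?A j + q \<cdot>\<^sub>m 1\<^sub>m ?n)"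
    then have ab: "a < ?n" "b < ?n" by auto
    let ?f = "basis_fun (hook_enum r i b) :: nat set \<Rightarrow> 'a"
    have j1: "1 \<le> j" and sub: "set [j, j] \<subseteq> {1..<r}" using j by auto
    have "(?A j * ?A j) $$ (a, b) = word_mat ?n ?A [j, j] $$ (a, b)" by (simp add: one)
    also have "\<dots> = hook_op q j (hook_op q j ?f) (hook_enum r i a)"
      using word_hook_mat_entry[OF sub ab] by simp
    also have "\<dots> = (1 - q) * ?A j $$ (a, b) + q * ?f (hook_enum r i a)"
      using ab by (simp add: hook_op_quadratic[OF j1] hook_mat_def)
    also have "\<dots> = ((1 - q) \<cdot>\<^sub>m ?A j + q \<cdot>\<^sub>m 1\<^sub>m ?n) $$ (a, b)"
      using ab hook_mat_carrier[of q r i j] by (simp add: basis_fun_def hook_enum_eq_iff)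
    finally show "(?A j * ?A j) $$ (a, b) = ((1 - q) \<cdot>\<^sub>m ?A j + q \<cdot>\<^sub>m 1\<^sub>m ?n) $$ (a, b)" .
  qed (use hook_mat_carrier[of q r i j] in auto)
  show "?A k * ?A j = ?A j * ?A k" if "k \<in> {1..<r}" "j \<in> {1..<r}" "k + 2 \<le> j" for k j
    using words[of "[k, j]" "[j, k]"] that hook_op_commute[of k j q] by (simp add: one)
  show "?A k * ?A (k + 1) * ?A k = ?A (k + 1) * ?A k * ?A (k + 1)" if k: "k \<in> {1..<r}" "k + 1 \<in> {1..<r}" for k
  proof -
    have "word_mat ?n ?A [k, k + 1, k] = word_mat ?n ?A [k + 1, k, k + 1]"
      by (rule words) (use k hook_op_braid[of k q] in auto)
    then show ?thesis
      using hook_mat_carrier[of q r i k] hook_mat_carrier[of q r i "k + 1"] by (simp add: one)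
  qed
qed

lemma trace_hook_word:
  assumes "set is \<subseteq> {1..<r}"
  shows "trace_mat (word_mat (card (hook_index r i)) (hook_mat q r i) is)
    = (\<Sum>S\<in>hook_index r i. hook_word q is (basis_fun S) S)"
proof -
  have "trace_mat (word_mat (card (hook_index r i)) (hook_mat q r i) is)
     = (\<Sum>a<card (hook_index r i). hook_word q is (basis_fun (hook_enum r i a)) (hook_enum r i a))"
    using word_hook_mat_carrier[of r i q "is"] word_hook_mat_entry[OF assms, of _ i _ q]
    by (simp add: trace_mat_def)
  also have "\<dots> = (\<Sum>S\<in>hook_index r i. hook_word q is (basis_fun S) S)"
    by (rule sum.reindex_bij_betw[OF hook_enum])
  finally show ?thesis .
qed

section \<open>Irreducibility of the exterior powers and specialization at $q = 1$\<close>

lemma down_closed_eq_interval: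
  assumes S: "S \<in> hook_index r i" and down: "\<And>j. j \<in> S \<Longrightarrow> 2 \<le> j \<Longrightarrow> j - 1 \<in> S"
  shows "S = {1..i}"
proof (cases "S = {}")
  case True
  then show ?thesis using S by (auto simp: hook_index_def)
next
  case False
  have fin: "finite S" and pos: "\<And>j. j \<in> S \<Longrightarrow> 1 \<le> j" and card: "card S = i"
    using S finite_subset[of S "{1..<r}"] by (auto simp: hook_index_def)
  have "m - k \<in> S" if "m \<in> S" "k < m" for m k
    using that
  proof (induction k)
    case (Suc k)
    then show ?case using down[of "m - k"] by (simp add: Suc_diff_Suc)
  qed simp
  note sub = this
  have "S = {1..Max S}"
  proof (intro equalityI subsetI)
    fix x assume "x \<in> S"
    then show "x \<in> {1..Max S}" using pos fin by auto
  next
    fix x assume x: "x \<in> {1..Max S}"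
    have "Max S \<in> S" using fin False by (rule Max_in)
    from sub[OF this, of "Max S - x"] x show "x \<in> S" by auto
  qed
  moreover from this card have "Max S = i" by (metis card_atLeastAtMost diff_Suc_1)
  ultimately show ?thesis by simp
qed

text \<open>Any \<open>i\<close>-subset reaches \<open>{1..i}\<close> by moving elements down one place at a time; the sum of the elements decreases.\<close>

lemma hook_index_connected:
  assumes d: "\<And>S j. S \<in> hook_index r i \<Longrightarrow> j \<in> S \<Longrightarrow> j - 1 \<notin> S \<Longrightarrow> 2 \<le> j \<Longrightarrow> d S = d (insert (j - 1) (S - {j}))"
    and S: "S \<in> hook_index r i"
  shows "d S = d {1..i}"
  using S
proof (induction "\<Sum>S" arbitrary: S rule: less_induct)
  case (less S)
  show ?case
  proof (cases "\<forall>j\<in>S. 2 \<le> j \<longrightarrow> j - 1 \<in> S")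
    case True
    then show ?thesis using down_closed_eq_interval[OF less.prems] by blast
  next
    case False
    then obtain j where j: "j \<in> S" "2 \<le> j" "j - 1 \<notin> S" by blast
    let ?S = "insert (j - 1) (S - {j})"
    have S: "S \<subseteq> {1..<r}" "finite S" "card S = i"
      using less.prems finite_subset[of S "{1..<r}"] by (auto simp: hook_index_def)
    have "card ?S = Suc (card (S - {j}))" using S(2) j by simp
    also have "\<dots> = i" using card_Suc_Diff1[OF S(2) j(1)] S(3) by simp
    finally have S': "?S \<in> hook_index r i"
      using S(1) j by (auto simp: hook_index_def)
    have "\<Sum>?S = (j - 1) + \<Sum>(S - {j})" using S(2) j by simp
    moreover have "\<Sum>S = j + \<Sum>(S - {j})" using S(2) j(1) by (rule sum.remove)
    ultimately have "\<Sum>?S < \<Sum>S" using j(2) by linarith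
    from less.hyps[OF this S'] d[OF less.prems j(1,3,2)] show ?thesis by simp
  qed
qed

text \<open>Row \<open>a\<close> of \<open>T\<^sub>j\<close> is a unit row if \<open>j\<close> is not in the set of \<open>a\<close>, and column \<open>b\<close> is \<open>-q\<close> times a unit column if
  \<open>j\<close> is in the set of \<open>b\<close>. Comparing the two products at \<open>(a, b)\<close> shows that \<open>X\<close> is diagonal. Its diagonal is constant because
  neighbouring sets are joined by an entry \<open>q\<close> of some generator.\<close>

lemma hook_commutant:
  fixes q :: "'a::field"
  assumes q: "q \<noteq> 0" "q \<noteq> -1"
    and X: "X \<in> carrier_mat (card (hook_index r i)) (card (hook_index r i))"
    and comm: "\<And>j. j \<in> {1..<r} \<Longrightarrow> hook_mat q r i j * X = X * hook_mat q r i j"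
  shows "\<exists>c. X = c \<cdot>\<^sub>m 1\<^sub>m (card (hook_index r i))"
proof -
  let ?N = "card (hook_index r i)" and ?e = "hook_enum r i" and ?A = "hook_mat q r i"
  have sub: "?e a \<subseteq> {1..<r}" "finite (?e a)" "card (?e a) = i" if "a < ?N" for a
    using hook_enum_mem[OF that] finite_subset[of _ "{1..<r}"] by (auto simp: hook_index_def)
  have AX: "(\<Sum>k<?N. ?A j $$ (a, k) * X $$ (k, b)) = (\<Sum>k<?N. X $$ (a, k) * ?A j $$ (k, b))"
    if "j \<in> {1..<r}" "a < ?N" "b < ?N" for j a b
    using arg_cong[OF comm[OF that(1)], of "\<lambda>M. M $$ (a, b)"]
      mult_mat_entry[OF hook_mat_carrier[of q r i j] X that(2,3)] mult_mat_entry[OF X hook_mat_carrier[of q r i j] that(2,3)]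
    by simp
  \<comment> \<open>Different sets of equal size: some \<open>j\<close> lies in the second but not in the first.\<close>
  have off: "X $$ (a, b) = 0" if ab: "a < ?N" "b < ?N" "a \<noteq> b" for a b
  proof -
    have "?e a \<noteq> ?e b" using ab by (simp add: hook_enum_eq_iff)
    then have "\<not> ?e b \<subseteq> ?e a" using card_subset_eq[of "?e a" "?e b"] sub ab by auto
    then obtain j where j: "j \<in> ?e b" "j \<notin> ?e a" by blast
    then have jr: "j \<in> {1..<r}" using sub(1)[OF ab(2)] by blast
    have "?A j $$ (a, k) = (if k = a then 1 else 0)" if "k < ?N" for k
      using that ab j by (auto simp: hook_mat_def hook_op_def basis_fun_def hook_enum_eq_iff)
    moreover have "?A j $$ (k, b) = (if k = b then - q else 0)" if "k < ?N" for k
    proof -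
      have "?e b \<noteq> insert l (?e k - {j})" if "l \<noteq> j" for l using j that by auto
      moreover have "j - 1 \<noteq> j" using jr by auto
      ultimately show ?thesis
        using that ab j by (auto simp: hook_mat_def hook_op_def basis_fun_def hook_enum_eq_iff)
    qed
    ultimately have "(\<Sum>k<?N. if k = a then X $$ (k, b) else 0) = (\<Sum>k<?N. if k = b then - q * X $$ (a, k) else 0)"
      using AX[OF jr ab(1,2)] by (simp add: if_distrib[of "\<lambda>x. x * _"] if_distrib[of "\<lambda>x. _ * x"] mult.commute cong: if_cong)
    then have "(1 + q) * X $$ (a, b) = 0" using ab by (simp add: distrib_right eq_neg_iff_add_eq_0)
    moreover have "1 + q \<noteq> 0" using q(2) by (simp add: add_eq_0_iff)
    ultimately show ?thesis by simp
  qed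
  define d where "d S = (let a = inv_into {..<?N} ?e S in X $$ (a, a))" for S
  have inv: "inv_into {..<?N} ?e (?e a) = a" if "a < ?N" for a
    using bij_betw_imp_inj_on[OF hook_enum[of r i]] that by simp
  have dS: "d (?e a) = X $$ (a, a)" if "a < ?N" for a by (simp add: d_def inv[OF that])
  have const: "d S = d {1..i}" if "S \<in> hook_index r i" for S
  proof (rule hook_index_connected[OF _ that])
    fix S j assume S: "S \<in> hook_index r i" and j: "j \<in> S" "j - 1 \<notin> S" "2 \<le> j"
    let ?S = "insert (j - 1) (S - {j})"
    have fin: "finite S" using S finite_subset[of S "{1..<r}"] by (auto simp: hook_index_def)
    have "card ?S = Suc (card (S - {j}))" using fin j by simp
    also have "\<dots> = i" using card_Suc_Diff1[OF fin j(1)] S by (simp add: hook_index_def)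
    finally have S': "?S \<in> hook_index r i" using S j by (auto simp: hook_index_def)
    obtain a b where a: "a < ?N" "?e a = S" and b: "b < ?N" "?e b = ?S"
      using hook_enum_surj[OF S] hook_enum_surj[OF S'] by blast
    have jr: "j \<in> {1..<r}" using S j by (auto simp: hook_index_def)
    have ne: "insert (j + 1) (S - {j}) \<noteq> ?S" "S \<noteq> ?S" using j by auto
    have "?A j $$ (a, b) = q"
      using a b j ne by (auto simp: hook_mat_def hook_op_def basis_fun_def)
    moreover have "(\<Sum>k<?N. ?A j $$ (a, k) * X $$ (k, b)) = (\<Sum>k<?N. if k = b then ?A j $$ (a, b) * X $$ (b, b) else 0)"
      using off b by (intro sum.cong refl) auto
    moreover have "(\<Sum>k<?N. X $$ (a, k) * ?A j $$ (k, b)) = (\<Sum>k<?N. if k = a then X $$ (a, a) * ?A j $$ (a, b) else 0)"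
      using off a by (intro sum.cong refl) auto
    ultimately have "X $$ (a, a) = X $$ (b, b)" using AX[OF jr a(1) b(1)] a b q by simp
    then show "d S = d ?S" using dS a b by metis
  qed
  have "X = d {1..i} \<cdot>\<^sub>m 1\<^sub>m ?N"
  proof (rule eq_matI)
    fix a b assume "a < dim_row (d {1..i} \<cdot>\<^sub>m 1\<^sub>m ?N)" "b < dim_col (d {1..i} \<cdot>\<^sub>m 1\<^sub>m ?N)"
    then have ab: "a < ?N" "b < ?N" by auto
    show "X $$ (a, b) = (d {1..i} \<cdot>\<^sub>m 1\<^sub>m ?N) $$ (a, b)"
      using off[OF ab] dS[OF ab(1)] const[OF hook_enum_mem[OF ab(1)]] ab by auto
  qed (use X in auto)
  then show ?thesis by blast
qed

definition hook_char :: "'a::comm_ring_1 \<Rightarrow> nat \<Rightarrow> nat \<Rightarrow> nat list \<Rightarrow> 'a" where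
  "hook_char q r i is = (\<Sum>S\<in>hook_index r i. hook_word q is (basis_fun S) S)"

lemma (in comm_ring_hom) hom_hook_op: "hom (hook_op q j f S) = hook_op (hom q) j (\<lambda>S. hom (f S)) S"
  by (simp add: hook_op_def hom_distribs)

lemma (in comm_ring_hom) hom_hook_word: "hom (hook_word q is f S) = hook_word (hom q) is (\<lambda>S. hom (f S)) S"
  by (induction "is" arbitrary: S) (simp_all add: hom_hook_op)

text \<open>The characters are compared through their values in the polynomial ring, which map both to rational functions
  and, at \<open>q = 1\<close>, to complex numbers.\<close>

lemma (in comm_ring_hom) hom_hook_char: "hom (hook_char q r i is) = hook_char (hom q) r i is"
  by (simp add: hook_char_def hom_sum hom_hook_word basis_fun_def of_bool_def if_distrib[of hom] cong: if_cong)

interpretation to_fract_hom: comm_ring_hom "to_fract :: complex poly \<Rightarrow> ratfun"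
  by unfold_locales simp_all

interpretation poly_hom: comm_ring_hom "\<lambda>p. poly p (1::complex)"
  by unfold_locales simp_all

abbreviation poly_q :: "complex poly" where "poly_q \<equiv> [:0, 1:]"

lemma to_fract_hook_char: "to_fract (hook_char poly_q r i is) = hook_char qq r i is"
  by (simp add: to_fract_hom.hom_hook_char qq_def)

lemma poly_hook_char: "poly (hook_char poly_q r i is) 1 = hook_char 1 r i is"
  by (simp add: poly_hom.hom_hook_char)

lemma qq_nonzero: "qq \<noteq> 0" "qq \<noteq> -1"
proof -
  have "to_fract poly_q \<noteq> to_fract 0" "to_fract poly_q \<noteq> to_fract (-1)"
    by (simp_all add: to_fract_eq_iff one_pCons)
  then show "qq \<noteq> 0" "qq \<noteq> -1" by (simp_all add: qq_def)
qed

text \<open>The negative powers of \<open>q\<close> are harmless at \<open>q = 1\<close>: a large power of \<open>q\<close> clears them and itself specializes to \<open>1\<close>.\<close>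

lemma specialize_sum_zero:
  assumes "finite W" and "(\<Sum>w\<in>W. inverse qq ^ l w * to_fract (P w)) = 0"
  shows "(\<Sum>w\<in>W. poly (P w) 1) = 0"
proof -
  \<comment> \<open>Any common bound of the exponents would do.\<close>
  define L where "L = sum l W"
  have le: "l w \<le> L" if "w \<in> W" for w unfolding L_def using that assms(1) by (simp add: member_le_sum)
  have "to_fract (\<Sum>w\<in>W. poly_q ^ (L - l w) * P w) = (\<Sum>w\<in>W. qq ^ (L - l w) * to_fract (P w))"
    by (simp add: to_fract_hom.hom_sum to_fract_hom.hom_mult to_fract_hom.hom_power qq_def)
  also have "\<dots> = (\<Sum>w\<in>W. qq ^ L * (inverse qq ^ l w * to_fract (P w)))"
    using le qq_nonzero(1) by (intro sum.cong refl) (simp add: power_diff field_simps)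
  also have "\<dots> = to_fract 0" using assms(2) by (simp add: sum_distrib_left[symmetric])
  finally have "(\<Sum>w\<in>W. poly_q ^ (L - l w) * P w) = 0" by (simp only: to_fract_eq_iff)
  then have "poly (\<Sum>w\<in>W. poly_q ^ (L - l w) * P w) 1 = 0" by simp
  then show ?thesis by (simp add: poly_sum)
qed

lemma hook_word_append: "hook_word q (u @ v) f = hook_word q u (hook_word q v f)"
  by (simp add: hook_word_def)

text \<open>At \<open>q = 1\<close> every generator is an involution.\<close>

lemma hook_word_one_rev:
  assumes "set is \<subseteq> {1..<r}"
  shows "hook_word 1 (is @ rev is) f = f"
  using assms
proof (induction "is" arbitrary: f)
  case (Cons j js)
  then have "hook_word 1 (j # js @ rev js @ [j]) f = hook_op 1 j (hook_word 1 (js @ rev js) (hook_op 1 j f))"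
    by (simp add: hook_word_append)
  also have "\<dots> = hook_op 1 j (hook_op 1 j f)" using Cons by simp
  also have "\<dots> = f" using hook_op_quadratic[of j 1 f] Cons.prems by auto
  finally show ?case by simp
qed simp

lemma hook_char_one_rev:
  assumes "set is \<subseteq> {1..<r}"
  shows "hook_char 1 r i (is @ rev is) = of_nat (card (hook_index r i))"
  unfolding hook_char_def hook_word_one_rev[OF assms] by (simp add: basis_fun_def)

definition reduced :: "nat \<Rightarrow> (nat \<Rightarrow> nat) \<Rightarrow> nat list" where
  "reduced r w = (SOME is. reduced_word r w is)"

lemma reduced: "w permutes {1..r} \<Longrightarrow> reduced_word r w (reduced r w)"
  unfolding reduced_def by (rule someI_ex[OF ex_reduced_word])

lemma reduced_subset: "w permutes {1..r} \<Longrightarrow> set (reduced r w) \<subseteq> {1..<r}"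
  using reduced by (auto simp: reduced_word_def)

abbreviation hook_perm_mat :: "'a::comm_ring_1 \<Rightarrow> nat \<Rightarrow> nat \<Rightarrow> (nat \<Rightarrow> nat) \<Rightarrow> 'a mat" where
  "hook_perm_mat q r i \<equiv> hecke_matrices.perm_mat r (card (hook_index r i)) (hook_mat q r i)"

lemma hook_perm_mat_eq: "hook_perm_mat q r i w = word_mat (card (hook_index r i)) (hook_mat q r i) (reduced r w)"
  by (simp add: hecke_matrices.perm_mat_def[OF hook_matrices] reduced_def)

lemma trace_hook_perm_mat:
  "w permutes {1..r} \<Longrightarrow> trace_mat (hook_perm_mat q r i w) = hook_char q r i (reduced r w)"
  by (simp only: hook_perm_mat_eq trace_hook_word[OF reduced_subset] hook_char_def)

lemma trace_hook_perm_mat_inv: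
  assumes w: "w permutes {1..r}"
  shows "trace_mat (hook_perm_mat q r i w * hook_perm_mat q r i (inv_into UNIV w))
     = hook_char q r i (reduced r w @ rev (reduced r w))"
proof -
  interpret hecke_matrices q r "card (hook_index r i)" "hook_mat q r i" by (rule hook_matrices)
  note sub = reduced_subset[OF w]
  have "hook_perm_mat q r i (inv_into UNIV w) = word_mat (card (hook_index r i)) (hook_mat q r i) (rev (reduced r w))"
    by (rule word_mat_reduced[OF reduced_word_rev[OF reduced[OF w]], symmetric])
  then show ?thesis
    unfolding hook_char_def hook_perm_mat_eq[where w = w] using sub
    by (subst trace_hook_word[symmetric]) (simp_all add: word_mat_append)
qed

lemma card_hook_index_pos: "1 \<le> r \<Longrightarrow> i \<le> r - 1 \<Longrightarrow> 0 < card (hook_index r i)"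
proof -
  assume "1 \<le> r" "i \<le> r - 1"
  then have "{1..i} \<in> hook_index r i" by (auto simp: hook_index_def)
  then show ?thesis using finite_hook_index by (auto simp: card_gt_0_iff)
qed

lemma finite_perms: "finite {w::nat \<Rightarrow> nat. w permutes {1..r}}"
  by (rule finite_permutations) simp

lemma card_perms_pos: "0 < card {w::nat \<Rightarrow> nat. w permutes {1..r}}"
proof -
  have "id \<in> {w::nat \<Rightarrow> nat. w permutes {1..r}}" by (simp add: permutes_id)
  then show ?thesis using finite_perms[of r] by (subst card_gt_0_iff) blast
qed

lemma schur_hook_one:
  assumes "1 \<le> r" "i \<le> r - 1"
  shows "schur_matrices (1::complex) r (card (hook_index r i)) (hook_mat 1 r i)"
proof (intro schur_matrices.intro hook_matrices schur_matrices_axioms.intro)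
  have "(\<Sum>w | w permutes {1..r}. inverse 1 ^ perm_length r w *
      trace_mat (hook_perm_mat 1 r i w * hook_perm_mat 1 r i (inv_into UNIV w))) =
      (\<Sum>w | w permutes {1..r}. of_nat (card (hook_index r i)) :: complex)"
    by (intro sum.cong refl) (simp add: trace_hook_perm_mat_inv hook_char_one_rev[OF reduced_subset])
  then show "(\<Sum>w | w permutes {1..r}. inverse (1::complex) ^ perm_length r w *
      trace_mat (hook_perm_mat 1 r i w * hook_perm_mat 1 r i (inv_into UNIV w))) \<noteq> 0"
    using card_perms_pos[of r] card_hook_index_pos[OF assms] by simp
qed (use hook_commutant[of "1::complex"] in auto)

text \<open>At \<open>q = 1\<close> the trace is the number of permutations times the dimension, so the generic trace cannot vanish either.\<close>

lemma schur_hook_qq: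
  assumes "1 \<le> r" "i \<le> r - 1"
  shows "schur_matrices qq r (card (hook_index r i)) (hook_mat qq r i)"
proof (intro schur_matrices.intro hook_matrices schur_matrices_axioms.intro notI)
  assume "(\<Sum>w | w permutes {1..r}. inverse qq ^ perm_length r w *
      trace_mat (hook_perm_mat qq r i w * hook_perm_mat qq r i (inv_into UNIV w))) = 0"
  then have "(\<Sum>w | w permutes {1..r}. inverse qq ^ perm_length r w *
      to_fract (hook_char poly_q r i (reduced r w @ rev (reduced r w)))) = 0"
    by (simp add: trace_hook_perm_mat_inv to_fract_hook_char)
  from specialize_sum_zero[OF finite_perms this]
  have "(\<Sum>w\<in>{w::nat\<Rightarrow>nat. w permutes {1..r}}. of_nat (card (hook_index r i)) :: complex) = 0"
    by (simp add: poly_hook_char hook_char_one_rev[OF reduced_subset])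
  then show False using card_perms_pos[of r] card_hook_index_pos[OF assms] by simp
qed (use hook_commutant[OF qq_nonzero] qq_nonzero in auto)

text \<open>The dimension times the norm is a trace that is nonzero by \<open>schur_hook_one\<close>.\<close>

lemma hook_char_norm:
  assumes "1 \<le> r" "i \<le> r - 1"
  shows "(\<Sum>w | w permutes {1..r}. hook_char (1::complex) r i (reduced r (inv_into UNIV w)) * hook_char 1 r i (reduced r w)) \<noteq> 0"
proof -
  interpret schur_matrices "1::complex" r "card (hook_index r i)" "hook_mat 1 r i"
    by (rule schur_hook_one[OF assms])
  have "(\<Sum>w | w permutes {1..r}. inverse (1::complex) ^ perm_length r w *
      (trace_mat (perm_mat (inv_into UNIV w)) * trace_mat (perm_mat w))) \<noteq> 0"
    using character_norm trace_nonzero by auto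
  then show ?thesis by (simp add: trace_hook_perm_mat permutes_inv)
qed

section \<open>The trace on the full exterior algebra\<close>

text \<open>The trace on the full exterior algebra with places \<open>1, \<dots>, n\<close>.\<close>

definition total_char :: "'a::comm_ring_1 \<Rightarrow> nat \<Rightarrow> nat list \<Rightarrow> 'a" where
  "total_char q n is = (\<Sum>S\<in>Pow {1..n}. hook_word q is (basis_fun S) S)"

lemma sum_hook_char:
  assumes "1 \<le> r"
  shows "(\<Sum>i = 0..r - 1. hook_char q r i is) = total_char q (r - 1) is"
proof -
  have U: "(\<Union>i\<in>{0..r - 1}. hook_index r i) = Pow {1..r - 1}"
  proof (intro equalityI subsetI)
    fix S assume "S \<in> Pow {1..r - 1}"
    moreover from this have "card S \<le> r - 1" using card_mono[of "{1..r - 1}" S] by simp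
    moreover have "{1..r - 1} = {1..<r}" using assms by auto
    ultimately show "S \<in> (\<Union>i\<in>{0..r - 1}. hook_index r i)" by (auto simp: hook_index_def)
  qed (use assms in \<open>force simp: hook_index_def\<close>)
  have "(\<Sum>i = 0..r - 1. hook_char q r i is) = (\<Sum>S\<in>(\<Union>i\<in>{0..r - 1}. hook_index r i). hook_word q is (basis_fun S) S)"
    unfolding hook_char_def
    by (rule sum.UNION_disjoint[symmetric]) (use finite_hook_index in \<open>auto simp: hook_index_def\<close>)
  then show ?thesis by (simp only: U total_char_def)
qed

lemma hook_op_insert_top:
  assumes "j \<le> n" and g: "\<And>X. Suc n \<in> X \<Longrightarrow> g X = 0" "\<And>X. Suc n \<notin> X \<Longrightarrow> g X = f (insert (Suc n) X)"
  shows "Suc n \<in> X \<Longrightarrow> hook_op q j g X = 0"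
    and "Suc n \<notin> X \<Longrightarrow> hook_op q j g X = hook_op q j f (insert (Suc n) X)"
proof -
  show "Suc n \<in> X \<Longrightarrow> hook_op q j g X = 0"
    using assms by (auto simp: hook_op_def)
  assume X: "Suc n \<notin> X"
  have "insert a (insert (Suc n) X - {j}) = insert (Suc n) (insert a (X - {j}))" for a
    using assms(1) by auto
  then show "hook_op q j g X = hook_op q j f (insert (Suc n) X)"
    using X assms(1) by (cases "j = n") (auto simp: hook_op_def g)
qed

text \<open>A word in the generators up to \<open>n\<close> never fills the place \<open>n + 1\<close>. Hence the coefficient of a set that
  contains this place only depends on the sets that contain it, and there the place is inert.\<close>

lemma hook_word_insert_top:
  assumes "set is \<subseteq> {1..n}" and g: "\<And>X. Suc n \<in> X \<Longrightarrow> g X = 0" "\<And>X. Suc n \<notin> X \<Longrightarrow> g X = f (insert (Suc n) X)"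
  shows "(Suc n \<in> X \<longrightarrow> hook_word q is g X = 0) \<and> (Suc n \<notin> X \<longrightarrow> hook_word q is g X = hook_word q is f (insert (Suc n) X))"
  using assms(1)
proof (induction "is" arbitrary: X)
  case (Cons j js)
  then have IH: "\<And>X. Suc n \<in> X \<Longrightarrow> hook_word q js g X = 0"
    "\<And>X. Suc n \<notin> X \<Longrightarrow> hook_word q js g X = hook_word q js f (insert (Suc n) X)" and "j \<le> n" by auto
  show ?case
    using hook_op_insert_top[OF \<open>j \<le> n\<close>, of "hook_word q js g" "hook_word q js f" X q, OF IH] by simp
qed (simp add: g)

text \<open>An occupied place above all generators of the word has no effect on diagonal coefficients.\<close>

lemma hook_word_spectator:
  assumes "set is \<subseteq> {1..n}" and S: "S \<subseteq> {1..n}"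
  shows "hook_word q is (basis_fun (insert (Suc n) S)) (insert (Suc n) S) = hook_word q is (basis_fun S) S"
proof -
  have S': "Suc n \<notin> S" using S by auto
  have "basis_fun S X = (0::'a)" if "Suc n \<in> X" for X using that S' by (auto simp: basis_fun_def)
  moreover have "basis_fun S X = (basis_fun (insert (Suc n) S) (insert (Suc n) X) :: 'a)" if "Suc n \<notin> X" for X
    using that S' by (simp add: basis_fun_def insert_ident)
  ultimately show ?thesis
    using hook_word_insert_top[OF assms(1), of "basis_fun S" "basis_fun (insert (Suc n) S)" S q] S' by simp
qed

lemma sum_Pow_Suc:
  "(\<Sum>S\<in>Pow {1..Suc n}. h S) = (\<Sum>S\<in>Pow {1..n}. h S) + (\<Sum>S\<in>Pow {1..n}. h (insert (Suc n) S))"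
proof -
  have "{1..Suc n} = insert (Suc n) {1..n}" by auto
  then have P: "Pow {1..Suc n} = Pow {1..n} \<union> insert (Suc n) ` Pow {1..n}" by (simp only: Pow_insert)
  have "(\<Sum>S\<in>Pow {1..Suc n}. h S) = (\<Sum>S\<in>Pow {1..n}. h S) + (\<Sum>S\<in>insert (Suc n) ` Pow {1..n}. h S)"
    unfolding P by (rule sum.union_disjoint) auto
  moreover have "inj_on (insert (Suc n)) (Pow {1..n})"
  proof (rule inj_onI)
    fix X Y assume "X \<in> Pow {1..n}" "Y \<in> Pow {1..n}" and eq: "insert (Suc n) X = insert (Suc n) Y"
    then have "Suc n \<notin> X" "Suc n \<notin> Y" by auto
    then show "X = Y" using eq by (simp add: insert_ident)
  qed
  ultimately show ?thesis by (simp add: sum.reindex)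
qed

lemma total_char_spectator:
  assumes "set is \<subseteq> {1..n}"
  shows "total_char q (Suc n) is = 2 * total_char q n is"
  unfolding total_char_def sum_Pow_Suc
  using hook_word_spectator[OF assms, of _ q] by (simp add: algebra_simps)

text \<open>Generators up to \<open>n\<close> neither fill nor empty the place \<open>n + 2\<close>.\<close>

lemma hook_word_vanish:
  assumes "set is \<subseteq> {1..n}" and g: "\<And>X. Suc (Suc n) \<notin> X \<Longrightarrow> g X = 0" and "Suc (Suc n) \<notin> X"
  shows "hook_word q is g X = 0"
  using assms(1,3)
proof (induction "is" arbitrary: X)
  case (Cons j js)
  then show ?case by (auto simp: hook_op_def)
qed (simp add: g)

lemma hook_word_add: "hook_word q is (\<lambda>X. f X + g X) S = hook_word q is f S + hook_word q is g S"
  by (induction "is" arbitrary: S) (auto simp: hook_op_def algebra_simps)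

lemma hook_word_smult: "hook_word q is (\<lambda>X. c * f X) S = c * hook_word q is f S"
  by (induction "is" arbitrary: S) (auto simp: hook_op_def algebra_simps)

text \<open>The largest generator applied to a basis vector: since the place \<open>n + 2\<close> is empty, only the place \<open>n\<close> can feed the place \<open>n + 1\<close>.\<close>

lemma hook_op_basis_top:
  assumes S: "S \<subseteq> {1..n}"
  shows "hook_op q (Suc n) (basis_fun (insert (Suc n) S)) = (\<lambda>X. - q * basis_fun (insert (Suc n) S) X)"
    and "hook_op q (Suc n) (basis_fun S) = (\<lambda>X. basis_fun S X +
       (if n \<in> S then q else 0) * basis_fun (insert (Suc n) (S - {n})) X)"
proof -
  have n: "Suc n \<notin> S" "Suc (Suc n) \<notin> S" using S by auto
  show "hook_op q (Suc n) (basis_fun (insert (Suc n) S)) = (\<lambda>X. - q * basis_fun (insert (Suc n) S) X)"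
  proof
    fix X
    have "insert a (X - {Suc n}) \<noteq> insert (Suc n) S" if "a \<noteq> Suc n" for a
    proof -
      have "Suc n \<notin> insert a (X - {Suc n})" using that by simp
      then show ?thesis by blast
    qed
    then have "insert n (X - {Suc n}) \<noteq> insert (Suc n) S" "insert (Suc (Suc n)) (X - {Suc n}) \<noteq> insert (Suc n) S"
      by simp_all
    moreover have "Suc n \<notin> X \<Longrightarrow> X \<noteq> insert (Suc n) S" by blast
    ultimately show "hook_op q (Suc n) (basis_fun (insert (Suc n) S)) X = - q * basis_fun (insert (Suc n) S) X"
      by (simp add: hook_op_def basis_fun_def)
  qed
  show "hook_op q (Suc n) (basis_fun S) = (\<lambda>X. basis_fun S X +
       (if n \<in> S then q else 0) * basis_fun (insert (Suc n) (S - {n})) X)"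
  proof
    fix X
    have A: "insert (Suc (Suc n)) (X - {Suc n}) \<noteq> S" using n(2) by blast
    show "hook_op q (Suc n) (basis_fun S) X = basis_fun S X +
       (if n \<in> S then q else 0) * basis_fun (insert (Suc n) (S - {n})) X"
    proof (cases "Suc n \<in> X")
      case True
      then have "X \<noteq> S" "insert (Suc n) (S - {n}) \<noteq> S" using n(1) by blast+
      have "(if n \<in> X then 0 else q * basis_fun S (insert n (X - {Suc n})))
          = (if insert n (X - {Suc n}) = S \<and> n \<notin> X then q else 0)"
        by (simp add: basis_fun_def)
      also have "\<dots> = (if n \<in> S \<and> X = insert (Suc n) (S - {n}) then q else 0)"
        using exchange_eq_iff[of n "Suc n" X S, OF _ True n(1)] by simp
      also have "\<dots> = (if n \<in> S then q else 0) * basis_fun (insert (Suc n) (S - {n})) X"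
        by (simp add: basis_fun_def)
      finally have "(if n \<in> X then 0 else q * basis_fun S (insert n (X - {Suc n})))
          = (if n \<in> S then q else 0) * basis_fun (insert (Suc n) (S - {n})) X" .
      moreover have "basis_fun S (insert (Suc (Suc n)) (X - {Suc n})) = (0::'a)" "basis_fun S X = (0::'a)"
        using A \<open>X \<noteq> S\<close> by (simp_all add: basis_fun_def)
      moreover have "hook_op q (Suc n) (basis_fun S) X = - q * basis_fun S X
          + (if n \<in> X then 0 else q * basis_fun S (insert n (X - {Suc n})))
          + (if Suc (Suc n) \<in> X then 0 else basis_fun S (insert (Suc (Suc n)) (X - {Suc n})))"
        using True by (simp add: hook_op_def)
      ultimately show ?thesis by (simp only: if_cancel) simp
    next
      case False
      then have "X \<noteq> insert (Suc n) (S - {n})" by blast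
      then show ?thesis using False by (simp add: hook_op_def basis_fun_def)
    qed
  qed
qed

text \<open>The sets with and without the place \<open>n + 1\<close> contribute \<open>-q\<close> and \<open>1\<close> times the smaller trace. The last sum
  collects the paths on which \<open>n\<close> first moves to \<open>n + 1\<close>.\<close>

lemma total_char_snoc:
  assumes "set is \<subseteq> {1..n}"
  shows "total_char q (Suc n) (is @ [Suc n]) = (1 - q) * total_char q n is +
    q * (\<Sum>S\<in>Pow {1..n}. if n \<in> S then hook_word q is (basis_fun (insert (Suc n) (S - {n}))) S else 0)"
proof -
  have "total_char q (Suc n) (is @ [Suc n]) =
      (\<Sum>S\<in>Pow {1..n}. hook_word q is (hook_op q (Suc n) (basis_fun S)) S) +
      (\<Sum>S\<in>Pow {1..n}. hook_word q is (hook_op q (Suc n) (basis_fun (insert (Suc n) S))) (insert (Suc n) S))"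
    by (simp only: total_char_def sum_Pow_Suc hook_word_append hook_word_simps)
  also have "(\<Sum>S\<in>Pow {1..n}. hook_word q is (hook_op q (Suc n) (basis_fun (insert (Suc n) S))) (insert (Suc n) S))
      = - q * total_char q n is"
    unfolding total_char_def sum_distrib_left
    by (rule sum.cong[OF refl]) (simp only: hook_op_basis_top(1) Pow_iff hook_word_smult hook_word_spectator[OF assms])
  also have "(\<Sum>S\<in>Pow {1..n}. hook_word q is (hook_op q (Suc n) (basis_fun S)) S)
      = (\<Sum>S\<in>Pow {1..n}. hook_word q is (basis_fun S) S +
          q * (if n \<in> S then hook_word q is (basis_fun (insert (Suc n) (S - {n}))) S else 0))"
    by (rule sum.cong[OF refl]) (simp add: hook_op_basis_top(2) hook_word_smult hook_word_add)
  finally show ?thesis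
    by (simp add: total_char_def sum.distrib sum_distrib_left algebra_simps sum_subtractf sum_negf)
qed

text \<open>Without the generator \<open>T\<^sub>n\<close> an element that has moved to \<open>n + 1\<close> cannot return.\<close>

lemma total_char_new_block:
  assumes "set is \<subseteq> {1..n - 1}"
  shows "total_char q (Suc n) (is @ [Suc n]) = (1 - q) * total_char q n is"
proof -
  have "hook_word q is (basis_fun (insert (Suc n) (S - {n}))) S = 0" if "S \<subseteq> {1..n}" "n \<in> S" for S
  proof -
    have n: "n = Suc (n - 1)" "Suc n \<notin> S" using that by auto
    show ?thesis
      by (rule hook_word_vanish[OF assms]) (use n in \<open>auto simp: basis_fun_def\<close>)
  qed
  then have "(\<Sum>S\<in>Pow {1..n}. if n \<in> S then hook_word q is (basis_fun (insert (Suc n) (S - {n}))) S else 0) = 0"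
    by (intro sum.neutral) auto
  moreover have "{1..n - 1} \<subseteq> {1..n}" by auto
  ultimately show ?thesis using total_char_snoc[OF subset_trans[OF assms], of n q] by simp
qed

text \<open>An element that has moved from \<open>n + 1\<close> to \<open>n + 2\<close> must return at the very next generator. After
  that the place \<open>n + 1\<close> is occupied and inert, which leaves the trace for two places less.\<close>

lemma total_char_extend_block:
  assumes "set is \<subseteq> {1..n}"
  shows "total_char q (Suc (Suc n)) (is @ [Suc n, Suc (Suc n)]) =
    (1 - q) * total_char q (Suc n) (is @ [Suc n]) + q * total_char q n is"
proof -
  let ?n = "Suc n" and ?m = "Suc (Suc n)"
  have "hook_word q (is @ [?n]) (basis_fun (insert ?m (insert ?n S - {?n}))) (insert ?n S) = hook_word q is (basis_fun S) S"
    if S: "S \<subseteq> {1..n}" for S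
  proof -
    have n: "?n \<notin> S" "?m \<notin> S" using S by auto
    let ?T = "insert ?m S"
    \<comment> \<open>Apart from the returning term, everything that the next generator produces still occupies the place \<open>n + 2\<close>.\<close>
    define g where "g X = hook_op q ?n (basis_fun ?T) X - basis_fun (insert ?n S) X" for X
    have "g X = 0" if X: "?m \<notin> X" for X
    proof -
      have "?m \<notin> insert n (X - {?n})" using X by simp
      then have a: "insert n (X - {?n}) \<noteq> ?T" "X \<noteq> ?T" using X by blast+
      have b: "insert ?m (X - {?n}) = ?T \<longleftrightarrow> X = insert ?n S" if "?n \<in> X"
      proof -
        have "insert ?m (X - {?n}) = ?T \<longleftrightarrow> X - {?n} = S" using X n by (simp add: insert_ident)
        also have "\<dots> \<longleftrightarrow> X = insert ?n S"
          using insert_Diff[OF that] Diff_insert_absorb[OF n(1)] by metis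
        finally show ?thesis .
      qed
      show ?thesis
      proof (cases "?n \<in> X")
        case True
        then show ?thesis using X a b[OF True] by (simp add: g_def hook_op_def basis_fun_def)
      next
        case False
        then have "X \<noteq> insert ?n S" by blast
        then show ?thesis using False a by (simp add: g_def hook_op_def basis_fun_def)
      qed
    qed
    then have z: "hook_word q is g (insert ?n S) = 0"
      by (rule hook_word_vanish[OF assms]) (use n in auto)
    have "hook_op q ?n (basis_fun ?T) = (\<lambda>X. basis_fun (insert ?n S) X + g X)" by (simp add: g_def)
    then have "hook_word q (is @ [?n]) (basis_fun ?T) (insert ?n S)
       = hook_word q is (basis_fun (insert ?n S)) (insert ?n S)"
      by (simp add: hook_word_append hook_word_add z)
    also have "\<dots> = hook_word q is (basis_fun S) S" by (rule hook_word_spectator[OF assms S])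
    finally show ?thesis using n by simp
  qed
  then have "(\<Sum>S\<in>Pow {1..?n}. if ?n \<in> S then hook_word q (is @ [?n]) (basis_fun (insert ?m (S - {?n}))) S else 0)
     = total_char q n is"
    unfolding sum_Pow_Suc total_char_def
    by (intro trans[OF arg_cong2[where f = "(+)", OF sum.neutral sum.cong[OF refl]]]) auto
  moreover have "set (is @ [?n]) \<subseteq> {1..?n}" using assms by auto
  ultimately show ?thesis using total_char_snoc[of "is @ [?n]" ?n q] by simp
qed

text \<open>The partial sums of the geometric series satisfy the recursion \<open>t\<^sub>k = (1 - q) t\<^sub>k\<^sub>-\<^sub>1 + q t\<^sub>k\<^sub>-\<^sub>2\<close>.\<close>

lemma total_char_block:
  assumes "set is \<subseteq> {1..a - 1}"
  shows "total_char q (a + k) (is @ [a + 1..<a + k + 1]) = (\<Sum>i<Suc k. (- q) ^ i) * total_char q a is"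
proof (induction k rule: less_induct)
  case (less k)
  consider "k = 0" | "k = 1" | m where "k = Suc (Suc m)"
    by (metis One_nat_def not0_implies_Suc)
  then show ?case
  proof cases
    case 1
    then show ?thesis by simp
  next
    case 2
    then show ?thesis using total_char_new_block[OF assms] by simp
  next
    case (3 m)
    have sub: "set (is @ [a + 1..<a + m + 1]) \<subseteq> {1..a + m}"
    proof -
      have "{1..a - 1} \<subseteq> {1..a + m}" by auto
      then show ?thesis using assms by (auto simp del: One_nat_def)
    qed
    have "total_char q (a + k) (is @ [a + 1..<a + k + 1]) =
       (1 - q) * total_char q (a + Suc m) (is @ [a + 1..<a + Suc m + 1]) + q * total_char q (a + m) (is @ [a + 1..<a + m + 1])"
      using total_char_extend_block[OF sub, of q] by (simp add: 3)
    also have "\<dots> = ((1 - q) * (\<Sum>i<Suc (Suc m). (- q) ^ i) + q * (\<Sum>i<Suc m. (- q) ^ i)) * total_char q a is"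
      using less[of m] less[of "Suc m"] 3 by (simp only: algebra_simps)
    also have "(1 - q) * (\<Sum>i<Suc (Suc m). (- q) ^ i) + q * (\<Sum>i<Suc m. (- q) ^ i) = (\<Sum>i<Suc k. (- q) ^ i)"
      by (simp add: 3 algebra_simps)
    finally show ?thesis .
  qed
qed

definition standard_word :: "nat list \<Rightarrow> nat list" where
  "standard_word mu = concat (map (\<lambda>i. [sum_list (take i mu) + 1 ..< sum_list (take (i + 1) mu)]) [0..<length mu])"

lemma standard_word_snoc: "standard_word (mu @ [k]) = standard_word mu @ [sum_list mu + 1..<sum_list mu + k]"
proof -
  let ?F = "\<lambda>mu i. [sum_list (take i mu) + 1 ..< sum_list (take (i + 1) mu)]"
  have "map (?F (mu @ [k])) [0..<length mu] = map (?F mu) [0..<length mu]"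
  proof (rule map_cong[OF refl])
    fix i assume "i \<in> set [0..<length mu]"
    then have "take i (mu @ [k]) = take i mu" "take (i + 1) (mu @ [k]) = take (i + 1) mu" by auto
    then show "?F (mu @ [k]) i = ?F mu i" by (simp only:)
  qed
  moreover have "?F (mu @ [k]) (length mu) = [sum_list mu + 1..<sum_list mu + k]" by simp
  moreover have "[0..<length (mu @ [k])] = [0..<length mu] @ [length mu]" by simp
  ultimately show ?thesis
    by (simp only: standard_word_def map_append concat_append list.map concat.simps append_Nil2)
qed

lemma standard_word_subset: "set (standard_word mu) \<subseteq> {1..sum_list mu - 1}"
proof (induction mu rule: rev_induct)
  case (snoc k mu)
  then show ?case by (auto simp: standard_word_snoc) force+
qed (simp add: standard_word_def)

text \<open>Blocks are added from the left to the right; before each new block the place between the blocks contributes the factor \<open>2\<close>.\<close>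

theorem total_char_standard_word:
  assumes "mu \<noteq> []" "\<forall>m\<in>set mu. 0 < m"
  shows "total_char q (sum_list mu - 1) (standard_word mu) =
    2 ^ (length mu - 1) * (\<Prod>i<length mu. \<Sum>k<mu ! i. (- q) ^ k)"
  using assms
proof (induction mu rule: rev_induct)
  case (snoc m mu)
  have m: "m = Suc (m - 1)" using snoc.prems by simp
  let ?s = "sum_list mu"
  have "total_char q (sum_list (mu @ [m]) - 1) (standard_word (mu @ [m]))
     = total_char q (?s + (m - 1)) (standard_word mu @ [?s + 1..<?s + (m - 1) + 1])"
    using m by (simp add: standard_word_snoc)
  also have "\<dots> = (\<Sum>k<m. (- q) ^ k) * total_char q ?s (standard_word mu)"
    using total_char_block[OF standard_word_subset, of q mu "m - 1"] m by simp
  finally have step: "total_char q (sum_list (mu @ [m]) - 1) (standard_word (mu @ [m]))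
     = (\<Sum>k<m. (- q) ^ k) * total_char q ?s (standard_word mu)" .
  have prod: "(\<Prod>i<length (mu @ [m]). \<Sum>k<(mu @ [m]) ! i. (- q) ^ k)
     = (\<Prod>i<length mu. \<Sum>k<mu ! i. (- q) ^ k) * (\<Sum>k<m. (- q) ^ k)"
    by (simp add: nth_append)
  show ?case
  proof (cases "mu = []")
    case True
    then show ?thesis using step by (simp add: standard_word_def total_char_def basis_fun_def)
  next
    case False
    then have "0 < ?s" using snoc.prems by (cases mu) auto
    then have s: "?s = Suc (?s - 1)" by simp
    have "total_char q ?s (standard_word mu) = 2 * total_char q (?s - 1) (standard_word mu)"
      using total_char_spectator[OF standard_word_subset, of q mu] s by simp
    moreover have two: "2 ^ length mu = (2::'a) * 2 ^ (length mu - 1)" using False by (cases mu) auto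
    ultimately show ?thesis
      unfolding step prod using snoc.IH[OF False] snoc.prems two by (simp add: mult_ac)
  qed
qed simp

section \<open>The Hecke algebra as a quotient of the free algebra\<close>

lemma letters_zero [simp]: "letters 0 = []" and letters_plus [simp]: "letters (x + y) = letters x @ letters y"
  by (simp_all add: zero_free_monoid_def plus_free_monoid_def)

lemma free_algebra_simps [simp]:
  "carrier (free_algebra r) = {p. \<forall>x\<in>Poly_Mapping.keys p. set (letters x) \<subseteq> {1..<r}}"
  "x \<otimes>\<^bsub>free_algebra r\<^esub> y = x * y" "\<one>\<^bsub>free_algebra r\<^esub> = 1"
  "\<zero>\<^bsub>free_algebra r\<^esub> = 0" "x \<oplus>\<^bsub>free_algebra r\<^esub> y = x + y"
  by (simp_all add: free_algebra_def)

lemma free_algebra_add: "p \<in> carrier (free_algebra r) \<Longrightarrow> q \<in> carrier (free_algebra r) \<Longrightarrow> p + q \<in> carrier (free_algebra r)"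
  using keys_add[of p q] by auto

lemma free_algebra_mult:
  assumes "p \<in> carrier (free_algebra r)" "q \<in> carrier (free_algebra r)"
  shows "p * q \<in> carrier (free_algebra r)"
proof -
  have "set (letters z) \<subseteq> {1..<r}" if "z \<in> Poly_Mapping.keys (p * q)" for z
  proof -
    from subsetD[OF keys_mult that]
    obtain x y where "x \<in> Poly_Mapping.keys p" "y \<in> Poly_Mapping.keys q" "z = x + y" by blast
    then show ?thesis using assms by simp
  qed
  then show ?thesis by simp
qed

lemma free_algebra_uminus: "p \<in> carrier (free_algebra r) \<Longrightarrow> - p \<in> carrier (free_algebra r)"
  by (simp add: in_keys_iff)

lemma ring_free_algebra: "ring (free_algebra r)"
proof (rule ringI)
  show "abelian_group (free_algebra r)"
  proof (rule abelian_groupI)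
    fix x assume x: "x \<in> carrier (free_algebra r)"
    then show "\<exists>y\<in>carrier (free_algebra r). y \<oplus>\<^bsub>free_algebra r\<^esub> x = \<zero>\<^bsub>free_algebra r\<^esub>"
      by (intro bexI[of _ "- x"] free_algebra_uminus) simp_all
  next
    fix x y assume "x \<in> carrier (free_algebra r)" "y \<in> carrier (free_algebra r)"
    then show "x \<oplus>\<^bsub>free_algebra r\<^esub> y \<in> carrier (free_algebra r)"
      using free_algebra_add by (simp only: free_algebra_simps(5))
  qed (simp_all add: add_ac)
  show "monoid (free_algebra r)"
  proof (rule monoidI)
    fix x y assume "x \<in> carrier (free_algebra r)" "y \<in> carrier (free_algebra r)"
    then show "x \<otimes>\<^bsub>free_algebra r\<^esub> y \<in> carrier (free_algebra r)"
      using free_algebra_mult by (simp only: free_algebra_simps(2))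
  qed (simp_all add: mult.assoc)
qed (simp_all add: algebra_simps)

interpretation free: ring "free_algebra r" for r by (rule ring_free_algebra)

lemma const_carrier: "const c \<in> carrier (free_algebra r)"
  by simp

lemma gen_carrier: "j \<in> {1..<r} \<Longrightarrow> gen j \<in> carrier (free_algebra r)"
  by simp

lemma free_algebra_minus: "p \<in> carrier (free_algebra r) \<Longrightarrow> q \<in> carrier (free_algebra r) \<Longrightarrow> p - q \<in> carrier (free_algebra r)"
  using free_algebra_add[OF _ free_algebra_uminus, of p r q] by (simp only: diff_conv_add_uminus)

lemma hecke_relators_carrier: "hecke_relators r \<subseteq> carrier (free_algebra r)"
proof
  fix x assume "x \<in> hecke_relators r"
  then consider i where "i \<in> {1..<r}" "x = gen i * gen i - (const (1 - qq) * gen i + const qq)"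
    | i j where "i \<in> {1..<r}" "j \<in> {1..<r}" "x = gen i * gen j - gen j * gen i"
    | i where "i \<in> {1..<r}" "i + 1 \<in> {1..<r}"
      "x = gen i * gen (i + 1) * gen i - gen (i + 1) * gen i * gen (i + 1)"
    unfolding hecke_relators_def by blast
  then show "x \<in> carrier (free_algebra r)"
    by cases (simp_all only: free_algebra_minus free_algebra_add free_algebra_mult const_carrier gen_carrier)
qed

lemma hecke_ideal: "ideal (hecke_ideal r) (free_algebra r)"
  unfolding hecke_ideal_def by (rule free.genideal_ideal[OF hecke_relators_carrier])

lemma ring_hecke: "ring (hecke r)"
  unfolding hecke_def by (rule ideal.quotient_is_ring[OF hecke_ideal])

interpretation hecke: ring "hecke r" for r by (rule ring_hecke)

definition hecke_class :: "nat \<Rightarrow> free_alg \<Rightarrow> free_alg set" where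
  "hecke_class r p = hecke_ideal r +>\<^bsub>free_algebra r\<^esub> p"

lemma hecke_class_hom: "hecke_class r \<in> Ring.ring_hom (free_algebra r) (hecke r)"
  unfolding hecke_class_def[abs_def] hecke_def by (rule ideal.rcos_ring_hom[OF hecke_ideal])

lemma hecke_class_add: "p \<in> carrier (free_algebra r) \<Longrightarrow> q \<in> carrier (free_algebra r) \<Longrightarrow>
    hecke_class r (p + q) = hecke_class r p \<oplus>\<^bsub>hecke r\<^esub> hecke_class r q"
  using ring_hom_add[OF hecke_class_hom, of p r q] by (simp only: free_algebra_simps(5))

lemma hecke_class_mult: "p \<in> carrier (free_algebra r) \<Longrightarrow> q \<in> carrier (free_algebra r) \<Longrightarrow>
    hecke_class r (p * q) = hecke_class r p \<otimes>\<^bsub>hecke r\<^esub> hecke_class r q"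
  using ring_hom_mult[OF hecke_class_hom, of p r q] by (simp only: free_algebra_simps(2))

lemma hecke_class_one: "hecke_class r 1 = \<one>\<^bsub>hecke r\<^esub>"
  using ring_hom_one[OF hecke_class_hom, of r] by (simp only: free_algebra_simps(3))

lemma hecke_class_carrier: "p \<in> carrier (free_algebra r) \<Longrightarrow> hecke_class r p \<in> carrier (hecke r)"
  by (rule ring_hom_closed[OF hecke_class_hom])

lemma carrier_hecke: "carrier (hecke r) = hecke_class r ` carrier (free_algebra r)"
  by (auto simp: hecke_def FactRing_def A_RCOSETS_def' hecke_class_def)

lemma hecke_scalar_eq: "hecke_scalar r c = hecke_class r (const c)"
  and hecke_T_eq: "hecke_T r j = hecke_class r (gen j)"
  by (simp_all add: hecke_scalar_def hecke_T_def hecke_class_def)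

lemma hecke_class_zero: "p \<in> hecke_ideal r \<Longrightarrow> hecke_class r p = \<zero>\<^bsub>hecke r\<^esub>"
proof -
  assume p: "p \<in> hecke_ideal r"
  have sub: "additive_subgroup (hecke_ideal r) (free_algebra r)" by (rule ideal.axioms(1)[OF hecke_ideal])
  from free.a_coset_join2[OF additive_subgroup.a_Hcarr[OF sub p] additive_subgroup.a_subgroup[OF sub] p]
  show ?thesis by (simp add: hecke_class_def hecke_def FactRing_def)
qed

lemma hecke_class_eqI:
  assumes "p - q \<in> hecke_ideal r" "p \<in> carrier (free_algebra r)" "q \<in> carrier (free_algebra r)"
  shows "hecke_class r p = hecke_class r q"
proof -
  have "hecke_class r p = hecke_class r ((p - q) + q)" by simp
  also have "\<dots> = hecke_class r (p - q) \<oplus>\<^bsub>hecke r\<^esub> hecke_class r q"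
    by (intro hecke_class_add free_algebra_minus assms)
  also have "\<dots> = hecke_class r q"
    using hecke_class_carrier[OF assms(3)] by (simp add: hecke_class_zero[OF assms(1)])
  finally show ?thesis .
qed

lemma hecke_class_relator: "p - q \<in> hecke_relators r \<Longrightarrow> p \<in> carrier (free_algebra r) \<Longrightarrow> q \<in> carrier (free_algebra r) \<Longrightarrow>
    hecke_class r p = hecke_class r q"
  using subsetD[OF free.genideal_self[OF hecke_relators_carrier[of r]]]
  by (intro hecke_class_eqI) (simp_all only: hecke_ideal_def)

lemma hecke_relators:
  "i \<in> {1..<r} \<Longrightarrow> gen i * gen i - (const (1 - qq) * gen i + const qq) \<in> hecke_relators r"
  "i \<in> {1..<r} \<Longrightarrow> j \<in> {1..<r} \<Longrightarrow> i + 2 \<le> j \<Longrightarrow> gen i * gen j - gen j * gen i \<in> hecke_relators r"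
  "i \<in> {1..<r} \<Longrightarrow> i + 1 \<in> {1..<r} \<Longrightarrow>
     gen i * gen (i + 1) * gen i - gen (i + 1) * gen i * gen (i + 1) \<in> hecke_relators r"
  unfolding hecke_relators_def by blast+

lemma hecke_T_carrier: "j \<in> {1..<r} \<Longrightarrow> hecke_T r j \<in> carrier (hecke r)"
  and hecke_scalar_carrier: "hecke_scalar r c \<in> carrier (hecke r)"
  unfolding hecke_T_eq hecke_scalar_eq by (intro hecke_class_carrier gen_carrier; assumption) (intro hecke_class_carrier const_carrier)

lemma hecke_word_Nil: "hecke_word r [] = \<one>\<^bsub>hecke r\<^esub>"
  and hecke_word_Cons: "hecke_word r (j # js) = hecke_T r j \<otimes>\<^bsub>hecke r\<^esub> hecke_word r js"
  by (simp_all add: hecke_word_def)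

lemma hecke_word_carrier: "set is \<subseteq> {1..<r} \<Longrightarrow> hecke_word r is \<in> carrier (hecke r)"
proof (induction "is")
  case (Cons j js)
  then show ?case unfolding hecke_word_Cons by (intro hecke.m_closed hecke_T_carrier) auto
qed (simp add: hecke_word_Nil)

lemma hecke_class_word: "set is \<subseteq> {1..<r} \<Longrightarrow> hecke_class r (Poly_Mapping.single (Word is) 1) = hecke_word r is"
proof (induction "is")
  case Nil
  have "Poly_Mapping.single (Word []) 1 = (1 :: free_alg)"
    by (simp add: zero_free_monoid_def[symmetric])
  then show ?case by (simp only: hecke_word_Nil hecke_class_one)
next
  case (Cons j js)
  have "Poly_Mapping.single (Word (j # js)) 1 = gen j * Poly_Mapping.single (Word js) 1"
    by (simp add: mult_single plus_free_monoid_def)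
  moreover have "gen j \<in> carrier (free_algebra r)" "Poly_Mapping.single (Word js) 1 \<in> carrier (free_algebra r)"
    using Cons.prems by simp_all
  ultimately show ?case using Cons by (simp add: hecke_class_mult hecke_T_eq hecke_word_Cons del: free_algebra_simps)
qed

lemma sum_single_lookup: "(p::free_alg) = (\<Sum>x\<in>Poly_Mapping.keys p. Poly_Mapping.single x (Poly_Mapping.lookup p x))"
  by (rule poly_mapping_eqI)
     (auto simp: lookup_sum lookup_single when_def in_keys_iff sum.delta' intro!: sum.neutral)

text \<open>Each element of the free algebra is a sum of scalars times words.\<close>

lemma hecke_induct [consumes 1, case_names scalar gen add mult]:
  assumes h: "h \<in> carrier (hecke r)"
    and scalar: "\<And>c. P (hecke_scalar r c)" and gen: "\<And>j. j \<in> {1..<r} \<Longrightarrow> P (hecke_T r j)"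
    and add: "\<And>x y. x \<in> carrier (hecke r) \<Longrightarrow> y \<in> carrier (hecke r) \<Longrightarrow> P x \<Longrightarrow> P y \<Longrightarrow> P (x \<oplus>\<^bsub>hecke r\<^esub> y)"
    and mult: "\<And>x y. x \<in> carrier (hecke r) \<Longrightarrow> y \<in> carrier (hecke r) \<Longrightarrow> P x \<Longrightarrow> P y \<Longrightarrow> P (x \<otimes>\<^bsub>hecke r\<^esub> y)"
  shows "P h"
proof -
  obtain p where p: "p \<in> carrier (free_algebra r)" "h = hecke_class r p" using h carrier_hecke by blast
  have one: "P \<one>\<^bsub>hecke r\<^esub>"
    using scalar[of 1] by (simp add: hecke_scalar_eq hecke_class_one)
  have word: "P (hecke_word r is)" if "set is \<subseteq> {1..<r}" for "is"
    using that
  proof (induction "is")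
    case (Cons j js)
    then show ?case unfolding hecke_word_Cons
      by (intro mult gen hecke_T_carrier hecke_word_carrier) auto
  qed (simp add: hecke_word_Nil one)
  have single: "P (hecke_class r (Poly_Mapping.single x c))" if x: "set (letters x) \<subseteq> {1..<r}" for x c
  proof -
    have "Poly_Mapping.single x c = const c * Poly_Mapping.single (Word (letters x)) 1"
      by (simp add: mult_single)
    moreover have "Poly_Mapping.single (Word (letters x)) 1 \<in> carrier (free_algebra r)" using x by simp
    ultimately have "hecke_class r (Poly_Mapping.single x c) = hecke_scalar r c \<otimes>\<^bsub>hecke r\<^esub> hecke_word r (letters x)"
      using hecke_class_mult[OF const_carrier] hecke_class_word[OF x] by (simp only: hecke_scalar_eq)
    then show ?thesis using mult[OF hecke_scalar_carrier hecke_word_carrier[OF x] scalar word[OF x]] by simp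
  qed
  have "P (hecke_class r (\<Sum>x\<in>K. Poly_Mapping.single x (c x))) \<and>
      (\<Sum>x\<in>K. Poly_Mapping.single x (c x)) \<in> carrier (free_algebra r)"
    if "finite K" "\<And>x. x \<in> K \<Longrightarrow> set (letters x) \<subseteq> {1..<r}" for K c
    using that
  proof (induction K rule: finite_induct)
    case empty
    have "hecke_class r 0 = hecke_scalar r 0" by (simp add: hecke_scalar_eq)
    then show ?case using scalar[of 0] by simp
  next
    case (insert x K)
    have c: "Poly_Mapping.single x (c x) \<in> carrier (free_algebra r)" using insert.prems by simp
    have IH: "P (hecke_class r (\<Sum>x\<in>K. Poly_Mapping.single x (c x)))"
      "(\<Sum>x\<in>K. Poly_Mapping.single x (c x)) \<in> carrier (free_algebra r)"
      using insert by auto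
    show ?case unfolding sum.insert[OF insert.hyps] hecke_class_add[OF c IH(2)]
      using insert.prems by (intro conjI add single free_algebra_add hecke_class_carrier c IH) auto
  qed
  from this[of "Poly_Mapping.keys p" "Poly_Mapping.lookup p"] p show ?thesis
    using sum_single_lookup[of p] by simp
qed

text \<open>The relators vanish in the quotient, so the images of the generators satisfy the Hecke relations.\<close>

lemma hecke_rep_matrices:
  assumes "hecke_rep r n \<rho>"
  shows "hecke_matrices qq r n (\<lambda>j. \<rho> (hecke_T r j))"
    and "set is \<subseteq> {1..<r} \<Longrightarrow> \<rho> (hecke_word r is) = word_mat n (\<lambda>j. \<rho> (hecke_T r j)) is"
proof -
  let ?c = "hecke_class r"
  have hom: "\<rho> \<in> Ring.ring_hom (hecke r) (ring_mat TYPE(ratfun) n ())"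
    and scalar: "\<And>c. \<rho> (?c (const c)) = c \<cdot>\<^sub>m 1\<^sub>m n"
    using assms by (simp_all add: hecke_rep_def hecke_scalar_eq)
  have carr: "\<rho> (?c p) \<in> carrier_mat n n" if "p \<in> carrier (free_algebra r)" for p
    using ring_hom_closed[OF hom hecke_class_carrier[OF that]] by (simp add: ring_mat_simps)
  have add: "\<rho> (?c (p + p')) = \<rho> (?c p) + \<rho> (?c p')"
    and mult: "\<rho> (?c (p * p')) = \<rho> (?c p) * \<rho> (?c p')"
    if "p \<in> carrier (free_algebra r)" "p' \<in> carrier (free_algebra r)" for p p'
    using ring_hom_add[OF hom hecke_class_carrier hecke_class_carrier, OF that]
      ring_hom_mult[OF hom hecke_class_carrier hecke_class_carrier, OF that]
    by (simp_all add: ring_mat_simps hecke_class_add[OF that] hecke_class_mult[OF that])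
  note closed = gen_carrier const_carrier free_algebra_mult free_algebra_add
  show mats: "hecke_matrices qq r n (\<lambda>j. \<rho> (hecke_T r j))"
    unfolding hecke_T_eq
  proof
    fix j assume j: "j \<in> {1..<r}"
    show "\<rho> (?c (gen j)) \<in> carrier_mat n n" by (rule carr[OF gen_carrier[OF j]])
    have "?c (gen j * gen j) = ?c (const (1 - qq) * gen j + const qq)"
      by (intro hecke_class_relator hecke_relators closed j)
    from arg_cong[OF this, of \<rho>]
    have "\<rho> (?c (gen j)) * \<rho> (?c (gen j)) = ((1 - qq) \<cdot>\<^sub>m 1\<^sub>m n) * \<rho> (?c (gen j)) + qq \<cdot>\<^sub>m 1\<^sub>m n"
      by (simp only: add mult scalar gen_carrier[OF j] const_carrier free_algebra_mult free_algebra_add)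
    also have "((1 - qq) \<cdot>\<^sub>m 1\<^sub>m n) * \<rho> (?c (gen j)) = (1 - qq) \<cdot>\<^sub>m \<rho> (?c (gen j))"
      using mult_smult_assoc_mat[OF one_carrier_mat carr[OF gen_carrier[OF j]]] left_mult_one_mat[OF carr[OF gen_carrier[OF j]]] by simp
    finally show "\<rho> (?c (gen j)) * \<rho> (?c (gen j)) = (1 - qq) \<cdot>\<^sub>m \<rho> (?c (gen j)) + qq \<cdot>\<^sub>m 1\<^sub>m n" .
  next
    fix i j assume ij: "i \<in> {1..<r}" "j \<in> {1..<r}" "i + 2 \<le> j"
    have "?c (gen i * gen j) = ?c (gen j * gen i)"
      by (intro hecke_class_relator hecke_relators closed ij)
    from arg_cong[OF this, of \<rho>]
    show "\<rho> (?c (gen i)) * \<rho> (?c (gen j)) = \<rho> (?c (gen j)) * \<rho> (?c (gen i))"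
      by (simp only: mult gen_carrier[OF ij(1)] gen_carrier[OF ij(2)])
  next
    fix i assume i: "i \<in> {1..<r}" "i + 1 \<in> {1..<r}"
    have "?c (gen i * gen (i + 1) * gen i) = ?c (gen (i + 1) * gen i * gen (i + 1))"
      by (intro hecke_class_relator hecke_relators closed i)
    from arg_cong[OF this, of \<rho>]
    show "\<rho> (?c (gen i)) * \<rho> (?c (gen (i + 1))) * \<rho> (?c (gen i))
        = \<rho> (?c (gen (i + 1))) * \<rho> (?c (gen i)) * \<rho> (?c (gen (i + 1)))"
      by (simp only: mult gen_carrier[OF i(1)] gen_carrier[OF i(2)] free_algebra_mult)
  qed
  show "\<rho> (hecke_word r is) = word_mat n (\<lambda>j. \<rho> (hecke_T r j)) is" if "set is \<subseteq> {1..<r}"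
    using that
  proof (induction "is")
    case Nil
    then show ?case using ring_hom_one[OF hom] by (simp add: hecke_word_Nil ring_mat_simps)
  next
    case (Cons j js)
    then have "hecke_T r j \<in> carrier (hecke r)" "hecke_word r js \<in> carrier (hecke r)"
      using hecke_T_carrier hecke_word_carrier by auto
    from ring_hom_mult[OF hom this] Cons show ?case by (simp add: hecke_word_Cons ring_mat_simps)
  qed
qed

lemma hecke_Tw_eq: "hecke_Tw r w = hecke_word r (reduced r w)"
  by (simp add: hecke_Tw_def reduced_def)

lemma mat_trace_eq: "mat_trace A = trace_mat A"
  by (simp add: mat_trace_def trace_mat_def)

section \<open>Representations from matrices\<close>

lemma smult_one_mat [simp]: "1 \<cdot>\<^sub>m A = (A :: 'a::comm_ring_1 mat)"
  by (intro eq_matI) auto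

text \<open>The evaluation of a noncommutative polynomial at the matrices \<open>A\<close>.\<close>

definition eval_mat :: "nat \<Rightarrow> (nat \<Rightarrow> ratfun mat) \<Rightarrow> free_alg \<Rightarrow> ratfun mat" where
  "eval_mat n A p = mat n n (\<lambda>(k, l). \<Sum>x\<in>Poly_Mapping.keys p. Poly_Mapping.lookup p x * word_mat n A (letters x) $$ (k, l))"

lemma eval_mat_carrier: "eval_mat n A p \<in> carrier_mat n n"
  by (simp add: eval_mat_def)

lemma eval_mat_add: "eval_mat n A (p + q) = eval_mat n A p + eval_mat n A q"
proof (rule eq_matI)
  fix k l assume "k < dim_row (eval_mat n A p + eval_mat n A q)" "l < dim_col (eval_mat n A p + eval_mat n A q)"
  then have kl: "k < n" "l < n" by (simp_all add: eval_mat_def)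
  have "eval_mat n A (p + q) $$ (k, l) = eval_mat n A p $$ (k, l) + eval_mat n A q $$ (k, l)"
    using kl setsum_keys_plus_distrib[of "\<lambda>x c. c * word_mat n A (letters x) $$ (k, l)" p q]
    by (simp add: eval_mat_def algebra_simps)
  then show "eval_mat n A (p + q) $$ (k, l) = (eval_mat n A p + eval_mat n A q) $$ (k, l)"
    using kl by (simp add: eval_mat_def)
qed (simp_all add: eval_mat_def)

lemma eval_mat_single:
  assumes "word_mat n A (letters x) \<in> carrier_mat n n"
  shows "eval_mat n A (Poly_Mapping.single x c) = c \<cdot>\<^sub>m word_mat n A (letters x)"
  using assms by (intro eq_matI) (auto simp: eval_mat_def)

lemma eval_mat_sum_entry:
  "finite X \<Longrightarrow> k < n \<Longrightarrow> l < n \<Longrightarrow> eval_mat n A (\<Sum>x\<in>X. f x) $$ (k, l) = (\<Sum>x\<in>X. eval_mat n A (f x) $$ (k, l))"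
proof (induction X rule: finite_induct)
  case empty
  then show ?case by (simp add: eval_mat_def)
next
  case (insert x X)
  then show ?case using eval_mat_carrier[of n A "sum f X"] eval_mat_carrier[of n A "f x"] by (simp add: eval_mat_add)
qed

context
  fixes r n :: nat and A :: "nat \<Rightarrow> ratfun mat"
  assumes mats: "hecke_matrices qq r n A"
begin

interpretation hecke_matrices qq r n A by (rule mats)

lemma eval_mat_mult:
  assumes p: "p \<in> carrier (free_algebra r)" and q: "q \<in> carrier (free_algebra r)"
  shows "eval_mat n A (p * q) = eval_mat n A p * eval_mat n A q"
proof (rule eq_matI)
  fix k l assume "k < dim_row (eval_mat n A p * eval_mat n A q)" "l < dim_col (eval_mat n A p * eval_mat n A q)"
  then have kl: "k < n" "l < n" by (simp_all add: eval_mat_def)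
  let ?W = "\<lambda>x. word_mat n A (letters x)" and ?K = Poly_Mapping.keys and ?l = Poly_Mapping.lookup
  have prod: "eval_mat n A (Poly_Mapping.single x c * Poly_Mapping.single y d) $$ (k, l)
      = (\<Sum>m<n. (c * ?W x $$ (k, m)) * (d * ?W y $$ (m, l)))"
    if "x \<in> ?K p" "y \<in> ?K q" for x y c d
  proof -
    have xy: "set (letters x) \<subseteq> {1..<r}" "set (letters y) \<subseteq> {1..<r}" using p q that by auto
    note cx = word_mat_carrier[OF xy(1)] and cy = word_mat_carrier[OF xy(2)]
    have "?W (x + y) = ?W x * ?W y" using word_mat_append[OF xy] by simp
    then have "eval_mat n A (Poly_Mapping.single x c * Poly_Mapping.single y d) = (c * d) \<cdot>\<^sub>m (?W x * ?W y)"
      using eval_mat_single[of n A "x + y" "c * d"] cx cy by (simp add: mult_single)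
    then show ?thesis
      using kl cx cy mult_mat_entry[OF cx cy kl] by (simp add: sum_distrib_left mult_ac)
  qed
  have "p * q = (\<Sum>x\<in>?K p. \<Sum>y\<in>?K q. Poly_Mapping.single x (?l p x) * Poly_Mapping.single y (?l q y))"
    by (subst sum_single_lookup[of p], subst sum_single_lookup[of q]) (rule sum_product)
  then have "eval_mat n A (p * q) $$ (k, l) = (\<Sum>x\<in>?K p. \<Sum>y\<in>?K q. \<Sum>m<n.
       (?l p x * ?W x $$ (k, m)) * (?l q y * ?W y $$ (m, l)))"
    using kl by (simp add: eval_mat_sum_entry prod)
  also have "\<dots> = (\<Sum>m<n. \<Sum>x\<in>?K p. \<Sum>y\<in>?K q. (?l p x * ?W x $$ (k, m)) * (?l q y * ?W y $$ (m, l)))"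
    by (rule sum_swap3[symmetric])
  also have "\<dots> = (\<Sum>m<n. eval_mat n A p $$ (k, m) * eval_mat n A q $$ (m, l))"
    using kl by (intro sum.cong refl) (simp add: eval_mat_def sum_product)
  also have "\<dots> = (eval_mat n A p * eval_mat n A q) $$ (k, l)"
    by (rule mult_mat_entry[OF eval_mat_carrier eval_mat_carrier kl, symmetric])
  finally show "eval_mat n A (p * q) $$ (k, l) = (eval_mat n A p * eval_mat n A q) $$ (k, l)" .
qed (simp_all add: eval_mat_def)

lemma eval_mat_const: "eval_mat n A (const c) = c \<cdot>\<^sub>m 1\<^sub>m n"
  using eval_mat_single[of n A 0 c] by simp

lemma eval_mat_gen: "j \<in> {1..<r} \<Longrightarrow> eval_mat n A (gen j) = A j"
  using eval_mat_single[of n A "Word [j]" 1] carrier[of j] by (simp add: right_mult_one_mat[of "A j" n n])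

lemma eval_mat_hom: "eval_mat n A \<in> Ring.ring_hom (free_algebra r) (ring_mat TYPE(ratfun) n ())"
proof (rule ring_hom_memI)
  have "eval_mat n A (const 1) = 1\<^sub>m n" unfolding eval_mat_const by (rule smult_one_mat)
  then show "eval_mat n A \<one>\<^bsub>free_algebra r\<^esub> = \<one>\<^bsub>ring_mat TYPE(ratfun) n ()\<^esub>" by (simp add: ring_mat_simps)
qed (simp_all add: ring_mat_simps eval_mat_carrier eval_mat_add eval_mat_mult del: free_algebra_simps(1))

lemma eval_mat_eqI:
  assumes "eval_mat n A p = eval_mat n A q" "p \<in> carrier (free_algebra r)" "q \<in> carrier (free_algebra r)"
  shows "eval_mat n A (p - q) = 0\<^sub>m n n"
proof -
  have "p - q = p + const (- 1) * q" by (simp add: single_uminus)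
  moreover have "eval_mat n A (const (- 1) * q) = (- 1) \<cdot>\<^sub>m eval_mat n A q"
    using mult_smult_assoc_mat[OF one_carrier_mat eval_mat_carrier[of n A q]] left_mult_one_mat[OF eval_mat_carrier[of n A q]]
    by (simp only: eval_mat_mult[OF const_carrier assms(3)] eval_mat_const)
  ultimately have "eval_mat n A (p - q) = eval_mat n A q + (- 1) \<cdot>\<^sub>m eval_mat n A q"
    by (simp only: eval_mat_add assms(1))
  also have "\<dots> = 0\<^sub>m n n" using eval_mat_carrier[of n A q] by (intro eq_matI) auto
  finally show ?thesis .
qed

lemma eval_mat_relator: "x \<in> hecke_relators r \<Longrightarrow> eval_mat n A x = 0\<^sub>m n n"
proof -
  note closed = gen_carrier const_carrier free_algebra_mult free_algebra_add
  assume "x \<in> hecke_relators r"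
  then consider i where "i \<in> {1..<r}" "x = gen i * gen i - (const (1 - qq) * gen i + const qq)"
    | i j where "i \<in> {1..<r}" "j \<in> {1..<r}" "i + 2 \<le> j" "x = gen i * gen j - gen j * gen i"
    | i where "i \<in> {1..<r}" "i + 1 \<in> {1..<r}"
      "x = gen i * gen (i + 1) * gen i - gen (i + 1) * gen i * gen (i + 1)"
    unfolding hecke_relators_def by blast
  then show ?thesis
  proof cases
    case (1 i)
    have "((1 - qq) \<cdot>\<^sub>m 1\<^sub>m n) * A i = (1 - qq) \<cdot>\<^sub>m A i"
      using mult_smult_assoc_mat[OF one_carrier_mat carrier[OF 1(1)]] left_mult_one_mat[OF carrier[OF 1(1)]] by simp
    then have "eval_mat n A (gen i * gen i) = eval_mat n A (const (1 - qq) * gen i + const qq)"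
      using 1(1) by (simp only: eval_mat_mult eval_mat_add eval_mat_gen eval_mat_const closed quadratic)
    then show ?thesis unfolding 1(2) by (rule eval_mat_eqI) (intro closed 1)+
  next
    case (2 i j)
    have "eval_mat n A (gen i * gen j) = eval_mat n A (gen j * gen i)"
      using commutation[OF 2(1-3)] 2 by (simp only: eval_mat_mult eval_mat_gen closed)
    then show ?thesis unfolding 2(4) by (rule eval_mat_eqI) (intro closed 2)+
  next
    case (3 i)
    have "eval_mat n A (gen i * gen (i + 1) * gen i) = eval_mat n A (gen (i + 1) * gen i * gen (i + 1))"
      using braid[OF 3(1,2)] 3(1,2) by (simp only: eval_mat_mult eval_mat_gen closed)
    then show ?thesis unfolding 3(3) by (rule eval_mat_eqI) (intro closed 3)+
  qed
qed

text \<open>The kernel is an ideal that contains the relators.\<close>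

lemma eval_mat_ideal:
  assumes "p \<in> hecke_ideal r"
  shows "eval_mat n A p = 0\<^sub>m n n"
proof -
  have "ring_hom_ring (free_algebra r) (ring_mat TYPE(ratfun) n ()) (eval_mat n A)"
    by (intro ring_hom_ringI2 ring_free_algebra ring_mat eval_mat_hom)
  then have "ideal (a_kernel (free_algebra r) (ring_mat TYPE(ratfun) n ()) (eval_mat n A)) (free_algebra r)"
    by (rule ring_hom_ring.kernel_is_ideal)
  moreover have "hecke_relators r \<subseteq> a_kernel (free_algebra r) (ring_mat TYPE(ratfun) n ()) (eval_mat n A)"
    using hecke_relators_carrier[of r] eval_mat_relator by (auto simp: a_kernel_def' ring_mat_simps simp del: free_algebra_simps)
  ultimately have "hecke_ideal r \<subseteq> a_kernel (free_algebra r) (ring_mat TYPE(ratfun) n ()) (eval_mat n A)"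
    unfolding hecke_ideal_def by (rule free.genideal_minimal)
  then show ?thesis using assms by (auto simp: a_kernel_def' ring_mat_simps)
qed

text \<open>The map induced by evaluation on the quotient; a representative of the coset is chosen.\<close>

definition matrix_rep :: "free_alg set \<Rightarrow> ratfun mat" where
  "matrix_rep X = eval_mat n A (SOME p. p \<in> carrier (free_algebra r) \<and> hecke_class r p = X)"

lemma matrix_rep_class:
  assumes p: "p \<in> carrier (free_algebra r)"
  shows "matrix_rep (hecke_class r p) = eval_mat n A p"
proof -
  let ?p = "SOME p'. p' \<in> carrier (free_algebra r) \<and> hecke_class r p' = hecke_class r p"
  have p': "?p \<in> carrier (free_algebra r) \<and> hecke_class r ?p = hecke_class r p"
    by (rule someI_ex) (use p in blast)
  have "0 \<in> hecke_ideal r"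
    using additive_subgroup.zero_closed[OF ideal.axioms(1)[OF hecke_ideal[of r]]] by simp
  then have "?p \<in> hecke_ideal r +>\<^bsub>free_algebra r\<^esub> ?p"
    by (auto simp: a_r_coset_def' intro!: bexI[of _ 0])
  then have "?p \<in> hecke_class r p" using p' by (simp add: hecke_class_def del: free_algebra_simps)
  then obtain i where i: "i \<in> hecke_ideal r" "?p = i + p"
    by (auto simp: hecke_class_def a_r_coset_def')
  have "eval_mat n A ?p = eval_mat n A p"
    unfolding i(2) eval_mat_add eval_mat_ideal[OF i(1)] using left_add_zero_mat[OF eval_mat_carrier] .
  then show ?thesis by (simp only: matrix_rep_def)
qed

lemma hecke_rep_matrix_rep: "hecke_rep r n matrix_rep"
  unfolding hecke_rep_def
proof (intro conjI allI)
  show "matrix_rep \<in> Ring.ring_hom (hecke r) (ring_mat TYPE(ratfun) n ())"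
  proof (rule ring_hom_memI)
    show "matrix_rep \<one>\<^bsub>hecke r\<^esub> = \<one>\<^bsub>ring_mat TYPE(ratfun) n ()\<^esub>"
      using matrix_rep_class[OF const_carrier, of 1] eval_mat_const[of 1]
      by (simp add: hecke_class_one ring_mat_simps)
  next
    fix X assume "X \<in> carrier (hecke r)"
    then obtain p where p: "p \<in> carrier (free_algebra r)" "X = hecke_class r p" unfolding carrier_hecke by blast
    show "matrix_rep X \<in> carrier (ring_mat TYPE(ratfun) n ())"
      unfolding p(2) matrix_rep_class[OF p(1)] by (simp add: ring_mat_simps eval_mat_carrier)
    fix Y assume "Y \<in> carrier (hecke r)"
    then obtain q where q: "q \<in> carrier (free_algebra r)" "Y = hecke_class r q" unfolding carrier_hecke by blast
    show "matrix_rep (X \<otimes>\<^bsub>hecke r\<^esub> Y) = matrix_rep X \<otimes>\<^bsub>ring_mat TYPE(ratfun) n ()\<^esub> matrix_rep Y"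
      unfolding p(2) q(2) hecke_class_mult[OF p(1) q(1), symmetric] matrix_rep_class[OF p(1)] matrix_rep_class[OF q(1)]
        matrix_rep_class[OF free_algebra_mult[OF p(1) q(1)]] eval_mat_mult[OF p(1) q(1)] by (simp add: ring_mat_simps)
    show "matrix_rep (X \<oplus>\<^bsub>hecke r\<^esub> Y) = matrix_rep X \<oplus>\<^bsub>ring_mat TYPE(ratfun) n ()\<^esub> matrix_rep Y"
      unfolding p(2) q(2) hecke_class_add[OF p(1) q(1), symmetric] matrix_rep_class[OF p(1)] matrix_rep_class[OF q(1)]
        matrix_rep_class[OF free_algebra_add[OF p(1) q(1)]] eval_mat_add by (simp add: ring_mat_simps)
  qed
  show "matrix_rep (hecke_scalar r c) = c \<cdot>\<^sub>m 1\<^sub>m n" for c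
    unfolding hecke_scalar_eq matrix_rep_class[OF const_carrier] by (rule eval_mat_const)
qed

lemma matrix_rep_T: "j \<in> {1..<r} \<Longrightarrow> matrix_rep (hecke_T r j) = A j"
  unfolding hecke_T_eq by (simp only: matrix_rep_class[OF gen_carrier] eval_mat_gen)

lemma matrix_rep_word: "set is \<subseteq> {1..<r} \<Longrightarrow> matrix_rep (hecke_word r is) = word_mat n A is"
proof -
  assume sub: "set is \<subseteq> {1..<r}"
  have "word_mat n (\<lambda>j. matrix_rep (hecke_T r j)) is = word_mat n A is"
    using sub by (induction "is") (auto simp: matrix_rep_T simp del: One_nat_def)
  then show ?thesis using hecke_rep_matrices(2)[OF hecke_rep_matrix_rep sub] by simp
qed

end

text \<open>An invariant subspace other than zero contains a nonzero vector, hence everything.\<close>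

lemma irreducible_matrix_rep:
  assumes "schur_matrices qq r n A" "0 < n"
  shows "irreducible_hecke_rep r n (matrix_rep r n A)"
  unfolding irreducible_hecke_rep_def
proof (intro conjI allI impI)
  interpret schur_matrices qq r n A by fact
  show "hecke_rep r n (matrix_rep r n A)" by (rule hecke_rep_matrix_rep[OF hecke_matrices_axioms])
  show "0 < n" by fact
  fix U assume U: "VectorSpace.subspace class_ring U (module_vec TYPE(ratfun) n) \<and>
     (\<forall>h\<in>carrier (hecke r). \<forall>v\<in>U. matrix_rep r n A h *\<^sub>v v \<in> U)"
  then have sub: "submodule class_ring U (module_vec TYPE(ratfun) n)" by (simp add: VectorSpace.subspace_def)
  note subD = sub[unfolded submodule_def module_vec_simps]
  have U1: "U \<subseteq> carrier_vec n" "0\<^sub>v n \<in> U" "\<And>u v. u \<in> U \<Longrightarrow> v \<in> U \<Longrightarrow> u + v \<in> U"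
    and U2: "\<And>c u. u \<in> U \<Longrightarrow> c \<cdot>\<^sub>v u \<in> U"
    using subD by (auto simp: class_ring_simps)
  show "U = {0\<^sub>v n} \<or> U = carrier_vec n"
  proof (cases "U = {0\<^sub>v n}")
    case False
    then obtain u where u: "u \<in> U" "u \<noteq> 0\<^sub>v n" using U1(2) by blast
    have "A j *\<^sub>v v \<in> U" if "j \<in> {1..<r}" "v \<in> U" for j v
      using U hecke_T_carrier[OF that(1)] that(2) by (simp only: matrix_rep_T[OF hecke_matrices_axioms that(1), symmetric])
    from nonzero_invariant_subset_full[OF U1(1,3) U2 this u] have "U = carrier_vec n" .
    then show ?thesis ..
  qed simp
qed

section \<open>Orthogonality of irreducible characters\<close>

lemma mult_mat_vec_zero: "M \<in> carrier_mat m n \<Longrightarrow> M *\<^sub>v 0\<^sub>v n = 0\<^sub>v m"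
  by (intro eq_vecI) auto

lemma smult_zero_vec_eq: "(c::'a::comm_ring_1) \<cdot>\<^sub>v 0\<^sub>v m = 0\<^sub>v m"
  by (intro eq_vecI) auto

lemma mult_unit_vec_col: "(M :: 'a::comm_ring_1 mat) \<in> carrier_mat m n \<Longrightarrow> l < n \<Longrightarrow> M *\<^sub>v unit_vec n l = col M (l::nat)"
  by (intro eq_vecI) auto

lemma submodule_module_vecI:
  fixes U :: "ratfun vec set"
  assumes "U \<subseteq> carrier_vec n" "0\<^sub>v n \<in> U" "\<And>u v. u \<in> U \<Longrightarrow> v \<in> U \<Longrightarrow> u + v \<in> U"
    "\<And>c u. u \<in> U \<Longrightarrow> c \<cdot>\<^sub>v u \<in> U"
  shows "VectorSpace.subspace class_ring U (module_vec TYPE(ratfun) n)"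
proof -
  have "vectorspace class_ring (module_vec TYPE(ratfun) n)" by (rule vec_vs)
  then show ?thesis
    using assms by (auto simp: VectorSpace.subspace_def submodule_def vectorspace_def module_vec_simps class_ring_simps)
qed

lemma hecke_intertwiner_extends:
  assumes A: "hecke_rep r n \<alpha>" and B: "hecke_rep r m \<beta>" and M: "M \<in> carrier_mat m n"
    and comm: "\<And>j. j \<in> {1..<r} \<Longrightarrow> \<beta> (hecke_T r j) * M = M * \<alpha> (hecke_T r j)"
    and h: "h \<in> carrier (hecke r)"
  shows "\<beta> h * M = M * \<alpha> h"
proof -
  have hA: "\<alpha> \<in> Ring.ring_hom (hecke r) (ring_mat TYPE(ratfun) n ())" and sA: "\<And>c. \<alpha> (hecke_scalar r c) = c \<cdot>\<^sub>m 1\<^sub>m n"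
    using A by (simp_all add: hecke_rep_def)
  have hB: "\<beta> \<in> Ring.ring_hom (hecke r) (ring_mat TYPE(ratfun) m ())" and sB: "\<And>c. \<beta> (hecke_scalar r c) = c \<cdot>\<^sub>m 1\<^sub>m m"
    using B by (simp_all add: hecke_rep_def)
  have cA: "\<alpha> x \<in> carrier_mat n n" and cB: "\<beta> x \<in> carrier_mat m m" if "x \<in> carrier (hecke r)" for x
    using ring_hom_closed[OF hA that] ring_hom_closed[OF hB that] by (simp_all add: ring_mat_simps)
  from h show ?thesis
  proof (induction rule: hecke_induct)
    case (scalar c)
    have "(c \<cdot>\<^sub>m 1\<^sub>m m) * M = c \<cdot>\<^sub>m M"
      using mult_smult_assoc_mat[OF one_carrier_mat M] left_mult_one_mat[OF M] by simp
    moreover have "M * (c \<cdot>\<^sub>m 1\<^sub>m n) = c \<cdot>\<^sub>m M"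
      using mult_smult_distrib[OF M one_carrier_mat] right_mult_one_mat[OF M] by simp
    ultimately show ?case by (simp only: sA sB)
  next
    case (gen j)
    then show ?case by (rule comm)
  next
    case (add x y)
    note c = cA[OF add(1)] cA[OF add(2)] cB[OF add(1)] cB[OF add(2)]
    have "\<beta> (x \<oplus>\<^bsub>hecke r\<^esub> y) * M = \<beta> x * M + \<beta> y * M"
      using ring_hom_add[OF hB add(1,2)] add_mult_distrib_mat[OF c(3,4) M] by (simp add: ring_mat_simps)
    moreover have "M * \<alpha> (x \<oplus>\<^bsub>hecke r\<^esub> y) = M * \<alpha> x + M * \<alpha> y"
      using ring_hom_add[OF hA add(1,2)] mult_add_distrib_mat[OF M c(1,2)] by (simp add: ring_mat_simps)
    ultimately show ?case using add by simp
  next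
    case (mult x y)
    note c = cA[OF mult(1)] cA[OF mult(2)] cB[OF mult(1)] cB[OF mult(2)]
    have "\<beta> (x \<otimes>\<^bsub>hecke r\<^esub> y) * M = \<beta> x * (\<beta> y * M)"
      using ring_hom_mult[OF hB mult(1,2)] assoc_mult_mat[OF c(3,4) M] by (simp add: ring_mat_simps)
    also have "\<dots> = (\<beta> x * M) * \<alpha> y" unfolding mult(4) using assoc_mult_mat[OF c(3) M c(2)] by simp
    also have "\<dots> = M * (\<alpha> x * \<alpha> y)" unfolding mult(3) using assoc_mult_mat[OF M c(1,2)] by simp
    also have "\<alpha> x * \<alpha> y = \<alpha> (x \<otimes>\<^bsub>hecke r\<^esub> y)"
      using ring_hom_mult[OF hA mult(1,2)] by (simp add: ring_mat_simps)
    finally show ?case .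
  qed
qed

lemma irreducible_hecke_repD:
  assumes "irreducible_hecke_rep r n \<rho>" "VectorSpace.subspace class_ring U (module_vec TYPE(ratfun) n)"
    and "\<And>h v. h \<in> carrier (hecke r) \<Longrightarrow> v \<in> U \<Longrightarrow> \<rho> h *\<^sub>v v \<in> U"
  shows "U = {0\<^sub>v n} \<or> U = carrier_vec n"
  using assms unfolding irreducible_hecke_rep_def by meson

text \<open>Schur's lemma: the kernel and the image of \<open>M\<close> are invariant, so \<open>M\<close> is bijective. An inverse \<open>N\<close>
  conjugates one representation into the other, and traces agree.\<close>

lemma intertwined_irreducibles_same_trace:
  assumes A: "irreducible_hecke_rep r n \<alpha>" and B: "irreducible_hecke_rep r m \<beta>" and M: "M \<in> carrier_mat m n"
    and comm: "\<And>j. j \<in> {1..<r} \<Longrightarrow> \<beta> (hecke_T r j) * M = M * \<alpha> (hecke_T r j)"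
    and nz: "M \<noteq> 0\<^sub>m m n" and h: "h \<in> carrier (hecke r)"
  shows "trace_mat (\<alpha> h) = trace_mat (\<beta> h)"
proof -
  have repA: "hecke_rep r n \<alpha>" and repB: "hecke_rep r m \<beta>"
    using A B by (simp_all add: irreducible_hecke_rep_def)
  note hA = repA[unfolded hecke_rep_def, THEN conjunct1] and hB = repB[unfolded hecke_rep_def, THEN conjunct1]
  have cA: "\<alpha> x \<in> carrier_mat n n" and cB: "\<beta> x \<in> carrier_mat m m" if "x \<in> carrier (hecke r)" for x
    using ring_hom_closed[OF hA that] ring_hom_closed[OF hB that] by (simp_all add: ring_mat_simps)
  have MA: "\<beta> x * M = M * \<alpha> x" if "x \<in> carrier (hecke r)" for x
    by (rule hecke_intertwiner_extends[OF repA repB M comm that])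
  have move: "M *\<^sub>v (\<alpha> x *\<^sub>v v) = \<beta> x *\<^sub>v (M *\<^sub>v v)" if "x \<in> carrier (hecke r)" "v \<in> carrier_vec n" for x v
    using MA[OF that(1)] assoc_mult_mat_vec[OF M cA[OF that(1)] that(2)] assoc_mult_mat_vec[OF cB[OF that(1)] M that(2)] by simp
  let ?K = "{v \<in> carrier_vec n. M *\<^sub>v v = 0\<^sub>v m}"
  let ?R = "(\<lambda>v. M *\<^sub>v v) ` carrier_vec n"
  have nonzero: "\<exists>v\<in>carrier_vec n. M *\<^sub>v v \<noteq> 0\<^sub>v m"
  proof (rule ccontr)
    assume "\<not> ?thesis"
    then have z: "M *\<^sub>v v = 0\<^sub>v m" if "v \<in> carrier_vec n" for v using that by blast
    have "M $$ (k, l) = 0" if kl: "k < m" "l < n" for k l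
    proof -
      have "M $$ (k, l) = col M l $ k" using M kl by simp
      also have "col M l = M *\<^sub>v unit_vec n l" by (rule mult_unit_vec_col[OF M kl(2), symmetric])
      also have "\<dots> $ k = 0" using z[of "unit_vec n l"] kl by simp
      finally show ?thesis .
    qed
    then have "M = 0\<^sub>m m n" using M by (intro eq_matI) auto
    then show False using nz by simp
  qed
  have "VectorSpace.subspace class_ring ?K (module_vec TYPE(ratfun) n)"
  proof (rule submodule_module_vecI)
    show "?K \<subseteq> carrier_vec n" by auto
    show "0\<^sub>v n \<in> ?K" using mult_mat_vec_zero[OF M] by simp
    show "u + v \<in> ?K" if "u \<in> ?K" "v \<in> ?K" for u v
      using that mult_add_distrib_mat_vec[OF M, of u v] by simp
    show "c \<cdot>\<^sub>v u \<in> ?K" if "u \<in> ?K" for c u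
      using that mult_mat_vec[OF M, of u c] by (simp add: smult_zero_vec_eq)
  qed
  moreover have "\<alpha> x *\<^sub>v v \<in> ?K" if "x \<in> carrier (hecke r)" "v \<in> ?K" for x v
  proof -
    have v: "v \<in> carrier_vec n" "M *\<^sub>v v = 0\<^sub>v m" using that(2) by simp_all
    then show ?thesis using move[OF that(1) v(1)] cA[OF that(1)] mult_mat_vec_zero[OF cB[OF that(1)]] by simp
  qed
  ultimately have "?K = {0\<^sub>v n} \<or> ?K = carrier_vec n"
    by (rule irreducible_hecke_repD[OF A])
  moreover have "?K \<noteq> carrier_vec n" using nonzero by auto
  ultimately have K: "?K = {0\<^sub>v n}" by simp
  have "VectorSpace.subspace class_ring ?R (module_vec TYPE(ratfun) m)"
  proof (rule submodule_module_vecI)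
    show "?R \<subseteq> carrier_vec m" using M by auto
    show "0\<^sub>v m \<in> ?R" using mult_mat_vec_zero[OF M] by (intro image_eqI[of _ _ "0\<^sub>v n"]) auto
    show "u + v \<in> ?R" if "u \<in> ?R" "v \<in> ?R" for u v
    proof -
      from that obtain u' v' where uv: "u' \<in> carrier_vec n" "v' \<in> carrier_vec n" "u = M *\<^sub>v u'" "v = M *\<^sub>v v'" by blast
      then have "u + v = M *\<^sub>v (u' + v')" using mult_add_distrib_mat_vec[OF M] by simp
      then show ?thesis using uv(1,2) by simp
    qed
    show "c \<cdot>\<^sub>v u \<in> ?R" if "u \<in> ?R" for c u
    proof -
      from that obtain u' where u: "u' \<in> carrier_vec n" "u = M *\<^sub>v u'" by blast
      then have "c \<cdot>\<^sub>v u = M *\<^sub>v (c \<cdot>\<^sub>v u')" using mult_mat_vec[OF M] by simp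
      then show ?thesis using u(1) by simp
    qed
  qed
  moreover have "\<beta> x *\<^sub>v v \<in> ?R" if x: "x \<in> carrier (hecke r)" and "v \<in> ?R" for x v
  proof -
    from that obtain v' where v: "v' \<in> carrier_vec n" "v = M *\<^sub>v v'" by blast
    then have "\<beta> x *\<^sub>v v = M *\<^sub>v (\<alpha> x *\<^sub>v v')" using move[OF x] by simp
    moreover have "\<alpha> x *\<^sub>v v' \<in> carrier_vec n" using cA[OF x] v by simp
    ultimately show ?thesis by (simp only: imageI)
  qed
  ultimately have "?R = {0\<^sub>v m} \<or> ?R = carrier_vec m"
    by (rule irreducible_hecke_repD[OF B])
  moreover have "?R \<noteq> {0\<^sub>v m}" using nonzero by auto
  ultimately have R: "?R = carrier_vec m" by simp
  \<comment> \<open>The columns of the inverse are preimages of the unit vectors.\<close>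
  define s where "s k = inv_into (carrier_vec n) (\<lambda>v. M *\<^sub>v v) (unit_vec m k)" for k
  have s: "s k \<in> carrier_vec n" "M *\<^sub>v s k = unit_vec m k" for k
  proof -
    have k: "unit_vec m k \<in> ?R" unfolding R by simp
    show "s k \<in> carrier_vec n" unfolding s_def by (rule inv_into_into[OF k])
    show "M *\<^sub>v s k = unit_vec m k" unfolding s_def by (rule f_inv_into_f[OF k])
  qed
  define N where "N = mat n m (\<lambda>(i, k). s k $ i)"
  have N: "N \<in> carrier_mat n m" by (simp add: N_def)
  have colN: "col N k = s k" if "k < m" for k using s(1)[of k] that by (intro eq_vecI) (auto simp: N_def)
  have MN: "M * N = 1\<^sub>m m"
  proof (rule eq_matI)
    fix i k assume ik: "i < dim_row (1\<^sub>m m :: ratfun mat)" "k < dim_col (1\<^sub>m m :: ratfun mat)"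
    then have "(M * N) $$ (i, k) = (M *\<^sub>v col N k) $ i" using M N by simp
    also have "\<dots> = (1\<^sub>m m) $$ (i, k)" using ik s by (simp add: colN)
    finally show "(M * N) $$ (i, k) = (1\<^sub>m m) $$ (i, k)" .
  qed (use M N in auto)
  have inj: "v = w" if "v \<in> carrier_vec n" "w \<in> carrier_vec n" "M *\<^sub>v v = M *\<^sub>v w" for v w
  proof -
    have "M *\<^sub>v (v - w) = 0\<^sub>v m"
      using that M mult_minus_distrib_mat_vec[OF M that(1,2)] by simp
    then have "v - w \<in> ?K" using that by simp
    then have z: "v - w = 0\<^sub>v n" unfolding K by simp
    show ?thesis
    proof (rule eq_vecI)
      fix i assume "i < dim_vec w"
      then show "v $ i = w $ i" using arg_cong[OF z, of "\<lambda>u. vec_index u i"] that by simp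
    qed (use that in auto)
  qed
  have NM: "N * M = 1\<^sub>m n"
  proof (rule eq_matI)
    fix i k assume ik: "i < dim_row (1\<^sub>m n :: ratfun mat)" "k < dim_col (1\<^sub>m n :: ratfun mat)"
    have u: "unit_vec n k \<in> carrier_vec n" "M *\<^sub>v unit_vec n k \<in> carrier_vec m"
      "(N * M) *\<^sub>v unit_vec n k \<in> carrier_vec n" using M N by auto
    have "M *\<^sub>v ((N * M) *\<^sub>v unit_vec n k) = (M * N) *\<^sub>v (M *\<^sub>v unit_vec n k)"
      by (simp only: assoc_mult_mat_vec[OF N M u(1)] assoc_mult_mat_vec[OF M N u(2)])
    also have "\<dots> = M *\<^sub>v unit_vec n k"
      unfolding MN by (rule one_mult_mat_vec[OF u(2)])
    finally have "(N * M) *\<^sub>v unit_vec n k = unit_vec n k" by (rule inj[OF u(3,1)])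
    moreover have "(N * M) $$ (i, k) = ((N * M) *\<^sub>v unit_vec n k) $ i"
      using mult_unit_vec_col[of "N * M" n n k] N M ik by simp
    ultimately show "(N * M) $$ (i, k) = (1\<^sub>m n) $$ (i, k)" using ik by simp
  qed (use M N in auto)
  have aN: "\<alpha> h * N \<in> carrier_mat n m" using cA[OF h] N by simp
  have "\<beta> h * M * N = \<beta> h"
    by (simp only: assoc_mult_mat[OF cB[OF h] M N] MN right_mult_one_mat[OF cB[OF h]])
  then have "trace_mat (\<beta> h) = trace_mat (\<beta> h * M * N)" by simp
  also have "\<dots> = trace_mat (M * (\<alpha> h * N))"
    by (simp only: MA[OF h] assoc_mult_mat[OF M cA[OF h] N])
  also have "\<dots> = trace_mat (\<alpha> h * N * M)" by (rule trace_mat_comm[OF M aN])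
  also have "\<dots> = trace_mat (\<alpha> h)"
    by (simp only: assoc_mult_mat[OF cA[OF h] N M] NM right_mult_one_mat[OF cA[OF h]])
  finally show ?thesis by (rule sym)
qed

lemma hecke_Tw_trace:
  assumes "hecke_rep r n \<rho>" and w: "w permutes {1..r}"
  shows "\<rho> (hecke_Tw r w) = hecke_matrices.perm_mat r n (\<lambda>j. \<rho> (hecke_T r j)) w"
  using hecke_rep_matrices(2)[OF assms(1) reduced_subset[OF w]]
  by (simp add: hecke_Tw_eq hecke_matrices.perm_mat_def[OF hecke_rep_matrices(1)[OF assms(1)]] reduced_def)

lemma hecke_Tw_carrier: "w permutes {1..r} \<Longrightarrow> hecke_Tw r w \<in> carrier (hecke r)"
  unfolding hecke_Tw_eq by (rule hecke_word_carrier[OF reduced_subset])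

text \<open>If some average of a matrix unit were nonzero, it would intertwine the two representations, and the
  characters would coincide. Since all averages vanish, so does the sum of their entries that forms the product of the characters.\<close>

lemma irreducible_characters_orthogonal:
  assumes "irreducible_hecke_character r \<chi>" "irreducible_hecke_character r \<psi>" "\<chi> \<noteq> \<psi>"
  shows "(\<Sum>w | w permutes {1..r}. inverse qq ^ perm_length r w *
     (\<psi> (hecke_Tw r (inv_into UNIV w)) * \<chi> (hecke_Tw r w))) = 0"
proof -
  obtain n \<alpha> where A: "irreducible_hecke_rep r n \<alpha>" and \<chi>: "\<chi> = restrict (\<lambda>h. trace_mat (\<alpha> h)) (carrier (hecke r))"
    using assms(1) by (auto simp: irreducible_hecke_character_def mat_trace_eq)
  obtain m \<beta> where B: "irreducible_hecke_rep r m \<beta>" and \<psi>: "\<psi> = restrict (\<lambda>h. trace_mat (\<beta> h)) (carrier (hecke r))"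
    using assms(2) by (auto simp: irreducible_hecke_character_def mat_trace_eq)
  have repA: "hecke_rep r n \<alpha>" and repB: "hecke_rep r m \<beta>"
    using A B by (simp_all add: irreducible_hecke_rep_def)
  let ?A = "\<lambda>j. \<alpha> (hecke_T r j)" and ?B = "\<lambda>j. \<beta> (hecke_T r j)"
  note mA = hecke_rep_matrices(1)[OF repA] and mB = hecke_rep_matrices(1)[OF repB]
  have zero: "schur_sum qq r m ?B n ?A k a b l = 0" if "k < m" "a < m" "b < n" "l < n" for k a b l
  proof -
    let ?M = "mat m n (\<lambda>(k, l). schur_sum qq r m ?B n ?A k a b l)"
    have "?M = 0\<^sub>m m n"
    proof (rule ccontr)
      assume nz: "?M \<noteq> 0\<^sub>m m n"
      have M: "?M \<in> carrier_mat m n" by simp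
      have comm: "?B j * ?M = ?M * ?A j" if "j \<in> {1..<r}" for j
        by (rule schur_sum_intertwines[OF mA mB qq_nonzero(1) \<open>a < m\<close> \<open>b < n\<close> that])
      have "trace_mat (\<alpha> h) = trace_mat (\<beta> h)" if "h \<in> carrier (hecke r)" for h
        by (rule intertwined_irreducibles_same_trace[OF A B M comm nz that])
      then have "\<chi> = \<psi>" unfolding \<chi> \<psi> by (intro restrict_ext)
      then show False using assms(3) by simp
    qed
    from arg_cong[OF this, of "\<lambda>M. M $$ (k, l)"] that show ?thesis by simp
  qed
  have "(\<Sum>w | w permutes {1..r}. inverse qq ^ perm_length r w *
     (\<psi> (hecke_Tw r (inv_into UNIV w)) * \<chi> (hecke_Tw r w))) = (\<Sum>k<m. \<Sum>l<n. schur_sum qq r m ?B n ?A k k l l)"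
    unfolding trace_product_schur_sum[OF mA mB, symmetric]
    by (intro sum.cong refl)
       (simp add: \<chi> \<psi> hecke_Tw_carrier permutes_inv hecke_Tw_trace[OF repA] hecke_Tw_trace[OF repB])
  also have "\<dots> = 0" by (simp add: zero)
  finally show ?thesis .
qed

section \<open>Traces on function spaces and row determinants\<close>

lemma sum_fun_apply: "(\<Sum>k\<in>K. f k) y = (\<Sum>k\<in>K. f k y)" for f :: "'k \<Rightarrow> 'b \<Rightarrow> complex"
  by (induction K rule: infinite_finite_induct) auto

definition lin_comb :: "'k set \<Rightarrow> ('k \<Rightarrow> complex) \<Rightarrow> ('k \<Rightarrow> 'b \<Rightarrow> complex) \<Rightarrow> 'b \<Rightarrow> complex" where
  "lin_comb K c x = (\<lambda>y. \<Sum>k\<in>K. c k * x k y)"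

lemma lin_comb_eq_sum: "lin_comb K c x = (\<Sum>k\<in>K. (\<lambda>y. c k * x k y))"
  by (rule ext) (simp add: lin_comb_def sum_fun_apply)

lemma lin_comb_in_span:
  assumes "\<And>k. k \<in> K \<Longrightarrow> x k \<in> fun_space.span X"
  shows "lin_comb K c x \<in> fun_space.span X"
  unfolding lin_comb_eq_sum by (intro fun_space.span_sum fun_space.span_scale assms)

lemma span_image_lin_comb:
  assumes "finite K" "v \<in> fun_space.span (x ` K)"
  shows "\<exists>c. v = lin_comb K c x"
proof -
  let ?V = "range (\<lambda>c. lin_comb K c x)"
  have "fun_space.subspace ?V"
  proof (rule fun_space.subspaceI)
    have "0 = lin_comb K (\<lambda>_. 0) x" by (rule ext) (simp add: lin_comb_def)
    then show "0 \<in> ?V" by (rule range_eqI[of _ "\<lambda>c. lin_comb K c x"])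
  next
    fix u v assume "u \<in> ?V" "v \<in> ?V"
    then obtain c d where cd: "u = lin_comb K c x" "v = lin_comb K d x" by (elim rangeE)
    have "u + v = lin_comb K (\<lambda>k. c k + d k) x"
      unfolding cd by (rule ext) (simp add: lin_comb_def sum.distrib distrib_right)
    then show "u + v \<in> ?V" by (rule range_eqI[of _ "\<lambda>c. lin_comb K c x"])
  next
    fix a u assume "u \<in> ?V"
    then obtain c where c: "u = lin_comb K c x" by (elim rangeE)
    have "(\<lambda>y. a * u y) = lin_comb K (\<lambda>k. a * c k) x"
      unfolding c by (rule ext) (simp add: lin_comb_def sum_distrib_left mult.assoc)
    then show "(\<lambda>y. a * u y) \<in> ?V" by (rule range_eqI[of _ "\<lambda>c. lin_comb K c x"])
  qed
  moreover have "x ` K \<subseteq> ?V"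
  proof (rule image_subsetI)
    fix k assume "k \<in> K"
    have "lin_comb K (\<lambda>l. of_bool (l = k)) x y = (\<Sum>l\<in>K. if l = k then x k y else 0)" for y
      unfolding lin_comb_def by (intro sum.cong refl) simp
    then have "x k = lin_comb K (\<lambda>l. of_bool (l = k)) x" using assms(1) \<open>k \<in> K\<close> by (simp add: fun_eq_iff)
    then show "x k \<in> ?V" by (rule range_eqI[of _ "\<lambda>c. lin_comb K c x"])
  qed
  ultimately have "fun_space.span (x ` K) \<subseteq> ?V" by (intro fun_space.span_minimal)
  from subsetD[OF this assms(2)] show ?thesis by (rule rangeE) (rule exI)
qed

text \<open>The trace is defined through an arbitrary basis; here it is computed from a linearly independent spanning family in
  which the operator has matrix \<open>m\<close>. The matrices of coordinate change between the two bases are inverse to each other.\<close>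

theorem trace_on_family:
  fixes x :: "'k \<Rightarrow> 'b \<Rightarrow> complex"
  assumes K: "finite K"
    and indep: "\<And>c. lin_comb K c x = (\<lambda>_. 0) \<Longrightarrow> \<forall>k\<in>K. c k = 0"
    and g_lin: "\<And>c. g (lin_comb K c x) = lin_comb K c (\<lambda>k. g (x k))"
    and g: "\<And>k. k \<in> K \<Longrightarrow> g (x k) = lin_comb K (\<lambda>l. m l k) x"
  shows "trace_on (fun_space.span (x ` K)) g = (\<Sum>k\<in>K. m k k)"
proof -
  let ?S = "fun_space.span (x ` K)"
  define B where "B = (SOME B. fun_space.independent B \<and> fun_space.span B = ?S)"
  obtain B0 where "B0 \<subseteq> x ` K" "fun_space.independent B0" "x ` K \<subseteq> fun_space.span B0"
    by (rule fun_space.maximal_independent_subset)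
  moreover from this have "fun_space.span B0 = ?S"
    by (intro equalityI fun_space.span_mono fun_space.span_minimal fun_space.subspace_span)
  ultimately have "fun_space.independent B0 \<and> fun_space.span B0 = ?S" by simp
  then have B: "fun_space.independent B \<and> fun_space.span B = ?S"
    unfolding B_def by (rule someI)
  have "B \<subseteq> ?S" using fun_space.span_superset[of B] B by simp
  with B have finB: "finite B" using fun_space.independent_span_bound[OF finite_imageI[OF K], of B x] by simp
  let ?R = "fun_space.representation B"
  have "\<exists>e. b = lin_comb K e x" if "b \<in> B" for b
    by (rule span_image_lin_comb[OF K subsetD[OF \<open>B \<subseteq> ?S\<close> that]])
  then have "\<forall>b\<in>B. \<exists>e. b = lin_comb K e x" by (rule ballI)
  from bchoice[OF this] obtain e where "\<forall>b\<in>B. b = lin_comb K (e b) x" by (elim exE)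
  note e = bspec[OF this]
  have xS: "x k \<in> fun_space.span B" if "k \<in> K" for k
    using that B fun_space.span_base[of "x k" "x ` K"] by simp
  have R_comb: "?R (lin_comb K c x) b = (\<Sum>k\<in>K. c k * ?R (x k) b)" for c b
  proof -
    have "?R (\<Sum>k\<in>K. (\<lambda>y. c k * x k y)) = (\<lambda>b. \<Sum>k\<in>K. ?R (\<lambda>y. c k * x k y) b)"
      using B by (intro fun_space.representation_sum fun_space.span_scale xS) auto
    moreover have "?R (\<lambda>y. c k * x k y) b = c k * ?R (x k) b" if "k \<in> K" for k
      using fun_space.representation_scale[OF _ xS[OF that], of "c k"] B by (simp add: fun_eq_iff)
    ultimately show ?thesis by (simp add: lin_comb_eq_sum)
  qed
  \<comment> \<open>The two coordinate changes are inverse to each other, by independence of the family.\<close>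
  have delta: "(\<Sum>b\<in>B. ?R (x l) b * e b k) = of_bool (k = l)" if kl: "k \<in> K" "l \<in> K" for k l
  proof -
    have "x l = (\<Sum>b\<in>B. (\<lambda>y. ?R (x l) b * b y))"
      using fun_space.sum_representation_eq[of B "x l" B] B xS[OF kl(2)] finB by simp
    from arg_cong[OF this, of "\<lambda>f. f _"] have xl: "x l y = (\<Sum>b\<in>B. ?R (x l) b * b y)" for y
      by (simp only: sum_fun_apply)
    have "lin_comb K (\<lambda>k. (\<Sum>b\<in>B. ?R (x l) b * e b k) - of_bool (k = l)) x y = 0" for y
    proof -
      have "(\<Sum>b\<in>B. ?R (x l) b * b y) = (\<Sum>b\<in>B. ?R (x l) b * (\<Sum>k\<in>K. e b k * x k y))"
      proof (rule sum.cong[OF refl])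
        fix b assume "b \<in> B"
        from arg_cong[OF e[OF this], of "\<lambda>f. f y"] have "b y = lin_comb K (e b) x y" .
        then show "?R (x l) b * b y = ?R (x l) b * (\<Sum>k\<in>K. e b k * x k y)" by (simp only: lin_comb_def)
      qed
      also have "\<dots> = (\<Sum>b\<in>B. \<Sum>k\<in>K. ?R (x l) b * e b k * x k y)"
        by (simp only: sum_distrib_left mult.assoc)
      also have "\<dots> = (\<Sum>k\<in>K. (\<Sum>b\<in>B. ?R (x l) b * e b k) * x k y)"
        unfolding sum_distrib_right by (rule sum.swap)
      finally have A: "(\<Sum>k\<in>K. (\<Sum>b\<in>B. ?R (x l) b * e b k) * x k y) = x l y"
        using xl[of y] by (simp only:)
      have "(\<Sum>k\<in>K. of_bool (k = l) * x k y) = (\<Sum>k\<in>K. if k = l then x l y else 0)"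
        by (intro sum.cong refl) simp
      also have "\<dots> = x l y" using K kl(2) by simp
      finally have "(\<Sum>k\<in>K. of_bool (k = l) * x k y) = x l y" .
      with A show ?thesis by (simp only: lin_comb_def left_diff_distrib sum_subtractf) simp
    qed
    then have "lin_comb K (\<lambda>k. (\<Sum>b\<in>B. ?R (x l) b * e b k) - of_bool (k = l)) x = (\<lambda>_. 0)" by (rule ext)
    from indep[OF this] kl(1) show ?thesis by simp
  qed
  have gb: "?R (g b) b = (\<Sum>k\<in>K. \<Sum>l\<in>K. m l k * (?R (x l) b * e b k))" if b: "b \<in> B" for b
  proof -
    have "g b = lin_comb K (e b) (\<lambda>k. g (x k))" using arg_cong[OF e[OF b], of g] by (simp only: g_lin)
    also have "\<dots> = lin_comb K (\<lambda>l. \<Sum>k\<in>K. e b k * m l k) x"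
    proof
      fix y
      have "lin_comb K (e b) (\<lambda>k. g (x k)) y = (\<Sum>k\<in>K. \<Sum>l\<in>K. e b k * (m l k * x l y))"
        unfolding lin_comb_def by (intro sum.cong refl) (simp add: g lin_comb_def sum_distrib_left)
      also have "\<dots> = (\<Sum>l\<in>K. \<Sum>k\<in>K. e b k * (m l k * x l y))" by (rule sum.swap)
      also have "\<dots> = lin_comb K (\<lambda>l. \<Sum>k\<in>K. e b k * m l k) x y"
        by (simp only: lin_comb_def sum_distrib_right mult.assoc)
      finally show "lin_comb K (e b) (\<lambda>k. g (x k)) y = lin_comb K (\<lambda>l. \<Sum>k\<in>K. e b k * m l k) x y" .
    qed
    finally have "?R (g b) b = (\<Sum>l\<in>K. (\<Sum>k\<in>K. e b k * m l k) * ?R (x l) b)" by (simp only: R_comb)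
    also have "\<dots> = (\<Sum>l\<in>K. \<Sum>k\<in>K. m l k * (?R (x l) b * e b k))"
      unfolding sum_distrib_right by (intro sum.cong refl) (simp only: mult_ac)
    also have "\<dots> = (\<Sum>k\<in>K. \<Sum>l\<in>K. m l k * (?R (x l) b * e b k))" by (rule sum.swap)
    finally show ?thesis .
  qed
  have "trace_on ?S g = (\<Sum>b\<in>B. ?R (g b) b)"
    by (simp add: trace_on_def B_def Let_def)
  also have "\<dots> = (\<Sum>b\<in>B. \<Sum>k\<in>K. \<Sum>l\<in>K. m l k * (?R (x l) b * e b k))"
    by (rule sum.cong[OF refl gb])
  also have "\<dots> = (\<Sum>k\<in>K. \<Sum>l\<in>K. \<Sum>b\<in>B. m l k * (?R (x l) b * e b k))"
    by (rule sum_swap3)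
  also have "\<dots> = (\<Sum>k\<in>K. \<Sum>l\<in>K. m l k * (\<Sum>b\<in>B. ?R (x l) b * e b k))"
    by (simp only: sum_distrib_left)
  also have "\<dots> = (\<Sum>k\<in>K. \<Sum>l\<in>K. if l = k then m k k else 0)"
    by (intro sum.cong refl) (simp add: delta)
  also have "\<dots> = (\<Sum>k\<in>K. m k k)" using K by simp
  finally show ?thesis .
qed

text \<open>The determinant as an alternating multilinear form in the rows \<open>\<rho> 0, \<dots>, \<rho> (n - 1)\<close>.\<close>

definition alt :: "nat \<Rightarrow> (nat \<Rightarrow> nat \<Rightarrow> complex) \<Rightarrow> complex" where
  "alt n \<rho> = det (mat n n (\<lambda>(a, b). \<rho> a b))"

lemma alt_leibniz: "alt n \<rho> = (\<Sum>p | p permutes {0..<n}. signof p * (\<Prod>a = 0..<n. \<rho> a (p a)))"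
proof -
  have "mat n n (\<lambda>(a, b). \<rho> a b) \<in> carrier_mat n n" by simp
  from det_def'[OF this] show ?thesis
    unfolding alt_def by (auto intro!: sum.cong prod.cong simp: permutes_in_image)
qed

lemma alt_row_linear:
  assumes k: "k < n"
  shows "alt n (\<rho>(k := (\<lambda>b. u b + c * v b))) = alt n (\<rho>(k := u)) + c * alt n (\<rho>(k := v))"
proof -
  have split: "(\<Prod>a = 0..<n. (\<rho>(k := w)) a (p a)) = w (p k) * (\<Prod>a\<in>{0..<n} - {k}. \<rho> a (p a))" for w p
    using k by (subst prod.remove[of _ k]) auto
  show ?thesis
    unfolding alt_leibniz split sum_distrib_left
    by (subst sum.distrib[symmetric]) (intro sum.cong refl, simp only: distrib_right distrib_left mult_ac)
qed

lemma alt_equal_rows: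
  assumes "j < n" "k < n" "j \<noteq> k" "\<rho> j = \<rho> k"
  shows "alt n \<rho> = 0"
  unfolding alt_def
  by (rule det_identical_rows[of _ n j k]) (use assms in \<open>auto intro!: eq_vecI\<close>)

text \<open>Expanding in all rows, a term with \<open>v\<close> in two rows vanishes, so only terms of degree at most one in \<open>v\<close> remain.\<close>

lemma alt_rank_one_update:
  assumes "K \<subseteq> {..<n}"
  shows "alt n (\<lambda>a b. \<rho> a b + (if a \<in> K then c a * v b else 0)) = alt n \<rho> + (\<Sum>k\<in>K. c k * alt n (\<rho>(k := v)))"
proof -
  have "finite K" using assms finite_subset by blast
  then show ?thesis using assms
  proof (induction K arbitrary: \<rho> rule: finite_induct)
    case (insert k K)
    let ?\<rho> = "\<lambda>a b. \<rho> a b + (if a \<in> K then c a * v b else 0)"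
    have k: "k < n" and K: "K \<subseteq> {..<n}" using insert.prems by auto
    have "(\<lambda>a b. \<rho> a b + (if a \<in> insert k K then c a * v b else 0)) = ?\<rho>(k := (\<lambda>b. \<rho> k b + c k * v b))"
      by (auto simp: fun_eq_iff)
    then have "alt n (\<lambda>a b. \<rho> a b + (if a \<in> insert k K then c a * v b else 0))
       = alt n (?\<rho>(k := \<rho> k)) + c k * alt n (?\<rho>(k := v))"
      by (simp only: alt_row_linear[OF k])
    also have "?\<rho>(k := \<rho> k) = ?\<rho>" using insert.hyps by (auto simp: fun_eq_iff)
    also have "?\<rho>(k := v) = (\<lambda>a b. (\<rho>(k := v)) a b + (if a \<in> K then c a * v b else 0))"
      using insert.hyps by (auto simp: fun_eq_iff)
    also have "alt n \<dots> = alt n (\<rho>(k := v)) + (\<Sum>a\<in>K. c a * alt n (\<rho>(k := v, a := v)))"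
      by (rule insert.IH[OF K])
    also have "(\<Sum>a\<in>K. c a * alt n (\<rho>(k := v, a := v))) = 0"
    proof (rule sum.neutral, rule ballI)
      fix a assume "a \<in> K"
      then have "alt n (\<rho>(k := v, a := v)) = 0"
        using insert.hyps k K by (intro alt_equal_rows[of k n a]) auto
      then show "c a * alt n (\<rho>(k := v, a := v)) = 0" by simp
    qed
    finally show ?case using insert.hyps insert.IH[OF K, of \<rho>] by (simp add: algebra_simps)
  qed simp
qed

section \<open>Exterior powers inside the span of tabloids\<close>

definition hook_tabloids :: "nat \<Rightarrow> nat \<Rightarrow> (nat \<Rightarrow> nat) set" where
  "hook_tabloids r i = tabloid r ` {t. tableau r (hook r i) t}"

lemma hook_tabloids_comp:
  assumes w: "w permutes {1..r}" and x: "x \<in> hook_tabloids r i"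
  shows "x \<circ> w \<in> hook_tabloids r i"
proof -
  obtain t where t: "tableau r (hook r i) t" "x = tabloid r t" using x by (auto simp: hook_tabloids_def)
  have "tableau r (hook r i) (t \<circ> w)"
    using bij_betw_trans[OF permutes_imp_bij[OF w] t(1)[unfolded tableau_def]] by (simp add: tableau_def)
  moreover have "x \<circ> w = tabloid r (t \<circ> w)"
    using permutes_in_image[OF w] by (auto simp: t(2) tabloid_def fun_eq_iff restrict_def)
  ultimately show ?thesis by (auto simp: hook_tabloids_def)
qed

lemma hook_tabloids_comp_iff:
  assumes w: "w permutes {1..r}"
  shows "x \<circ> w \<in> hook_tabloids r i \<longleftrightarrow> x \<in> hook_tabloids r i"
proof
  assume "x \<circ> w \<in> hook_tabloids r i"
  from hook_tabloids_comp[OF permutes_inv[OF w] this] show "x \<in> hook_tabloids r i"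
    using permutes_inv_o(1)[OF w] by (simp only: o_assoc[symmetric] comp_id)
qed (rule hook_tabloids_comp[OF w])

text \<open>The vector \<open>v\<^sub>s = e\<^sub>s - e\<^sub>s\<^sub>+\<^sub>1\<close> of the reflection representation, evaluated on the entry of the tabloid \<open>x\<close> that
  lies in the row \<open>Suc b\<close>; the first row has number \<open>0\<close>.\<close>

definition row_diff :: "(nat \<Rightarrow> nat) \<Rightarrow> nat \<Rightarrow> nat \<Rightarrow> complex" where
  "row_diff x s b = of_bool (x s = Suc b) - of_bool (x (Suc s) = Suc b)"

text \<open>The wedge product of the vectors \<open>v\<^sub>s\<close>, \<open>s \<in> S\<close>, as a function on tabloids: a tabloid of hook shape is determined by the
  entries of its \<open>i\<close> rows of length one, and on these the product is the determinant of the values of the factors.\<close>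

definition hook_vec :: "nat \<Rightarrow> nat \<Rightarrow> nat set \<Rightarrow> (nat \<Rightarrow> nat) \<Rightarrow> complex" where
  "hook_vec r i S x = (if x \<in> hook_tabloids r i
     then alt i (\<lambda>a. row_diff x (sorted_list_of_set S ! a)) else 0)"

text \<open>Replacing an element by an adjacent one keeps the order; this is why no signs occur.\<close>

lemma sorted_list_of_set_exchange:
  assumes S: "finite S" and a: "a < card S" "sorted_list_of_set S ! a = k" and j: "j \<notin> S" and adj: "k = Suc j \<or> j = Suc k"
  shows "sorted_list_of_set (insert j (S - {k})) = (sorted_list_of_set S)[a := j]"
proof -
  let ?l = "sorted_list_of_set S"
  have len: "length ?l = card S" and set: "set ?l = S" and dist: "distinct ?l" and srt: "sorted_wrt (<) ?l"
    using S by (simp_all add: sorted_list_of_set.strict_sorted_key_list_of_set)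
  have kS: "k \<in> S" using a len set nth_mem by fastforce
  have "sorted_wrt (<) (?l[a := j])"
    unfolding sorted_wrt_iff_nth_less
  proof (intro allI impI)
    fix c d assume cd: "c < d" "d < length (?l[a := j])"
    have lt: "?l ! c < ?l ! d" using srt cd by (simp add: sorted_wrt_iff_nth_less)
    have ne: "?l ! e \<noteq> j" if "e < card S" for e using that j set len nth_mem by metis
    show "?l[a := j] ! c < ?l[a := j] ! d"
      using cd lt a adj len ne[of c] ne[of d] by (auto simp: nth_list_update)
  qed
  moreover have "set (?l[a := j]) = insert j (S - {k})"
    using set_update_distinct[OF dist, of a j] a len set by simp
  moreover have "sorted_wrt (<) (sorted_list_of_set (insert j (S - {k})))"
    "set (sorted_list_of_set (insert j (S - {k}))) = insert j (S - {k})"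
    by (rule strict_sorted_list_of_set) (rule set_sorted_list_of_set, simp add: S)
  ultimately show ?thesis by (intro strict_sorted_equal) simp_all
qed

lemma alt_cong: "(\<And>a b. a < n \<Longrightarrow> b < n \<Longrightarrow> \<rho> a b = \<rho>' a b) \<Longrightarrow> alt n \<rho> = alt n \<rho>'"
  unfolding alt_def by (rule arg_cong[of _ _ det], rule eq_matI) auto

text \<open>At \<open>q = 1\<close> the reflection \<open>s\<^sub>j\<close> maps \<open>v\<^sub>s\<close> to \<open>v\<^sub>s\<close> plus this multiple of \<open>v\<^sub>j\<close>.\<close>

definition reflection_coeff :: "nat \<Rightarrow> nat \<Rightarrow> complex" where
  "reflection_coeff j s = (if s = j then - 2 else if Suc s = j \<or> s = Suc j then 1 else 0)"

lemma row_diff_comp: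
  "row_diff (x \<circ> transpose j (j + 1)) s b = row_diff x s b + reflection_coeff j s * row_diff x j b"
proof -
  consider "s = j" | "Suc s = j" | "s = Suc j" | "s \<noteq> j" "Suc s \<noteq> j" "s \<noteq> Suc j" by blast
  then show ?thesis
    by cases (auto simp: row_diff_def reflection_coeff_def transpose_def)
qed

text \<open>The reflection changes every row of the determinant by a multiple of the same row \<open>v\<^sub>j\<close>. Replacing a row by \<open>v\<^sub>j\<close> gives
  zero if \<open>v\<^sub>j\<close> is already another row, and otherwise the wedge product for the exchanged set.\<close>

lemma hook_vec_swap:
  assumes S: "S \<in> hook_index r i" and j: "j \<in> {1..<r}"
  shows "hook_vec r i S (x \<circ> transpose j (j + 1)) =
    (if j \<in> S then - hook_vec r i S x
     else hook_vec r i S x + (if j - 1 \<in> S then hook_vec r i (insert j (S - {j - 1})) x else 0)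
        + (if j + 1 \<in> S then hook_vec r i (insert j (S - {j + 1})) x else 0))"
proof (cases "x \<in> hook_tabloids r i")
  case False
  then have "x \<circ> transpose j (j + 1) \<notin> hook_tabloids r i"
    using hook_tabloids_comp_iff[OF transpose_simple_permutes[OF j]] by simp
  then show ?thesis using False by (simp add: hook_vec_def)
next
  case True
  then have True': "x \<circ> transpose j (j + 1) \<in> hook_tabloids r i"
    using hook_tabloids_comp_iff[OF transpose_simple_permutes[OF j]] by simp
  let ?l = "sorted_list_of_set S" and ?v = "row_diff x j"
  let ?\<rho> = "\<lambda>a. row_diff x (?l ! a)"
  have fin: "finite S" and card: "card S = i" and pos: "0 \<notin> S"
    using S finite_subset[of S "{1..<r}"] by (auto simp: hook_index_def)
  have len: "length ?l = i" and set: "set ?l = S" and dist: "distinct ?l" using fin card by simp_all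
  have mem: "?l ! a \<in> S" if "a < i" for a using that len set nth_mem by metis
  have "hook_vec r i S (x \<circ> transpose j (j + 1))
     = alt i (\<lambda>a b. ?\<rho> a b + (if a \<in> {..<i} then reflection_coeff j (?l ! a) * ?v b else 0))"
    using True' by (simp only: hook_vec_def if_True) (intro alt_cong, simp only: row_diff_comp, simp)
  also have "\<dots> = alt i ?\<rho> + (\<Sum>a\<in>{..<i}. reflection_coeff j (?l ! a) * alt i (?\<rho>(a := ?v)))"
    by (rule alt_rank_one_update) simp
  finally have eq: "hook_vec r i S (x \<circ> transpose j (j + 1))
     = hook_vec r i S x + (\<Sum>a<i. reflection_coeff j (?l ! a) * alt i (?\<rho>(a := ?v)))"
    using True by (simp add: hook_vec_def)
  show ?thesis
  proof (cases "j \<in> S")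
    case jS: True
    then obtain a0 where a0: "a0 < i" "?l ! a0 = j" using set len by (metis in_set_conv_nth)
    have "reflection_coeff j (?l ! a) * alt i (?\<rho>(a := ?v)) = (if a = a0 then - 2 * alt i ?\<rho> else 0)"
      if a: "a < i" for a
    proof (cases "a = a0")
      case True
      have "?\<rho>(a := ?v) = ?\<rho>" using True a0 by (auto simp: fun_eq_iff)
      then show ?thesis using True a0 by (simp add: reflection_coeff_def)
    next
      case False
      have "alt i (?\<rho>(a := ?v)) = 0"
        by (rule alt_equal_rows[of a i a0]) (use a a0 False in auto)
      then show ?thesis using False by simp
    qed
    then have "(\<Sum>a<i. reflection_coeff j (?l ! a) * alt i (?\<rho>(a := ?v))) = - 2 * alt i ?\<rho>"
      using a0(1) by simp
    then show ?thesis using eq jS True by (simp add: hook_vec_def)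
  next
    case jS: False
    let ?F = "\<lambda>s. if Suc s = j \<or> s = Suc j then hook_vec r i (insert j (S - {s})) x else 0"
    have "reflection_coeff j (?l ! a) * alt i (?\<rho>(a := ?v)) = ?F (?l ! a)" if a: "a < i" for a
    proof (cases "Suc (?l ! a) = j \<or> ?l ! a = Suc j")
      case adj: True
      have "sorted_list_of_set (insert j (S - {?l ! a})) = ?l[a := j]"
        by (rule sorted_list_of_set_exchange[OF fin _ refl jS]) (use a card adj in auto)
      then have "hook_vec r i (insert j (S - {?l ! a})) x = alt i (\<lambda>a'. row_diff x (?l[a := j] ! a'))"
        using True by (simp add: hook_vec_def)
      also have "\<dots> = alt i (?\<rho>(a := ?v))" using len by (intro alt_cong) (auto simp: nth_list_update)
      finally show ?thesis using adj by (auto simp: reflection_coeff_def)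
    next
      case False
      moreover have "?l ! a \<noteq> j" using mem[OF a] jS by auto
      ultimately show ?thesis by (simp add: reflection_coeff_def)
    qed
    then have "(\<Sum>a<i. reflection_coeff j (?l ! a) * alt i (?\<rho>(a := ?v))) = (\<Sum>a<i. ?F (?l ! a))"
      by (intro sum.cong refl) simp
    also have "\<dots> = (\<Sum>s\<in>S. ?F s)"
      by (rule sum.reindex_bij_betw[OF bij_betw_nth[OF dist _ set[symmetric]]]) (simp only: len)
    also have "\<dots> = (\<Sum>s\<in>S. (if s = j - 1 then hook_vec r i (insert j (S - {j - 1})) x else 0)
         + (if s = j + 1 then hook_vec r i (insert j (S - {j + 1})) x else 0))"
    proof (rule sum.cong[OF refl])
      fix s assume "s \<in> S"
      then have "Suc s = j \<longleftrightarrow> s = j - 1" using j pos by (cases s) auto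
      then show "?F s = (if s = j - 1 then hook_vec r i (insert j (S - {j - 1})) x else 0)
         + (if s = j + 1 then hook_vec r i (insert j (S - {j + 1})) x else 0)" by auto
    qed
    also have "\<dots> = (if j - 1 \<in> S then hook_vec r i (insert j (S - {j - 1})) x else 0)
         + (if j + 1 \<in> S then hook_vec r i (insert j (S - {j + 1})) x else 0)"
      using fin by (simp add: sum.distrib)
    finally show ?thesis using eq jS by simp
  qed
qed

section \<open>Polytabloids of hook shape\<close>

lemma perm_act_compose: "perm_act (u \<circ> v) f = perm_act u (perm_act v f)"
  by (simp add: perm_act_def o_assoc)

lemma perm_act_id: "perm_act id f = f"
  by (simp add: perm_act_def)

lemma perm_act_lin_comb: "perm_act w (lin_comb K c x) = lin_comb K c (\<lambda>k. perm_act w (x k))"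
  by (simp add: perm_act_def lin_comb_def)

lemma polytabloid_cong:
  assumes "\<And>k. k \<in> {1..r} \<Longrightarrow> t k = t' k"
  shows "polytabloid r t = polytabloid r t'"
proof -
  have stab: "column_stabilizer r t = column_stabilizer r t'"
  proof -
    have "t (p k) = t' (p k)" if "p permutes {1..r}" "k \<in> {1..r}" for p k
      using assms permutes_in_image[OF that(1)] that(2) by blast
    then show ?thesis using assms unfolding column_stabilizer_def by (intro Collect_cong conj_cong ball_cong refl) simp
  qed
  have "tabloid r (t \<circ> inv_into UNIV p) = tabloid r (t' \<circ> inv_into UNIV p)" if "p \<in> column_stabilizer r t'" for p
  proof -
    have p: "p permutes {1..r}" using that by (simp add: column_stabilizer_def)
    have "t (inv_into UNIV p k) = t' (inv_into UNIV p k)" if "k \<in> {1..r}" for k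
      using assms permutes_in_image[OF permutes_inv[OF p]] that by blast
    then show ?thesis by (auto simp: tabloid_def restrict_def fun_eq_iff)
  qed
  then show ?thesis unfolding polytabloid_def stab by (intro ext sum.cong refl) simp
qed

text \<open>Conjugation by \<open>w\<close> carries one column stabilizer to the other and keeps signs.\<close>

lemma perm_act_polytabloid:
  assumes w: "w permutes {1..r}"
  shows "perm_act w (polytabloid r t) = polytabloid r (t \<circ> inv_into UNIV w)"
proof
  fix x
  let ?v = "inv_into UNIV w"
  have v: "?v permutes {1..r}" by (rule permutes_inv[OF w])
  have wv: "w \<circ> ?v = id" "?v \<circ> w = id" using permutes_inv_o[OF w] by auto
  have bij: "bij_betw (\<lambda>p. w \<circ> p \<circ> ?v) (column_stabilizer r t) (column_stabilizer r (t \<circ> ?v))"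
  proof (rule bij_betw_byWitness[where f' = "\<lambda>p. ?v \<circ> p \<circ> w"])
    show "\<forall>p\<in>column_stabilizer r t. ?v \<circ> (w \<circ> p \<circ> ?v) \<circ> w = p"
    proof
      fix p
      have "?v \<circ> (w \<circ> p \<circ> ?v) \<circ> w = (?v \<circ> w) \<circ> p \<circ> (?v \<circ> w)" by (simp only: o_assoc)
      then show "?v \<circ> (w \<circ> p \<circ> ?v) \<circ> w = p" by (simp only: wv id_comp comp_id)
    qed
    show "\<forall>p\<in>column_stabilizer r (t \<circ> ?v). w \<circ> (?v \<circ> p \<circ> w) \<circ> ?v = p"
    proof
      fix p
      have "w \<circ> (?v \<circ> p \<circ> w) \<circ> ?v = (w \<circ> ?v) \<circ> p \<circ> (w \<circ> ?v)" by (simp only: o_assoc)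
      then show "w \<circ> (?v \<circ> p \<circ> w) \<circ> ?v = p" by (simp only: wv id_comp comp_id)
    qed
    show "(\<lambda>p. w \<circ> p \<circ> ?v) ` column_stabilizer r t \<subseteq> column_stabilizer r (t \<circ> ?v)"
    proof (rule image_subsetI)
      fix p assume "p \<in> column_stabilizer r t"
      then have p: "p permutes {1..r}" and col: "\<And>k. k \<in> {1..r} \<Longrightarrow> snd (t (p k)) = snd (t k)"
        by (auto simp: column_stabilizer_def)
      have "w \<circ> p \<circ> ?v permutes {1..r}" by (intro permutes_compose p v w)
      moreover have "snd ((t \<circ> ?v) ((w \<circ> p \<circ> ?v) k)) = snd ((t \<circ> ?v) k)" if "k \<in> {1..r}" for k
      proof -
        have "?v k \<in> {1..r}" using permutes_in_image[OF v] that by blast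
        then show ?thesis using col permutes_inverses(2)[OF w] by simp
      qed
      ultimately show "w \<circ> p \<circ> ?v \<in> column_stabilizer r (t \<circ> ?v)" unfolding column_stabilizer_def by blast
    qed
    show "(\<lambda>p. ?v \<circ> p \<circ> w) ` column_stabilizer r (t \<circ> ?v) \<subseteq> column_stabilizer r t"
    proof (rule image_subsetI)
      fix p assume "p \<in> column_stabilizer r (t \<circ> ?v)"
      then have p: "p permutes {1..r}" and col: "\<And>k. k \<in> {1..r} \<Longrightarrow> snd (t (?v (p k))) = snd (t (?v k))"
        by (auto simp: column_stabilizer_def)
      have "?v \<circ> p \<circ> w permutes {1..r}" by (intro permutes_compose p v w)
      moreover have "snd (t ((?v \<circ> p \<circ> w) k)) = snd (t k)" if "k \<in> {1..r}" for k
      proof -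
        have "w k \<in> {1..r}" using permutes_in_image[OF w] that by blast
        then show ?thesis using col[of "w k"] permutes_inverses(2)[OF w] by simp
      qed
      ultimately show "?v \<circ> p \<circ> w \<in> column_stabilizer r t" unfolding column_stabilizer_def by blast
    qed
  qed
  have perm: "permutation w" "permutation ?v"
    using w v permutation_permutes by (metis finite_atLeastAtMost)+
  have summand: "of_int (sign (w \<circ> p \<circ> ?v)) * of_bool (x = tabloid r (t \<circ> ?v \<circ> inv_into UNIV (w \<circ> p \<circ> ?v)))
     = (of_int (sign p) * of_bool (x \<circ> w = tabloid r (t \<circ> inv_into UNIV p)) :: complex)"
    if "p \<in> column_stabilizer r t" for p
  proof -
    have p: "p permutes {1..r}" using that by (simp add: column_stabilizer_def)
    then have pp: "permutation p" using permutation_permutes by (metis finite_atLeastAtMost)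
    have "sign (w \<circ> p \<circ> ?v) = sign w * sign p * sign ?v"
      using perm pp by (simp only: sign_compose permutation_compose)
    also have "\<dots> = sign p" using sign_inverse[OF perm(1)] sign_idempotent[of w] by (simp add: mult_ac)
    finally have sgn: "sign (w \<circ> p \<circ> ?v) = sign p" .
    have "inv_into UNIV (w \<circ> p \<circ> ?v) = w \<circ> inv_into UNIV p \<circ> ?v"
    proof (rule inv_unique_comp)
      have "w \<circ> p \<circ> ?v \<circ> (w \<circ> inv_into UNIV p \<circ> ?v) = w \<circ> (p \<circ> ((?v \<circ> w) \<circ> inv_into UNIV p)) \<circ> ?v"
        by (simp only: o_assoc)
      then show "w \<circ> p \<circ> ?v \<circ> (w \<circ> inv_into UNIV p \<circ> ?v) = id"
        by (simp only: wv id_comp comp_id permutes_inv_o(1)[OF p])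
      have "w \<circ> inv_into UNIV p \<circ> ?v \<circ> (w \<circ> p \<circ> ?v) = w \<circ> (inv_into UNIV p \<circ> ((?v \<circ> w) \<circ> p)) \<circ> ?v"
        by (simp only: o_assoc)
      then show "w \<circ> inv_into UNIV p \<circ> ?v \<circ> (w \<circ> p \<circ> ?v) = id"
        by (simp only: wv id_comp comp_id permutes_inv_o(2)[OF p])
    qed
    then have "t \<circ> ?v \<circ> inv_into UNIV (w \<circ> p \<circ> ?v) = t \<circ> ((?v \<circ> w) \<circ> (inv_into UNIV p \<circ> ?v))"
      by (simp only: o_assoc)
    also have "\<dots> = t \<circ> inv_into UNIV p \<circ> ?v" by (simp only: wv id_comp o_assoc)
    finally have comp: "t \<circ> ?v \<circ> inv_into UNIV (w \<circ> p \<circ> ?v) = t \<circ> inv_into UNIV p \<circ> ?v" .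
    have tab: "tabloid r (f \<circ> ?v) = tabloid r f \<circ> ?v" for f
      using permutes_in_image[OF v] by (auto simp: tabloid_def restrict_def fun_eq_iff)
    have "x = tabloid r (t \<circ> inv_into UNIV p) \<circ> ?v \<longleftrightarrow> x \<circ> w = tabloid r (t \<circ> inv_into UNIV p)"
    proof
      assume "x = tabloid r (t \<circ> inv_into UNIV p) \<circ> ?v"
      then have "x \<circ> w = tabloid r (t \<circ> inv_into UNIV p) \<circ> (?v \<circ> w)" by (simp only: o_assoc)
      then show "x \<circ> w = tabloid r (t \<circ> inv_into UNIV p)" by (simp only: wv comp_id)
    next
      assume "x \<circ> w = tabloid r (t \<circ> inv_into UNIV p)"
      then have "x \<circ> (w \<circ> ?v) = tabloid r (t \<circ> inv_into UNIV p) \<circ> ?v" by (simp only: o_assoc)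
      then show "x = tabloid r (t \<circ> inv_into UNIV p) \<circ> ?v" by (simp only: wv comp_id)
    qed
    then show ?thesis by (simp only: sgn comp tab)
  qed
  have "polytabloid r (t \<circ> ?v) x = (\<Sum>p\<in>column_stabilizer r t. of_int (sign (w \<circ> p \<circ> ?v)) *
      of_bool (x = tabloid r (t \<circ> ?v \<circ> inv_into UNIV (w \<circ> p \<circ> ?v))))"
    unfolding polytabloid_def by (rule sum.reindex_bij_betw[OF bij, symmetric])
  also have "\<dots> = perm_act w (polytabloid r t) x"
    unfolding perm_act_def polytabloid_def by (rule sum.cong[OF refl summand])
  finally show "perm_act w (polytabloid r t) x = polytabloid r (t \<circ> ?v) x" by (rule sym)
qed

text \<open>The tableau with first column \<open>1, \<dots>, i + 1\<close> and the remaining entries in the first row.\<close>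

definition hook_tableau :: "nat \<Rightarrow> nat \<Rightarrow> nat \<times> nat" where
  "hook_tableau i k = (if k \<le> i + 1 then (k - 1, 0) else (0, k - i - 1))"

lemma diagram_hook: "i < r \<Longrightarrow> diagram (hook r i) = {0} \<times> {..<r - i} \<union> {1..i} \<times> {0}"
  by (auto simp: diagram_def hook_def nth_Cons' split: if_splits)

lemma tableau_hook_tableau:
  assumes "i < r"
  shows "tableau r (hook r i) (hook_tableau i)"
  unfolding tableau_def
proof (rule bij_betw_byWitness[where f' = "\<lambda>(a, b). if a = 0 \<and> 0 < b then b + i + 1 else a + 1"])
  show "(\<lambda>(a, b). if a = 0 \<and> 0 < b then b + i + 1 else a + 1) ` diagram (hook r i) \<subseteq> {1..r}"
    using assms by (auto simp: diagram_hook[OF assms])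
  show "hook_tableau i ` {1..r} \<subseteq> diagram (hook r i)"
    using assms by (auto simp: diagram_hook[OF assms] hook_tableau_def split: if_splits)
qed (use assms in \<open>auto simp: diagram_hook[OF assms] hook_tableau_def split: if_splits\<close>)

lemma column_stabilizer_hook_tableau:
  assumes i: "i < r"
  shows "column_stabilizer r (hook_tableau i) = {p. p permutes {1..i + 1}}"
proof (intro equalityI subsetI CollectI)
  fix p assume "p \<in> column_stabilizer r (hook_tableau i)"
  then have p: "p permutes {1..r}" and col: "\<And>k. k \<in> {1..r} \<Longrightarrow> snd (hook_tableau i (p k)) = snd (hook_tableau i k)"
    by (auto simp: column_stabilizer_def)
  have "p k = k" if "k \<notin> {1..i + 1}" for k
  proof (cases "k \<in> {1..r}")
    case True
    then have "p k \<in> {1..r}" using permutes_in_image[OF p] by blast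
    then show ?thesis using col[OF True] that True by (auto simp: hook_tableau_def split: if_splits)
  next
    case False
    then show ?thesis using permutes_not_in[OF p] by blast
  qed
  then show "p permutes {1..i + 1}" using p by (auto simp: permutes_def)
next
  fix p assume "p \<in> {p. p permutes {1..i + 1}}"
  then have p: "p permutes {1..i + 1}" by simp
  have "p permutes {1..r}" by (rule permutes_subset[OF p]) (use i in auto)
  moreover have "snd (hook_tableau i (p k)) = snd (hook_tableau i k)" if "k \<in> {1..r}" for k
  proof (cases "k \<in> {1..i + 1}")
    case True
    then have "p k \<in> {1..i + 1}" using permutes_in_image[OF p] by blast
    then show ?thesis using True by (simp add: hook_tableau_def)
  next
    case False
    then show ?thesis using permutes_not_in[OF p] by simp
  qed
  ultimately show "p \<in> column_stabilizer r (hook_tableau i)" by (simp add: column_stabilizer_def)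
qed

section \<open>The hook polytabloid as a wedge product\<close>

lemma interval_mem_hook_index: "i < r \<Longrightarrow> {1..i} \<in> hook_index r i"
  by (auto simp: hook_index_def)

text \<open>A word for \<open>p\<close> only uses the transpositions \<open>s\<^sub>j\<close> with \<open>j \<in> {1..i}\<close>, and each of them acts by \<open>-1\<close>.\<close>

lemma hook_vec_alternating:
  assumes i: "i < r" and p: "p permutes {1..i + 1}"
  shows "hook_vec r i {1..i} (x \<circ> p) = of_int (sign p) * hook_vec r i {1..i} x"
proof -
  obtain "is" where "is": "set is \<subseteq> {1..<i + 1}" "word_perm is = p" using ex_shortest_word[OF p] by blast
  have "hook_vec r i {1..i} (x \<circ> word_perm is) = of_int (sign (word_perm is)) * hook_vec r i {1..i} x" for x
    using "is"(1)
  proof (induction "is" arbitrary: x)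
    case (Cons j js)
    let ?s = "transpose j (j + 1) :: nat \<Rightarrow> nat"
    have j: "j \<in> {1..i}" "j \<in> {1..<r}" and sub: "set js \<subseteq> {1..<i + 1}" using Cons.prems i by auto
    have perm: "permutation (word_perm js)"
      using word_perm_permutes[OF sub] by (auto simp: permutation_permutes)
    have "x \<circ> word_perm (j # js) = (x \<circ> ?s) \<circ> word_perm js" by (simp only: word_perm_Cons o_assoc)
    then have "hook_vec r i {1..i} (x \<circ> word_perm (j # js))
       = of_int (sign (word_perm js)) * hook_vec r i {1..i} (x \<circ> ?s)"
      using Cons.IH[OF sub] by (simp only:)
    also have "hook_vec r i {1..i} (x \<circ> ?s) = - hook_vec r i {1..i} x"
      unfolding hook_vec_swap[OF interval_mem_hook_index[OF i] j(2)] using j(1) by (simp only: if_True)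
    also have "sign (word_perm js) = - sign (word_perm (j # js))"
      unfolding word_perm_Cons sign_compose[OF permutation_swap_id perm] by (simp add: sign_swap_id)
    finally show ?case by (simp only: of_int_minus mult_minus_left mult_minus_right minus_minus)
  qed simp
  from this[of x] show ?thesis by (simp only: "is"(2))
qed

definition hook_tabloid :: "nat \<Rightarrow> nat \<Rightarrow> nat \<Rightarrow> nat" where
  "hook_tabloid r i = tabloid r (hook_tableau i)"

lemma hook_tabloid_apply: "hook_tabloid r i k = (if k \<in> {1..r} then if k \<le> i + 1 then k - 1 else 0 else undefined)"
  by (auto simp: hook_tabloid_def tabloid_def restrict_def hook_tableau_def)

lemma sorted_list_of_interval_nth: "a < i \<Longrightarrow> sorted_list_of_set {1..i} ! a = Suc a"
proof -
  have "{1..i} = {1..<Suc i}" by auto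
  then have "sorted_list_of_set {1..i} = [1..<Suc i]" by (simp only: sorted_list_of_set_range)
  then show "a < i \<Longrightarrow> ?thesis" by (simp del: upt_Suc)
qed

text \<open>The matrix is lower triangular with \<open>-1\<close> on the diagonal.\<close>

lemma hook_vec_hook_tabloid:
  assumes i: "i < r"
  shows "hook_vec r i {1..i} (hook_tabloid r i) \<noteq> 0"
proof -
  have mem: "hook_tabloid r i \<in> hook_tabloids r i"
    using tableau_hook_tableau[OF i] by (auto simp: hook_tabloids_def hook_tabloid_def)
  define M where "M = mat i i (\<lambda>(a, b). row_diff (hook_tabloid r i) (sorted_list_of_set {1..i} ! a) b)"
  have M: "M \<in> carrier_mat i i" by (simp add: M_def)
  have entry: "M $$ (a, b) = of_bool (a = Suc b) - of_bool (a = b)" if ab: "a < i" "b < i" for a b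
  proof -
    have "M $$ (a, b) = row_diff (hook_tabloid r i) (Suc a) b"
      using ab by (simp only: M_def index_mat prod.case sorted_list_of_interval_nth)
    also have "hook_tabloid r i (Suc a) = a" "hook_tabloid r i (Suc (Suc a)) = Suc a"
      using ab i by (simp_all add: hook_tabloid_apply)
    then have "row_diff (hook_tabloid r i) (Suc a) b = of_bool (a = Suc b) - of_bool (a = b)"
      by (simp add: row_diff_def)
    finally show ?thesis .
  qed
  have "det M = prod_list (diag_mat M)"
    by (rule det_lower_triangular[OF _ M]) (simp add: entry)
  also have "\<dots> = (\<Prod>a = 0..<i. M $$ (a, a))" using M by (simp add: prod_list_diag_prod)
  also have "\<dots> = (\<Prod>a = 0..<i. - 1)" by (rule prod.cong[OF refl]) (simp add: entry)
  finally have "det M \<noteq> 0" by simp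
  moreover have "hook_vec r i {1..i} (hook_tabloid r i) = det M"
    using mem by (simp only: hook_vec_def if_True alt_def M_def)
  ultimately show ?thesis by simp
qed

lemma alt_zero_column:
  assumes c: "c < n" and zero: "\<And>a. a < n \<Longrightarrow> \<rho> a c = 0"
  shows "alt n \<rho> = 0"
  unfolding alt_leibniz
proof (rule sum.neutral, rule ballI)
  fix p assume "p \<in> {p. p permutes {0..<n}}"
  then have p: "p permutes {0..<n}" by simp
  let ?a = "inv_into UNIV p c"
  have a: "?a \<in> {0..<n}" using permutes_in_image[OF permutes_inv[OF p], of c] c by simp
  have "p ?a = c" by (rule permutes_inverses(1)[OF p])
  then have "\<rho> ?a (p ?a) = 0" using zero[of ?a] a by simp
  then have "\<exists>a\<in>{0..<n}. \<rho> a (p a) = 0" using a by (rule bexI)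
  then have "(\<Prod>a = 0..<n. \<rho> a (p a)) = 0" by (intro prod_zero finite_atLeastLessThan)
  then show "signof p * (\<Prod>a = 0..<n. \<rho> a (p a)) = 0" by simp
qed

text \<open>Every row of a hook below the first has a single cell, which lies in the first column.\<close>

lemma hook_tabloids_rows:
  assumes i: "i < r" and x: "x \<in> hook_tabloids r i"
  shows "k \<in> {1..r} \<Longrightarrow> x k \<le> i"
    and "k \<notin> {1..r} \<Longrightarrow> x k = undefined"
    and "b \<in> {1..i} \<Longrightarrow> \<exists>!k. k \<in> {1..r} \<and> x k = b"
proof -
  obtain t where t: "bij_betw t {1..r} (diagram (hook r i))" and xt: "x = tabloid r t"
    using x by (auto simp: hook_tabloids_def tableau_def)
  have img: "t k \<in> diagram (hook r i)" if "k \<in> {1..r}" for k using bij_betwE[OF t] that by blast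
  have xk: "x k = fst (t k)" if "k \<in> {1..r}" for k using that by (simp add: xt tabloid_def)
  show "k \<in> {1..r} \<Longrightarrow> x k \<le> i" using img[of k] xk[of k] by (auto simp: diagram_hook[OF i])
  show "k \<notin> {1..r} \<Longrightarrow> x k = undefined" by (simp only: xt tabloid_def restrict_apply if_False)
  assume b: "b \<in> {1..i}"
  then have "(b, 0) \<in> diagram (hook r i)" by (simp add: diagram_hook[OF i])
  then have "(b, 0) \<in> t ` {1..r}" by (simp only: bij_betw_imp_surj_on[OF t])
  then obtain k where k: "k \<in> {1..r}" "t k = (b, 0)" by (elim imageE) simp
  have "l = k" if l: "l \<in> {1..r}" "x l = b" for l
  proof -
    have "t l = (b, 0)" using img[OF l(1)] xk[OF l(1)] l(2) b by (cases "t l") (auto simp: diagram_hook[OF i])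
    then show ?thesis using k by (intro inj_onD[OF bij_betw_imp_inj_on[OF t] _ l(1) k(1)]) simp
  qed
  moreover have "x k = b" using k xk by simp
  ultimately show "\<exists>!k. k \<in> {1..r} \<and> x k = b" using k(1) by (intro ex1I[of _ k]) blast+
qed

text \<open>The factors only involve \<open>1, \<dots>, i + 1\<close>. If an entry below the first row is larger, the determinant has a zero column;
  otherwise the tabloid is a rearrangement of these \<open>i + 1\<close> numbers.\<close>

lemma hook_vec_support:
  assumes i: "i < r" and nz: "hook_vec r i {1..i} x \<noteq> 0"
  shows "\<exists>w. w permutes {1..i + 1} \<and> x = hook_tabloid r i \<circ> w"
proof -
  have x: "x \<in> hook_tabloids r i" using nz by (auto simp: hook_vec_def split: if_splits)
  note rows = hook_tabloids_rows[OF i x]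
  have sub: "{1..i + 1} \<subseteq> {1..r}" using i by auto
  have hit: "\<exists>k\<in>{1..i + 1}. x k = b" if b: "b \<in> {1..i}" for b
  proof (rule ccontr)
    assume none: "\<not> ?thesis"
    have "alt i (\<lambda>a. row_diff x (sorted_list_of_set {1..i} ! a)) = 0"
    proof (rule alt_zero_column[of "b - 1"])
      show "b - 1 < i" using b by auto
      fix a assume a: "a < i"
      have "x (Suc a) \<noteq> b" "x (Suc (Suc a)) \<noteq> b" using none a by auto
      then show "row_diff x (sorted_list_of_set {1..i} ! a) (b - 1) = 0"
        using b unfolding sorted_list_of_interval_nth[OF a] row_diff_def by simp
    qed
    then have "hook_vec r i {1..i} x = 0" by (simp only: hook_vec_def if_cancel)
    then show False using nz by simp
  qed
  have uniq: "k = l" if "k \<in> {1..r}" "l \<in> {1..r}" "x k = x l" "x k \<noteq> 0" for k l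
  proof -
    have "x k \<in> {1..i}" using rows(1)[OF that(1)] that(4) by simp
    from rows(3)[OF this] show ?thesis using that by metis
  qed
  have img: "x ` {1..i + 1} \<subseteq> {0..i}"
    using rows(1) subsetD[OF sub] by (intro image_subsetI) (simp only: atLeastAtMost_iff zero_le simp_thms)
  \<comment> \<open>The numbers \<open>1, \<dots>, i + 1\<close> cannot all lie below the first row, where there are only \<open>i\<close> cells.\<close>
  have "0 \<in> x ` {1..i + 1}"
  proof (rule ccontr)
    assume "0 \<notin> x ` {1..i + 1}"
    then have nz: "x k \<noteq> 0" if "k \<in> {1..i + 1}" for k using imageI[OF that, of x] by (intro notI) simp
    have "inj_on x {1..i + 1}"
    proof (rule inj_onI)
      fix k l assume "k \<in> {1..i + 1}" "l \<in> {1..i + 1}" "x k = x l"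
      then show "k = l" using uniq[OF subsetD[OF sub] subsetD[OF sub]] nz by blast
    qed
    moreover have "x ` {1..i + 1} \<subseteq> {1..i}"
    proof (rule image_subsetI)
      fix k assume k: "k \<in> {1..i + 1}"
      then show "x k \<in> {1..i}" using nz[OF k] rows(1)[OF subsetD[OF sub k]] by simp
    qed
    ultimately have "card {1..i + 1} \<le> card {1..i}" by (intro card_inj_on_le) auto
    then show False by simp
  qed
  note zero = this
  have "b \<in> x ` {1..i + 1}" if "b \<in> {0..i}" for b
  proof (cases "b = 0")
    case False
    then have "b \<in> {1..i}" using that by simp
    from hit[OF this] show ?thesis by (elim bexE) (rule image_eqI[OF sym])
  qed (use zero in simp)
  then have surj: "x ` {1..i + 1} = {0..i}"
    by (intro equalityI img subsetI)
  then have "card (x ` {1..i + 1}) = card {1..i + 1}" by simp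
  then have inj: "inj_on x {1..i + 1}" by (rule eq_card_imp_inj_on[rotated]) simp
  define w where "w k = (if k \<in> {1..i + 1} then x k + 1 else k)" for k
  have "bij_betw w {1..i + 1} {1..i + 1}"
  proof (rule bij_betw_imageI)
    show "inj_on w {1..i + 1}" using inj by (auto simp: w_def inj_on_def)
    have "w ` {1..i + 1} = Suc ` (x ` {1..i + 1})" unfolding image_image by (rule image_cong) (simp_all add: w_def)
    also have "\<dots> = {1..i + 1}" unfolding surj by (simp add: image_Suc_atLeastAtMost)
    finally show "w ` {1..i + 1} = {1..i + 1}" .
  qed
  then have w: "w permutes {1..i + 1}" by (rule bij_imp_permutes) (simp only: w_def if_False)
  have "x k = hook_tabloid r i (w k)" for k
  proof -
    consider "k \<in> {1..i + 1}" | "k \<notin> {1..i + 1}" "k \<in> {1..r}" | "k \<notin> {1..r}" by blast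
    then show ?thesis
    proof cases
      case 1
      then have "x k \<le> i" using rows(1) sub by blast
      then show ?thesis using 1 i by (simp add: w_def hook_tabloid_apply)
    next
      case 2
      have "x k = 0"
      proof (rule ccontr)
        assume nz: "x k \<noteq> 0"
        then have "x k \<in> {1..i}" using rows(1)[OF 2(2)] by simp
        from hit[OF this] obtain l where l: "l \<in> {1..i + 1}" "x l = x k" by blast
        have "k = l" by (rule uniq[OF 2(2) subsetD[OF sub l(1)] l(2)[symmetric] nz])
        then show False using l(1) 2(1) by blast
      qed
      then show ?thesis using 2 by (simp add: w_def hook_tabloid_apply)
    next
      case 3
      then have "w k = k" using subsetD[OF sub, of k] unfolding w_def by (intro if_not_P) blast
      then show ?thesis using 3 rows(2)[OF 3] by (simp only: hook_tabloid_apply if_False)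
    qed
  qed
  then show ?thesis using w by (intro exI[of _ w]) (auto simp: fun_eq_iff)
qed

lemma hook_tabloid_comp_inj:
  assumes i: "i < r" and u: "u permutes {1..i + 1}" and v: "v permutes {1..i + 1}"
    and eq: "hook_tabloid r i \<circ> u = hook_tabloid r i \<circ> v"
  shows "u = v"
proof
  fix k
  show "u k = v k"
  proof (cases "k \<in> {1..i + 1}")
    case True
    then have uv: "u k \<in> {1..i + 1}" "v k \<in> {1..i + 1}"
      using permutes_in_image[OF u, of k] permutes_in_image[OF v, of k] by (simp_all only:)
    from fun_cong[OF eq, of k] have "hook_tabloid r i (u k) = hook_tabloid r i (v k)" by simp
    then have "u k - 1 = v k - 1" using uv i by (simp add: hook_tabloid_apply)
    moreover have "1 \<le> u k" "1 \<le> v k" using uv by simp_all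
    ultimately show ?thesis by linarith
  next
    case False
    show ?thesis by (simp only: permutes_not_in[OF u False] permutes_not_in[OF v False])
  qed
qed

text \<open>Both sides are alternating under permutations of \<open>1, \<dots>, i + 1\<close> and are supported on the orbit of the same tabloid, so
  they are proportional.\<close>

lemma hook_vec_eq_polytabloid:
  assumes i: "i < r"
  shows "hook_vec r i {1..i} x = hook_vec r i {1..i} (hook_tabloid r i) * polytabloid r (hook_tableau i) x"
proof -
  let ?\<tau> = "hook_tabloid r i"
  have tab: "tabloid r (hook_tableau i \<circ> inv_into UNIV p) = ?\<tau> \<circ> inv_into UNIV p" if p: "p permutes {1..i + 1}" for p
  proof -
    have "p permutes {1..r}" by (rule permutes_subset[OF p]) (use i in auto)
    then have v: "inv_into UNIV p permutes {1..r}" by (rule permutes_inv)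
    show ?thesis
      by (rule ext) (simp only: hook_tabloid_def tabloid_def restrict_def o_apply permutes_in_image[OF v])
  qed
  have poly: "polytabloid r (hook_tableau i) x
     = (\<Sum>p | p permutes {1..i + 1}. of_int (sign p) * of_bool (x = ?\<tau> \<circ> inv_into UNIV p))"
    unfolding polytabloid_def column_stabilizer_hook_tableau[OF i]
    by (rule sum.cong[OF refl]) (simp only: mem_Collect_eq tab)
  show ?thesis
  proof (cases "\<exists>w. w permutes {1..i + 1} \<and> x = ?\<tau> \<circ> w")
    case True
    then obtain w where w: "w permutes {1..i + 1}" and x: "x = ?\<tau> \<circ> w" by blast
    let ?v = "inv_into UNIV w"
    have v: "?v permutes {1..i + 1}" by (rule permutes_inv[OF w])
    have "x = ?\<tau> \<circ> inv_into UNIV p \<longleftrightarrow> p = ?v" if p: "p permutes {1..i + 1}" for p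
    proof
      assume "x = ?\<tau> \<circ> inv_into UNIV p"
      then have "w = inv_into UNIV p"
        using hook_tabloid_comp_inj[OF i w permutes_inv[OF p]] x by simp
      then show "p = ?v" using permutes_inv_inv[OF p] by simp
    qed (simp add: x permutes_inv_inv[OF w])
    then have "polytabloid r (hook_tableau i) x = (\<Sum>p | p permutes {1..i + 1}. if p = ?v then of_int (sign p) else 0)"
      unfolding poly by (intro sum.cong refl) (simp del: One_nat_def add_Suc_right)
    also have "\<dots> = of_int (sign ?v)"
      using v finite_permutations[of "{1..i + 1}"] by simp
    also have "sign ?v = sign w"
      using w by (intro sign_inverse) (auto simp: permutation_permutes)
    finally have "polytabloid r (hook_tableau i) x = of_int (sign w)" .
    moreover have "hook_vec r i {1..i} x = of_int (sign w) * hook_vec r i {1..i} ?\<tau>"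
      unfolding x by (rule hook_vec_alternating[OF i w])
    ultimately show ?thesis by (simp only: mult.commute)
  next
    case False
    then have "hook_vec r i {1..i} x = 0" using hook_vec_support[OF i] by blast
    moreover have "polytabloid r (hook_tableau i) x = 0"
      unfolding poly
    proof (rule sum.neutral, rule ballI)
      fix p assume "p \<in> {p. p permutes {1..i + 1}}"
      then have "x \<noteq> ?\<tau> \<circ> inv_into UNIV p" using False permutes_inv by blast
      then show "of_int (sign p) * of_bool (x = ?\<tau> \<circ> inv_into UNIV p) = (0::complex)" by simp
    qed
    ultimately show ?thesis by simp
  qed
qed

section \<open>The Specht character of a hook\<close>

lemma exchange_mem_hook_index:
  assumes "S \<in> hook_index r i" "j \<in> {1..<r}" "j \<notin> S" "k \<in> S"
  shows "insert j (S - {k}) \<in> hook_index r i"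
proof -
  have fin: "finite S" using assms(1) finite_subset[of S "{1..<r}"] by (auto simp: hook_index_def)
  have "card (insert j (S - {k})) = Suc (card (S - {k}))" using fin assms(3) by simp
  also have "\<dots> = card S" by (rule card_Suc_Diff1[OF fin assms(4)])
  finally show ?thesis using assms by (auto simp: hook_index_def)
qed

text \<open>The action on basis vectors, dual to the action on coordinates that defines the operator.\<close>

lemma hook_op_basis_fun:
  assumes j: "1 \<le> j" and S: "0 \<notin> S"
  shows "hook_op q j (basis_fun S) T = (if j \<in> S then - q * basis_fun S T else basis_fun S T
     + (if j - 1 \<in> S then q * basis_fun (insert j (S - {j - 1})) T else 0)
     + (if j + 1 \<in> S then basis_fun (insert j (S - {j + 1})) T else 0))"
proof (cases "j \<in> T")
  case jT: False
  then have "insert j X \<noteq> T" for X by blast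
  then show ?thesis using jT by (auto simp: hook_op_def basis_fun_def)
next
  case jT: True
  have exch: "(if a \<in> T then 0 else basis_fun S (insert a (T - {j})))
      = (if a \<in> S then basis_fun (insert j (S - {a})) T else (0::'a))" if "a \<noteq> j" "j \<notin> S" for a
  proof -
    have "(if a \<in> T then 0 else basis_fun S (insert a (T - {j}))) = (of_bool (insert a (T - {j}) = S \<and> a \<notin> T) :: 'a)"
      by (simp add: basis_fun_def)
    also have "\<dots> = of_bool (a \<in> S \<and> T = insert j (S - {a}))"
      by (simp only: exchange_eq_iff[OF that(1) jT that(2)])
    also have "\<dots> = (if a \<in> S then basis_fun (insert j (S - {a})) T else 0)" by (simp add: basis_fun_def)
    finally show ?thesis .
  qed
  show ?thesis
  proof (cases "j \<in> S")
    case True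
    then have "insert a (T - {j}) \<noteq> S" if "a \<noteq> j" for a using that by blast
    then have "basis_fun S (insert (j - 1) (T - {j})) = (0::'a)" "basis_fun S (insert (j + 1) (T - {j})) = (0::'a)"
      using j by (simp_all add: basis_fun_def)
    then show ?thesis using jT True by (simp add: hook_op_def)
  next
    case False
    have ne: "j - 1 \<noteq> j" "j + 1 \<noteq> j" using j by auto
    have "S \<noteq> T" using jT False by blast
    then have "hook_op q j (basis_fun S) T = q * (if j - 1 \<in> T then 0 else basis_fun S (insert (j - 1) (T - {j})))
        + (if j + 1 \<in> T then 0 else basis_fun S (insert (j + 1) (T - {j})))"
      using jT by (simp add: hook_op_def basis_fun_def)
    also have "\<dots> = q * (if j - 1 \<in> S then basis_fun (insert j (S - {j - 1})) T else 0)
        + (if j + 1 \<in> S then basis_fun (insert j (S - {j + 1})) T else 0)"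
      by (simp only: exch[OF ne(1) False] exch[OF ne(2) False])
    finally show ?thesis using False \<open>S \<noteq> T\<close> by (simp add: basis_fun_def)
  qed
qed

definition hook_family :: "nat \<Rightarrow> nat \<Rightarrow> nat \<Rightarrow> (nat \<Rightarrow> nat) \<Rightarrow> complex" where
  "hook_family r i a = hook_vec r i (hook_enum r i a)"

lemma sum_basis_fun_family:
  assumes "T \<in> hook_index r i"
  shows "(\<Sum>a<card (hook_index r i). basis_fun T (hook_enum r i a) * hook_family r i a x) = hook_vec r i T x"
proof -
  have "(\<Sum>a<card (hook_index r i). basis_fun T (hook_enum r i a) * hook_family r i a x)
      = (\<Sum>S\<in>hook_index r i. basis_fun T S * hook_vec r i S x)"
    unfolding hook_family_def by (rule sum.reindex_bij_betw[OF hook_enum])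
  also have "\<dots> = (\<Sum>S\<in>hook_index r i. if S = T then hook_vec r i T x else 0)"
    by (intro sum.cong refl) (simp add: basis_fun_def)
  also have "\<dots> = hook_vec r i T x" using finite_hook_index assms by simp
  finally show ?thesis .
qed

lemma perm_act_hook_family:
  assumes j: "j \<in> {1..<r}" and b: "b < card (hook_index r i)"
  shows "perm_act (transpose j (j + 1)) (hook_family r i b) =
    lin_comb {..<card (hook_index r i)} (\<lambda>a. hook_mat 1 r i j $$ (a, b)) (hook_family r i)"
proof
  fix x
  let ?N = "card (hook_index r i)" and ?S = "hook_enum r i b"
  have S: "?S \<in> hook_index r i" by (rule hook_enum_mem[OF b])
  then have S0: "0 \<notin> ?S" by (auto simp: hook_index_def)
  have j1: "1 \<le> j" using j by simp
  let ?sum = "\<lambda>f. \<Sum>a<?N. f (hook_enum r i a) * hook_family r i a x"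
  have "lin_comb {..<?N} (\<lambda>a. hook_mat 1 r i j $$ (a, b)) (hook_family r i) x
     = ?sum (hook_op 1 j (basis_fun ?S))"
    unfolding lin_comb_def by (intro sum.cong refl) (simp add: hook_mat_def b)
  also have "\<dots> = hook_vec r i ?S (x \<circ> transpose j (j + 1))"
  proof (cases "j \<in> ?S")
    case True
    have "?sum (hook_op 1 j (basis_fun ?S)) = - ?sum (basis_fun ?S)"
      unfolding hook_op_basis_fun[OF j1 S0] using True by (simp add: sum_negf)
    then show ?thesis
      unfolding hook_vec_swap[OF S j] sum_basis_fun_family[OF S] using True by simp
  next
    case False
    have ex: "?sum (\<lambda>T. if k \<in> ?S then basis_fun (insert j (?S - {k})) T else 0)
        = (if k \<in> ?S then hook_vec r i (insert j (?S - {k})) x else 0)" for k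
      using sum_basis_fun_family[OF exchange_mem_hook_index[OF S j False, of k], of x] by simp
    have "?sum (hook_op 1 j (basis_fun ?S)) = ?sum (basis_fun ?S)
        + ?sum (\<lambda>T. if j - 1 \<in> ?S then basis_fun (insert j (?S - {j - 1})) T else 0)
        + ?sum (\<lambda>T. if j + 1 \<in> ?S then basis_fun (insert j (?S - {j + 1})) T else 0)"
      unfolding hook_op_basis_fun[OF j1 S0] sum.distrib[symmetric] using False
      by (intro sum.cong refl) (simp add: distrib_right)
    then show ?thesis
      unfolding hook_vec_swap[OF S j] sum_basis_fun_family[OF S] ex using False by simp
  qed
  also have "\<dots> = perm_act (transpose j (j + 1)) (hook_family r i b) x"
    by (simp only: perm_act_def hook_family_def)
  finally show "perm_act (transpose j (j + 1)) (hook_family r i b) x =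
     lin_comb {..<?N} (\<lambda>a. hook_mat 1 r i j $$ (a, b)) (hook_family r i) x" by (rule sym)
qed

lemma perm_act_lin_comb_hook_family:
  assumes j: "j \<in> {1..<r}"
  shows "perm_act (transpose j (j + 1)) (lin_comb {..<card (hook_index r i)} c (hook_family r i))
    = lin_comb {..<card (hook_index r i)} (\<lambda>a. \<Sum>k<card (hook_index r i). hook_mat 1 r i j $$ (a, k) * c k) (hook_family r i)"
proof
  fix x
  let ?N = "card (hook_index r i)"
  have "perm_act (transpose j (j + 1)) (lin_comb {..<?N} c (hook_family r i)) x
     = (\<Sum>k<?N. c k * lin_comb {..<?N} (\<lambda>a. hook_mat 1 r i j $$ (a, k)) (hook_family r i) x)"
  proof -
    have "perm_act (transpose j (j + 1)) (lin_comb {..<?N} c (hook_family r i)) x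
       = (\<Sum>k<?N. c k * perm_act (transpose j (j + 1)) (hook_family r i k) x)"
      by (simp only: perm_act_def lin_comb_def)
    also have "\<dots> = (\<Sum>k<?N. c k * lin_comb {..<?N} (\<lambda>a. hook_mat 1 r i j $$ (a, k)) (hook_family r i) x)"
      by (rule sum.cong[OF refl]) (simp only: perm_act_hook_family[OF j] lessThan_iff)
    finally show ?thesis .
  qed
  also have "\<dots> = (\<Sum>k<?N. \<Sum>a<?N. hook_mat 1 r i j $$ (a, k) * c k * hook_family r i a x)"
    unfolding lin_comb_def sum_distrib_left by (intro sum.cong refl) (simp only: mult_ac)
  also have "\<dots> = (\<Sum>a<?N. \<Sum>k<?N. hook_mat 1 r i j $$ (a, k) * c k * hook_family r i a x)" by (rule sum.swap)
  also have "\<dots> = lin_comb {..<?N} (\<lambda>a. \<Sum>k<?N. hook_mat 1 r i j $$ (a, k) * c k) (hook_family r i) x"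
    by (simp only: lin_comb_def sum_distrib_right)
  finally show "perm_act (transpose j (j + 1)) (lin_comb {..<?N} c (hook_family r i)) x
    = lin_comb {..<?N} (\<lambda>a. \<Sum>k<?N. hook_mat 1 r i j $$ (a, k) * c k) (hook_family r i) x" .
qed

lemma perm_act_word_hook_family:
  assumes "set is \<subseteq> {1..<r}" and b: "b < card (hook_index r i)"
  shows "perm_act (word_perm is) (hook_family r i b) =
    lin_comb {..<card (hook_index r i)} (\<lambda>a. word_mat (card (hook_index r i)) (hook_mat 1 r i) is $$ (a, b)) (hook_family r i)"
  using assms(1)
proof (induction "is")
  case Nil
  let ?N = "card (hook_index r i)"
  have "lin_comb {..<?N} (\<lambda>a. 1\<^sub>m ?N $$ (a, b)) (hook_family r i) x = hook_family r i b x" for x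
  proof -
    have "lin_comb {..<?N} (\<lambda>a. 1\<^sub>m ?N $$ (a, b)) (hook_family r i) x = (\<Sum>a<?N. if a = b then hook_family r i b x else 0)"
      unfolding lin_comb_def using b by (intro sum.cong refl) simp
    then show ?thesis using b by simp
  qed
  then show ?case by (simp only: word_perm_Nil perm_act_id word_mat_Nil fun_eq_iff) simp
next
  case (Cons j js)
  let ?N = "card (hook_index r i)"
  have j: "j \<in> {1..<r}" and sub: "set js \<subseteq> {1..<r}" using Cons.prems by auto
  have "perm_act (word_perm (j # js)) (hook_family r i b)
     = lin_comb {..<?N} (\<lambda>a. \<Sum>k<?N. hook_mat 1 r i j $$ (a, k) * word_mat ?N (hook_mat 1 r i) js $$ (k, b)) (hook_family r i)"
    by (simp only: word_perm_Cons perm_act_compose Cons.IH[OF sub] perm_act_lin_comb_hook_family[OF j])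
  also have "\<dots> = lin_comb {..<?N} (\<lambda>a. word_mat ?N (hook_mat 1 r i) (j # js) $$ (a, b)) (hook_family r i)"
    unfolding lin_comb_def
    by (intro ext sum.cong refl) (simp add: mult_mat_entry[OF hook_mat_carrier word_hook_mat_carrier _ b])
  finally show ?case .
qed

text \<open>The map from the exterior power to functions on tabloids that sends the basis vector of \<open>S\<close> to its wedge product.\<close>

definition hook_comb :: "nat \<Rightarrow> nat \<Rightarrow> complex vec \<Rightarrow> (nat \<Rightarrow> nat) \<Rightarrow> complex" where
  "hook_comb r i v = lin_comb {..<card (hook_index r i)} (\<lambda>a. vec_index v a) (hook_family r i)"

lemma hook_comb_add: "u \<in> carrier_vec (card (hook_index r i)) \<Longrightarrow> v \<in> carrier_vec (card (hook_index r i)) \<Longrightarrow>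
    hook_comb r i (u + v) = hook_comb r i u + hook_comb r i v"
  by (rule ext) (simp add: hook_comb_def lin_comb_def sum.distrib distrib_right)

lemma hook_comb_smult: "v \<in> carrier_vec (card (hook_index r i)) \<Longrightarrow>
    hook_comb r i (c \<cdot>\<^sub>v v) = (\<lambda>x. c * hook_comb r i v x)"
  by (rule ext) (simp add: hook_comb_def lin_comb_def sum_distrib_left mult.assoc)

lemma hook_comb_action:
  assumes j: "j \<in> {1..<r}" and v: "v \<in> carrier_vec (card (hook_index r i))"
  shows "hook_comb r i (hook_mat 1 r i j *\<^sub>v v) = perm_act (transpose j (j + 1)) (hook_comb r i v)"
proof -
  let ?N = "card (hook_index r i)"
  have "vec_index (hook_mat 1 r i j *\<^sub>v v) a = (\<Sum>k<?N. hook_mat 1 r i j $$ (a, k) * vec_index v k)" if "a < ?N" for a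
    using v that hook_mat_carrier[of "1::complex" r i j] by (simp add: scalar_prod_def atLeast0LessThan)
  then have "hook_comb r i (hook_mat 1 r i j *\<^sub>v v)
     = lin_comb {..<?N} (\<lambda>a. \<Sum>k<?N. hook_mat 1 r i j $$ (a, k) * vec_index v k) (hook_family r i)"
    unfolding hook_comb_def lin_comb_def by (intro ext sum.cong refl) (simp only: lessThan_iff)
  then show ?thesis by (simp only: hook_comb_def perm_act_lin_comb_hook_family[OF j])
qed

lemma hook_comb_unit:
  assumes b: "b < card (hook_index r i)"
  shows "hook_comb r i (unit_vec (card (hook_index r i)) b) = hook_family r i b"
proof
  fix x
  have "hook_comb r i (unit_vec (card (hook_index r i)) b) x
     = (\<Sum>a<card (hook_index r i). if a = b then hook_family r i b x else 0)"
    unfolding hook_comb_def lin_comb_def using b by (intro sum.cong refl) simp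
  then show "hook_comb r i (unit_vec (card (hook_index r i)) b) x = hook_family r i b x" using b by simp
qed

text \<open>The preimage of \<open>V\<close> is invariant and contains the nonzero vector \<open>u\<close>, so it is everything by irreducibility at \<open>q = 1\<close>.
  With \<open>V\<close> zero this gives linear independence, with \<open>V\<close> the Specht module it gives containment.\<close>

lemma hook_comb_invariant:
  assumes i: "i < r" and V: "fun_space.subspace V"
    and inv: "\<And>j f. j \<in> {1..<r} \<Longrightarrow> f \<in> V \<Longrightarrow> perm_act (transpose j (j + 1)) f \<in> V"
    and u: "u \<in> carrier_vec (card (hook_index r i))" "u \<noteq> 0\<^sub>v (card (hook_index r i))" "hook_comb r i u \<in> V"
    and v: "v \<in> carrier_vec (card (hook_index r i))"
  shows "hook_comb r i v \<in> V"
proof -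
  let ?N = "card (hook_index r i)"
  interpret schur_matrices "1::complex" r ?N "hook_mat 1 r i"
    by (rule schur_hook_one) (use i in auto)
  let ?U = "{v \<in> carrier_vec ?N. hook_comb r i v \<in> V}"
  have "?U = carrier_vec ?N"
  proof (rule nonzero_invariant_subset_full)
    show "u \<in> ?U" "u \<noteq> 0\<^sub>v ?N" using u by simp_all
    show "?U \<subseteq> carrier_vec ?N" by (rule Collect_restrict)
    show "v + w \<in> ?U" if "v \<in> ?U" "w \<in> ?U" for v w
      using that hook_comb_add[of v r i w] fun_space.subspace_add[OF V] by simp
    show "c \<cdot>\<^sub>v v \<in> ?U" if "v \<in> ?U" for c v
      using that hook_comb_smult[of v r i c] fun_space.subspace_scale[OF V] by simp
    show "hook_mat 1 r i j *\<^sub>v v \<in> ?U" if "j \<in> {1..<r}" "v \<in> ?U" for j v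
      using that(2) hook_comb_action[OF that(1), of v i] inv[OF that(1)] mult_mat_vec_carrier[OF hook_mat_carrier[of "1::complex" r i j]]
      by simp
  qed
  then show ?thesis using v by blast
qed

lemma specht_module_invariant:
  assumes w: "w permutes {1..r}" and f: "f \<in> specht_module r lam"
  shows "perm_act w f \<in> specht_module r lam"
proof -
  let ?V = "{f. perm_act w f \<in> specht_module r lam}"
  have "fun_space.subspace ?V"
  proof (rule fun_space.subspaceI)
    have "perm_act w 0 = 0" by (rule ext) (simp add: perm_act_def)
    then show "0 \<in> ?V" by (simp add: specht_module_def fun_space.span_zero)
  next
    fix f g assume "f \<in> ?V" "g \<in> ?V"
    moreover have "perm_act w (f + g) = perm_act w f + perm_act w g" by (rule ext) (simp add: perm_act_def)
    ultimately show "f + g \<in> ?V" by (simp add: specht_module_def fun_space.span_add)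
  next
    fix c f assume "f \<in> ?V"
    moreover have "perm_act w (\<lambda>x. c * f x) = (\<lambda>x. c * perm_act w f x)" by (rule ext) (simp add: perm_act_def)
    ultimately show "(\<lambda>x. c * f x) \<in> ?V" by (simp add: specht_module_def fun_space.span_scale)
  qed
  moreover have "polytabloid r ` {t. tableau r lam t} \<subseteq> ?V"
  proof (intro image_subsetI CollectI)
    fix t assume "t \<in> {t. tableau r lam t}"
    then have t: "bij_betw t {1..r} (diagram lam)" by (simp add: tableau_def)
    have "tableau r lam (t \<circ> inv_into UNIV w)"
      unfolding tableau_def by (rule bij_betw_trans[OF permutes_imp_bij[OF permutes_inv[OF w]] t])
    then show "perm_act w (polytabloid r t) \<in> specht_module r lam"
      unfolding perm_act_polytabloid[OF w] specht_module_def by (intro fun_space.span_base imageI CollectI)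
  qed
  ultimately have "specht_module r lam \<subseteq> ?V" unfolding specht_module_def by (intro fun_space.span_minimal)
  then show ?thesis using f by blast
qed

text \<open>The symmetric group acts transitively on tableaux, so a Specht module is generated by any polytabloid.\<close>

lemma tableau_relabel:
  assumes s: "tableau r lam s" and t: "tableau r lam t"
  obtains w where "w permutes {1..r}" "\<And>k. k \<in> {1..r} \<Longrightarrow> s (w k) = t k"
proof -
  define w where "w k = (if k \<in> {1..r} then inv_into {1..r} s (t k) else k)" for k
  note bs = s[unfolded tableau_def] and bt = t[unfolded tableau_def]
  have "bij_betw (inv_into {1..r} s \<circ> t) {1..r} {1..r}"
    by (rule bij_betw_trans[OF bt bij_betw_inv_into[OF bs]])
  then have "bij_betw w {1..r} {1..r}"
    by (rule bij_betw_cong[THEN iffD1, rotated]) (simp add: w_def)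
  then have "w permutes {1..r}" by (rule bij_imp_permutes) (simp only: w_def if_False)
  moreover have "s (w k) = t k" if k: "k \<in> {1..r}" for k
  proof -
    have "t k \<in> s ` {1..r}" using bij_betwE[OF bt] k bij_betw_imp_surj_on[OF bs] by blast
    then show ?thesis using k by (simp only: w_def if_True f_inv_into_f)
  qed
  ultimately show ?thesis by (rule that)
qed

text \<open>The wedge products are a basis of the Specht module, in which the word acts by the matrix of the exterior power. Independence
  and containment in the Specht module follow from irreducibility; they span because one of them is a polytabloid up to a scalar, which generates
  the module.\<close>

theorem sym_char_hook:
  assumes i: "i < r" and "is": "set is \<subseteq> {1..<r}"
  shows "sym_char r (hook r i) (word_perm is) = hook_char 1 r i is"
proof -
  let ?N = "card (hook_index r i)" and ?X = "hook_family r i" and ?L = "specht_module r (hook r i)"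
  obtain a0 where a0: "a0 < ?N" "hook_enum r i a0 = {1..i}"
    using hook_enum_surj[OF interval_mem_hook_index[OF i]] by blast
  let ?u = "unit_vec ?N a0 :: complex vec"
  define d where "d = hook_vec r i {1..i} (hook_tabloid r i)"
  have d: "d \<noteq> 0" unfolding d_def by (rule hook_vec_hook_tabloid[OF i])
  have u: "?u \<in> carrier_vec ?N" "?u \<noteq> 0\<^sub>v ?N"
    using a0 by (auto dest: arg_cong[of _ _ "\<lambda>v. vec_index v a0"])
  have comb_u: "hook_comb r i ?u = hook_vec r i {1..i}"
    unfolding hook_comb_unit[OF a0(1)] hook_family_def a0(2) ..
  also have "\<dots> = (\<lambda>x. d * polytabloid r (hook_tableau i) x)"
    unfolding d_def by (rule ext) (rule hook_vec_eq_polytabloid[OF i])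
  finally have comb_poly: "hook_comb r i ?u = (\<lambda>x. d * polytabloid r (hook_tableau i) x)" .
  have indep: "\<forall>k\<in>{..<?N}. c k = 0" if zero: "lin_comb {..<?N} c ?X = (\<lambda>_. 0)" for c
  proof (rule ccontr)
    assume "\<not> ?thesis"
    then obtain k where k: "k < ?N" "c k \<noteq> 0" by auto
    let ?v = "vec ?N c"
    have "hook_comb r i ?v = lin_comb {..<?N} c ?X"
      unfolding hook_comb_def lin_comb_def by (intro ext sum.cong refl) simp
    then have v0: "hook_comb r i ?v \<in> {0}" using zero by (simp add: zero_fun_def)
    have "?v \<noteq> 0\<^sub>v ?N" using k by (auto dest: arg_cong[of _ _ "\<lambda>v. vec_index v k"])
    moreover have "fun_space.subspace {0::(nat \<Rightarrow> nat) \<Rightarrow> complex}" by (rule fun_space.subspace_single_0)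
    moreover have "perm_act w f \<in> {0}" if "f \<in> {0}" for w and f :: "(nat \<Rightarrow> nat) \<Rightarrow> complex"
      using that by (auto simp: perm_act_def fun_eq_iff)
    ultimately have "hook_comb r i ?u \<in> {0}"
      using hook_comb_invariant[OF i _ _ _ _ v0 u(1)] by simp
    then have "hook_vec r i {1..i} (hook_tabloid r i) = 0" unfolding comb_u by simp
    then show False using d by (simp add: d_def)
  qed
  have subL: "fun_space.subspace ?L" unfolding specht_module_def by (rule fun_space.subspace_span)
  have "polytabloid r (hook_tableau i) \<in> ?L"
    unfolding specht_module_def using tableau_hook_tableau[OF i] by (intro fun_space.span_base imageI CollectI)
  then have uL: "hook_comb r i ?u \<in> ?L" unfolding comb_poly by (rule fun_space.subspace_scale[OF subL])
  have XL: "?X b \<in> ?L" if b: "b < ?N" for b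
  proof -
    have "hook_comb r i (unit_vec ?N b) \<in> ?L"
      by (rule hook_comb_invariant[OF i subL _ u uL unit_vec_carrier])
        (rule specht_module_invariant[OF transpose_simple_permutes])
    then show ?thesis by (simp only: hook_comb_unit[OF b])
  qed
  have L: "?L = fun_space.span (?X ` {..<?N})"
  proof (rule equalityI)
    show "fun_space.span (?X ` {..<?N}) \<subseteq> ?L" using XL by (intro fun_space.span_minimal subL) auto
    have "polytabloid r t \<in> fun_space.span (?X ` {..<?N})" if t: "tableau r (hook r i) t" for t
    proof -
      obtain w where w: "w permutes {1..r}" and wt: "\<And>k. k \<in> {1..r} \<Longrightarrow> hook_tableau i (w k) = t k"
        using tableau_relabel[OF tableau_hook_tableau[OF i] t] by blast
      let ?v = "inv_into UNIV w"
      have v: "?v permutes {1..r}" by (rule permutes_inv[OF w])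
      obtain js where js: "set js \<subseteq> {1..<r}" "word_perm js = ?v" using ex_shortest_word[OF v] by blast
      have "polytabloid r t = polytabloid r (hook_tableau i \<circ> w)"
        by (rule polytabloid_cong) (simp add: wt del: One_nat_def)
      also have "\<dots> = perm_act ?v (polytabloid r (hook_tableau i))"
        unfolding perm_act_polytabloid[OF v] permutes_inv_inv[OF w] ..
      also have "polytabloid r (hook_tableau i) = (\<lambda>x. inverse d * ?X a0 x)"
        using comb_poly d unfolding hook_comb_unit[OF a0(1)] by simp
      also have "perm_act ?v (\<lambda>x. inverse d * ?X a0 x) = (\<lambda>x. inverse d * perm_act ?v (?X a0) x)"
        by (simp only: perm_act_def)
      also have "perm_act ?v (?X a0) = lin_comb {..<?N} (\<lambda>a. word_mat ?N (hook_mat 1 r i) js $$ (a, a0)) ?X"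
        unfolding js(2)[symmetric] by (rule perm_act_word_hook_family[OF js(1) a0(1)])
      also have "(\<lambda>x. inverse d * lin_comb {..<?N} (\<lambda>a. word_mat ?N (hook_mat 1 r i) js $$ (a, a0)) ?X x)
         \<in> fun_space.span (?X ` {..<?N})"
        by (intro fun_space.span_scale lin_comb_in_span fun_space.span_base imageI)
      finally show ?thesis .
    qed
    then show "?L \<subseteq> fun_space.span (?X ` {..<?N})"
      unfolding specht_module_def by (intro fun_space.span_minimal fun_space.subspace_span) auto
  qed
  have "trace_on ?L (perm_act (word_perm is)) = (\<Sum>k<?N. word_mat ?N (hook_mat 1 r i) is $$ (k, k))"
    unfolding L
    by (rule trace_on_family[OF finite_lessThan indep perm_act_lin_comb])
       (simp_all only: lessThan_iff perm_act_word_hook_family[OF "is"])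
  also have "\<dots> = trace_mat (word_mat ?N (hook_mat 1 r i) is)"
    by (simp only: trace_mat_def carrier_matD(1)[OF word_hook_mat_carrier])
  also have "\<dots> = hook_char 1 r i is"
    by (simp only: trace_hook_word[OF "is"] hook_char_def)
  finally show ?thesis by (simp only: sym_char_def)
qed

section \<open>The hook characters and their sum\<close>

text \<open>The character of the exterior power of degree \<open>i\<close> over the rational functions.\<close>

definition generic_hook_char :: "nat \<Rightarrow> nat \<Rightarrow> free_alg set \<Rightarrow> ratfun" where
  "generic_hook_char r i =
    restrict (\<lambda>h. mat_trace (matrix_rep r (card (hook_index r i)) (hook_mat qq r i) h)) (carrier (hecke r))"

lemma generic_hook_char_word:
  assumes "set is \<subseteq> {1..<r}"
  shows "generic_hook_char r i (hecke_word r is) = hook_char qq r i is"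
  using hecke_word_carrier[OF assms]
  by (simp add: generic_hook_char_def mat_trace_eq matrix_rep_word[OF hook_matrices assms] trace_hook_word[OF assms]
      hook_char_def)

lemma irreducible_generic_hook_char:
  assumes "1 \<le> r" "i \<le> r - 1"
  shows "irreducible_hecke_character r (generic_hook_char r i)"
  unfolding irreducible_hecke_character_def generic_hook_char_def
  using irreducible_matrix_rep[OF schur_hook_qq[OF assms] card_hook_index_pos[OF assms]] by blast

lemma sym_char_hook_reduced:
  assumes "i < r" "w permutes {1..r}"
  shows "sym_char r (hook r i) w = hook_char 1 r i (reduced r w)"
proof -
  have "word_perm (reduced r w) = w" using reduced[OF assms(2)] by (simp add: reduced_word_def)
  with sym_char_hook[OF assms(1) reduced_subset[OF assms(2)]] show ?thesis by simp
qed

text \<open>If another irreducible character had the same specialization, orthogonality would specialize at \<open>q = 1\<close> to the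
  vanishing of the norm of the Specht character.\<close>

theorem hecke_char_hook:
  assumes r: "1 \<le> r" "i \<le> r - 1"
  shows "hecke_char r (hook r i) = generic_hook_char r i"
  unfolding hecke_char_def
proof (rule the_equality)
  have i: "i < r" using r by linarith
  have char_values: "generic_hook_char r i (hecke_Tw r w) = to_fract (hook_char poly_q r i (reduced r w))"
    "poly (hook_char poly_q r i (reduced r w)) 1 = sym_char r (hook r i) w"
    if "w permutes {1..r}" for w
    by (simp_all only: hecke_Tw_eq generic_hook_char_word[OF reduced_subset[OF that]] to_fract_hook_char
        poly_hook_char sym_char_hook_reduced[OF i that])
  show "irreducible_hecke_character r (generic_hook_char r i) \<and>
    (\<forall>w. w permutes {1..r} \<longrightarrow> (\<exists>p. generic_hook_char r i (hecke_Tw r w) = to_fract p \<and> poly p 1 = sym_char r (hook r i) w))"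
  proof (intro conjI allI impI irreducible_generic_hook_char[OF r])
    fix w :: "nat \<Rightarrow> nat" assume w: "w permutes {1..r}"
    show "\<exists>p. generic_hook_char r i (hecke_Tw r w) = to_fract p \<and> poly p 1 = sym_char r (hook r i) w"
      using char_values[OF w] by (intro exI conjI)
  qed
  fix \<chi> assume \<chi>: "irreducible_hecke_character r \<chi> \<and>
    (\<forall>w. w permutes {1..r} \<longrightarrow> (\<exists>p. \<chi> (hecke_Tw r w) = to_fract p \<and> poly p 1 = sym_char r (hook r i) w))"
  then obtain p where p: "\<And>w. w permutes {1..r} \<Longrightarrow> \<chi> (hecke_Tw r w) = to_fract (p w) \<and> poly (p w) 1 = sym_char r (hook r i) w"
    by metis
  show "\<chi> = generic_hook_char r i"
  proof (rule ccontr)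
    assume ne: "\<chi> \<noteq> generic_hook_char r i"
    let ?i = "inv_into UNIV :: (nat \<Rightarrow> nat) \<Rightarrow> nat \<Rightarrow> nat"
    let ?P = "\<lambda>w. hook_char poly_q r i (reduced r (?i w)) * p w"
    have "(\<Sum>w | w permutes {1..r}. inverse qq ^ perm_length r w * to_fract (?P w))
       = (\<Sum>w | w permutes {1..r}. inverse qq ^ perm_length r w * (generic_hook_char r i (hecke_Tw r (?i w)) * \<chi> (hecke_Tw r w)))"
    proof (rule sum.cong[OF refl])
      fix w assume "w \<in> {w. w permutes {1..r}}"
      then have w: "w permutes {1..r}" by simp
      show "inverse qq ^ perm_length r w * to_fract (?P w)
         = inverse qq ^ perm_length r w * (generic_hook_char r i (hecke_Tw r (?i w)) * \<chi> (hecke_Tw r w))"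
        by (simp only: char_values(1)[OF permutes_inv[OF w]] p[OF w] to_fract_hom.hom_mult)
    qed
    also have "\<dots> = 0"
      by (rule irreducible_characters_orthogonal[OF conjunct1[OF \<chi>] irreducible_generic_hook_char[OF r] ne])
    finally have "(\<Sum>w | w permutes {1..r}. poly (?P w) 1) = 0"
      by (rule specialize_sum_zero[OF finite_perms])
    moreover have "(\<Sum>w | w permutes {1..r}. poly (?P w) 1)
       = (\<Sum>w | w permutes {1..r}. hook_char 1 r i (reduced r (?i w)) * hook_char 1 r i (reduced r w))"
    proof (rule sum.cong[OF refl])
      fix w assume "w \<in> {w. w permutes {1..r}}"
      then have w: "w permutes {1..r}" by simp
      show "poly (?P w) 1 = hook_char 1 r i (reduced r (?i w)) * hook_char 1 r i (reduced r w)"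
        by (simp only: poly_mult poly_hook_char p[OF w] sym_char_hook_reduced[OF i w])
    qed
    ultimately show False using hook_char_norm[OF r] by simp
  qed
qed

theorem theoremB:
  fixes r :: nat and mu :: "nat list"
  assumes "1 \<le> r" and "partition_of r mu"
  shows "(\<Sum>i = 0..r - 1. hecke_char r (hook r i) (standard_element r mu)) =
         2 ^ (length mu - 1) * (\<Prod>i<length mu. qint (mu ! i) (- qq))"
proof -
  have mu: "mu \<noteq> []" "\<forall>m\<in>set mu. 0 < m" "sum_list mu = r"
    using assms by (auto simp: partition_of_def)
  have "{1..r - 1} = {1..<r}" using assms(1) by auto
  then have sub: "set (standard_word mu) \<subseteq> {1..<r}" using standard_word_subset[of mu] mu(3) by simp
  have "(\<Sum>i = 0..r - 1. hecke_char r (hook r i) (standard_element r mu))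
     = (\<Sum>i = 0..r - 1. hook_char qq r i (standard_word mu))"
  proof (rule sum.cong[OF refl])
    fix i assume "i \<in> {0..r - 1}"
    then have "i \<le> r - 1" by simp
    moreover have "standard_element r mu = hecke_word r (standard_word mu)"
      by (simp only: standard_element_def standard_word_def)
    ultimately show "hecke_char r (hook r i) (standard_element r mu) = hook_char qq r i (standard_word mu)"
      by (simp only: hecke_char_hook[OF assms(1)] generic_hook_char_word[OF sub])
  qed
  also have "\<dots> = total_char qq (r - 1) (standard_word mu)" by (rule sum_hook_char[OF assms(1)])
  also have "\<dots> = 2 ^ (length mu - 1) * (\<Prod>i<length mu. \<Sum>k<mu ! i. (- qq) ^ k)"
    using total_char_standard_word[OF mu(1,2), of qq] by (simp only: mu(3))
  also have "(\<Prod>i<length mu. \<Sum>k<mu ! i. (- qq) ^ k) = (\<Prod>i<length mu. qint (mu ! i) (- qq))"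
  proof (rule prod.cong[OF refl])
    have "- qq \<noteq> 1" using qq_nonzero(2) by (metis minus_minus)
    then show "(\<Sum>k<mu ! i. (- qq) ^ k) = qint (mu ! i) (- qq)" for i
      unfolding qint_def by (rule geometric_sum)
  qed
  finally show ?thesis .
qed

end
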